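(* Let $K$ be a convex body in $\mathbb{R}^N$ with inradius $r(K)$. Then $\mathrm{Vol}_{N-1}(\partial K)=\mathcal{H}^{N-1}(\partial K)$ and $$\mathrm{Vol}_{N-1}(\partial K)\le\frac{N}{r(K)}\,\mathrm{Vol}_N(K).$$ If $K$ is strictly convex or if $\partial K$ is $\mathcal{C}^1$, then this inequality is an equality if and only if $K$ is a ball.
   Context: A convex body is a bounded, open, nonempty convex subset of $\mathbb{R}^N$. $\mathrm{Vol}_N$ denotes Lebesgue measure in $\mathbb{R}^N$, $\mathcal{H}^{N-1}$ denotes $(N-1)$-dimensional Hausdorff measure, and for $S\subset\mathbb{R}^N$, $$\mathrm{Vol}_{N-1}(S):=\liminf_{\epsilon\to0}\frac{\mathrm{Vol}_N\{\mathbf x\in\mathbb{R}^N:\mathrm{dist}(\mathbf x,S)<\epsilon\}}{2\epsilon}.$$ The inradius $r(K)$ is the largest radius of an open ball contained in $K$. $K$ is strictly convex if for all pairs of distinct points $\mathbf x,\mathbf y\in\partial K$ the open line segment $\{t\mathbf x+(1-t)\mathbf y:0<t<1\}$ is contained in $K$. *)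

theory Defs
  imports "HOL-Analysis.Analysis"
begin

definition convex_body :: "'a::euclidean_space set \<Rightarrow> bool" where
  "convex_body K \<longleftrightarrow> bounded K \<and> open K \<and> K \<noteq> {} \<and> convex K"

definition strictly_convex :: "'a::euclidean_space set \<Rightarrow> bool" where
  "strictly_convex K \<longleftrightarrow>
    (\<forall>x\<in>frontier K. \<forall>y\<in>frontier K. x \<noteq> y \<longrightarrow> open_segment x y \<subseteq> K)"

(* The greatest element exists when K is bounded, open and nonempty. *)
definition inradius :: "'a::euclidean_space set \<Rightarrow> real" where
  "inradius K = (GREATEST r. \<exists>x. ball x r \<subseteq> K)"

(* Vol_{N-1} for N = DIM('a).  The guard S \<noteq> {} gives the convention dist(x, {}) = \<infinity>;
   the library sets infdist x {} = 0. *)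
definition codim1_volume :: "'a::euclidean_space set \<Rightarrow> ennreal" where
  "codim1_volume S =
    Liminf (at_right 0)
      (\<lambda>\<epsilon>. emeasure lebesgue {x. S \<noteq> {} \<and> infdist x S < \<epsilon>} / ennreal (2 * \<epsilon>))"

(* Hausdorff (outer) measure in the standard normalisation, where a covering set C contributes
   the volume of a d-dimensional ball of diameter diam C; this makes the d-dimensional measure
   agree with Lebesgue measure on R^d and, for d = 0, with the counting measure.
   Boundedness is required because the library's diameter is only meaningful for bounded sets,
   and the empty set is singled out because 0 ^ 0 = 1. *)
definition hausdorff_content :: "nat \<Rightarrow> real \<Rightarrow> 'a::euclidean_space set \<Rightarrow> ennreal" where
  "hausdorff_content d \<delta> S =
    (INF C \<in> {C :: nat \<Rightarrow> 'a set.
                S \<subseteq> (\<Union>i. C i) \<and> (\<forall>i. bounded (C i) \<and> diameter (C i) \<le> \<delta>)}.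
      \<Sum>i. if C i = {} then 0
           else ennreal (unit_ball_vol (real d) * (diameter (C i) / 2) ^ d))"

definition hausdorff_measure :: "nat \<Rightarrow> 'a::euclidean_space set \<Rightarrow> ennreal" where
  "hausdorff_measure d S = (SUP \<delta>\<in>{0<..}. hausdorff_content d \<delta> S)"

(* Embedded C^1 hypersurface: locally the zero set of a C^1 function g whose gradient G
   does not vanish. *)
definition C1_hypersurface :: "'a::euclidean_space set \<Rightarrow> bool" where
  "C1_hypersurface S \<longleftrightarrow>
    (\<forall>x\<in>S. \<exists>U g G. open U \<and> x \<in> U \<and>
       (\<forall>y\<in>U. GDERIV g y :> G y \<and> G y \<noteq> 0) \<and> continuous_on U G \<and>
       S \<inter> U = {y\<in>U. g y = 0})"

end

theory Submission
  imports Defs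
begin

text \<open>
  Both boundary measures are compared with the total facet area of polytopes close to
  \<open>K\<close>. For a facet \<open>F\<close> with unit normal \<open>n\<close>, the area is
  the volume of the prism \<open>F + [0,1] n\<close>, and this equals the Hausdorff measure of
  \<open>F\<close> (\<open>hausdorff_measure_flat\<close>): slicing an efficient cover by balls of
  the prism at a good height gives one inequality, and the isodiametric inequality, in a form for
  sets of thickness one (\<open>isodiametric_slab\<close>), gives the other. Hence the facet area
  of a polytope is the Hausdorff measure of its boundary (\<open>facet_area_eq_hausdorff\<close>).

  Let \<open>P\<close> be a polytope inside \<open>K\<close>. Above each facet of
  \<open>P\<close>, every normal line crosses the boundary of \<open>K\<close> and so meets its
  \<open>\<epsilon>\<close>-neighbourhood in length at least \<open>2 \<epsilon>\<close>; the
  regions above different facets are disjoint. So the facet area of \<open>P\<close> is at most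
  \<open>Vol\<^sub>N\<^sub>-\<^sub>1\<close> of the boundary of \<open>K\<close>
  (\<open>facet_area_le_codim1\<close>). Let \<open>Q\<close> be a polytope around
  \<open>K\<close>. The \<open>\<epsilon>\<close>-neighbourhood of the boundary of
  \<open>K\<close> lies in the sum of the closure of \<open>K\<close> and an
  \<open>\<epsilon>\<close>-ball, and outside the erosion of the closure by the ball. Both the
  gain of the sum and the loss of the erosion are at most, up to a factor close to one, the volume
  which \<open>Q\<close> gains when the ball is added (\<open>parallel_growth_mono\<close>). This
  holds because a ball is nearly a zonotope, and adding one segment in direction \<open>n\<close>
  increases the volume by the length of the segment times the area of the projection along
  \<open>n\<close>, which is monotone in the convex set. For \<open>Q\<close> the gain is at most
  \<open>\<epsilon>\<close> times the facet area, up to terms of lower order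
  (\<open>codim1_le_facet_area\<close>). Finally the Hausdorff measure of a convex boundary is
  monotone, because the nearest-point map is a contraction
  (\<open>hausdorff_frontier_mono\<close>). Taking \<open>P\<close> and \<open>Q\<close> between
  \<open>K\<close> and dilates of \<open>K\<close> with ratio tending to one yields equality of
  the two measures (\<open>codim1_volume_eq_hausdorff\<close>).

  For the inequality, let \<open>c\<close> be an incentre and \<open>r\<close> the inradius. As
  all support planes are at distance at least \<open>r\<close> from \<open>c\<close>, the
  \<open>\<epsilon>\<close>-neighbourhood of the boundary lies between the dilates of
  \<open>K\<close> about \<open>c\<close> with ratios \<open>1 - \<epsilon> / r\<close> and
  \<open>1 + \<epsilon> / r\<close>, and the difference of their volumes is \<open>2 \<epsilon> N
  Vol\<^sub>N(K) / r\<close> to first order. If near some boundary point all support planes are at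
  distance at least \<open>s > r\<close>, then the ratio \<open>1 - \<epsilon> / s\<close> may be
  used on the cone with apex \<open>c\<close> over a piece of the boundary, and the inequality
  becomes strict (\<open>codim1_upper_bound\<close>). Equality therefore forces a support plane at
  distance exactly \<open>r\<close> at every boundary point (\<open>equality_touching\<close>).
  Such a plane touches the inscribed ball. If \<open>K\<close> is strictly convex, the plane meets
  the closure of \<open>K\<close> only once, so the boundary point is the point of contact. If the
  boundary is \<open>C\<^sup>1\<close>, the plane is the only support plane at the point, so the
  support planes in all directions are at distance \<open>r\<close>. In both cases
  \<open>K\<close> is the ball.
\<close>

section \<open>Slicing and efficient ball covers\<close>

abbreviation vol :: "'a::euclidean_space set \<Rightarrow> ennreal" where
  "vol \<equiv> emeasure lborel"

abbreviation rvol :: "'a::euclidean_space set \<Rightarrow> real" where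
  "rvol \<equiv> measure lborel"

lemma outer_open_approx:
  fixes X :: "'a::euclidean_space set"
  assumes X: "X \<in> sets borel" and e: "e > 0"
  obtains U where "open U" "X \<subseteq> U" "vol U \<le> vol X + ennreal e"
proof -
  obtain U where U: "open U" "X \<subseteq> U" "vol (U - X) < ennreal e"
    using outer_regular_lborel[OF X e] by blast
  have "vol U = vol (X \<union> (U - X))" using U(2) by (simp add: Un_absorb1)
  also have "\<dots> \<le> vol X + vol (U - X)" using U X by (intro emeasure_subadditive) auto
  also have "\<dots> \<le> vol X + ennreal e" using U(3) by (intro add_left_mono) auto
  finally show ?thesis using that U by blast
qed

lemma nn_integral_lborel_shift:
  fixes c :: "'a::euclidean_space"
  assumes "f \<in> borel_measurable borel"
  shows "(\<integral>\<^sup>+x. f (x + c) \<partial>lborel) = (\<integral>\<^sup>+x. f x \<partial>lborel)"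
proof -
  have "(\<integral>\<^sup>+x. f x \<partial>lborel) = (\<integral>\<^sup>+x. f x \<partial>distr lborel borel ((+) c))"
    by (simp add: lborel_distr_plus)
  also have "\<dots> = (\<integral>\<^sup>+x. f (c + x) \<partial>lborel)"
    using assms by (subst nn_integral_distr) auto
  finally show ?thesis by (simp add: add.commute)
qed

text \<open>
  The fibre through \<open>x\<close> is the same line for all translates of \<open>x\<close> along
  \<open>n\<close>, and those that lie in the unit slab form an interval of length one. So
  integrating fibre lengths over the slab counts every line once. This needs only Tonelli's
  theorem and translation invariance, and works for every unit vector \<open>n\<close> without a
  change of coordinates.
\<close>

lemma vol_slices:
  fixes n :: "'a::euclidean_space"
  assumes n: "norm n = 1" and X: "X \<in> sets borel"
  shows "vol X =
    (\<integral>\<^sup>+x. indicator {x. 0 \<le> x \<bullet> n \<and> x \<bullet> n < 1} x * vol {t::real. x + t *\<^sub>R n \<in> X} \<partial>lborel)"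
proof -
  define Z where "Z = {x::'a. 0 \<le> x \<bullet> n \<and> x \<bullet> n < 1}"
  have nn: "n \<bullet> n = 1" using n by (simp add: norm_eq_1)
  have [measurable]: "Z \<in> sets borel" unfolding Z_def by measurable
  have [measurable]: "X \<in> sets borel" by fact
  have 1: "(\<integral>\<^sup>+x. indicator X (x + t *\<^sub>R n) * indicator Z x \<partial>lborel)
      = (\<integral>\<^sup>+y. indicator X y * indicator Z (y - t *\<^sub>R n) \<partial>lborel)" for t
    using nn_integral_lborel_shift[of "\<lambda>y. indicator X y * indicator Z (y - t *\<^sub>R n)" "t *\<^sub>R n"] by simp
  have 2: "(\<integral>\<^sup>+t. indicator Z (y - t *\<^sub>R n) \<partial>lborel) = (1::ennreal)" for y
  proof -
    have "(indicator Z (y - t *\<^sub>R n) :: ennreal) = indicator {y \<bullet> n - 1 <.. y \<bullet> n} t" for t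
      by (auto simp: indicator_def Z_def inner_diff_left nn)
    then show ?thesis by simp
  qed
  have "(\<integral>\<^sup>+x. indicator Z x * vol {t::real. x + t *\<^sub>R n \<in> X} \<partial>lborel)
    = (\<integral>\<^sup>+x. \<integral>\<^sup>+t. indicator X (x + t *\<^sub>R n) * indicator Z x \<partial>lborel \<partial>lborel)"
  proof (intro nn_integral_cong)
    fix x
    have m: "{t::real. x + t *\<^sub>R n \<in> X} \<in> sets borel" by measurable
    have "(\<integral>\<^sup>+t. indicator X (x + t *\<^sub>R n) * indicator Z x \<partial>lborel)
       = (\<integral>\<^sup>+t. indicator Z x * indicator {t::real. x + t *\<^sub>R n \<in> X} t \<partial>lborel)"
      by (intro nn_integral_cong) (auto simp: indicator_def)
    also have "\<dots> = indicator Z x * vol {t::real. x + t *\<^sub>R n \<in> X}"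
      using m by (subst nn_integral_cmult_indicator) auto
    finally show "indicator Z x * vol {t::real. x + t *\<^sub>R n \<in> X}
      = (\<integral>\<^sup>+t. indicator X (x + t *\<^sub>R n) * indicator Z x \<partial>lborel)" by simp
  qed
  also have "\<dots> = (\<integral>\<^sup>+t. \<integral>\<^sup>+x. indicator X (x + t *\<^sub>R n) * indicator Z x \<partial>lborel \<partial>(lborel::real measure))"
    by (rule lborel_pair.Fubini') measurable
  also have "\<dots> = (\<integral>\<^sup>+t. \<integral>\<^sup>+y. indicator X y * indicator Z (y - t *\<^sub>R n) \<partial>lborel \<partial>(lborel::real measure))"
    by (simp add: 1)
  also have "\<dots> = (\<integral>\<^sup>+y. \<integral>\<^sup>+t. indicator X y * indicator Z (y - t *\<^sub>R n) \<partial>(lborel::real measure) \<partial>lborel)"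
    by (rule lborel_pair.Fubini') measurable
  also have "\<dots> = (\<integral>\<^sup>+y. indicator X y * 1 \<partial>lborel)"
    by (intro nn_integral_cong, subst nn_integral_cmult) (auto simp: 2)
  also have "\<dots> = vol X" by simp
  finally show ?thesis unfolding Z_def ..
qed

lemma suminf_interleave:
  fixes f g :: "nat \<Rightarrow> ennreal"
  shows "(\<Sum>i. if even i then f (i div 2) else g (i div 2)) = (\<Sum>i. f i) + (\<Sum>i. g i)"
proof -
  let ?h = "\<lambda>i. if even i then f (i div 2) else g (i div 2)"
  have eq: "sum ?h {..<2*n} = sum f {..<n} + sum g {..<n}" for n
    by (induction n) (auto simp: algebra_simps)
  have "(\<lambda>n. sum ?h {..<n}) \<longlonglongrightarrow> suminf ?h" by (rule summable_LIMSEQ) auto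
  then have "(\<lambda>n. sum ?h {..<2*n}) \<longlonglongrightarrow> suminf ?h"
    by (rule LIMSEQ_subseq_LIMSEQ[unfolded o_def]) (simp add: strict_mono_def)
  moreover have "(\<lambda>n. sum ?h {..<2*n}) \<longlonglongrightarrow> suminf f + suminf g"
    unfolding eq by (intro tendsto_add summable_LIMSEQ) auto
  ultimately show ?thesis by (rule LIMSEQ_unique)
qed

text \<open>
  The family may be finite or empty, so unused indices carry a degenerate ball of radius zero.
\<close>

lemma countable_balls_enumerate:
  fixes C :: "('a::euclidean_space \<times> real) set"
  assumes "countable C" and r: "\<And>p. p \<in> C \<Longrightarrow> 0 < snd p \<and> snd p \<le> \<delta>"
    and dj: "pairwise (\<lambda>p q. disjnt (ball (fst p) (snd p)) (ball (fst q) (snd q))) C"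
    and U: "\<And>p. p \<in> C \<Longrightarrow> ball (fst p) (snd p) \<subseteq> U" and "\<delta> \<ge> 0"
    and Um: "U \<in> sets borel"
  obtains a :: "nat \<Rightarrow> 'a" and r :: "nat \<Rightarrow> real"
  where "\<And>i. 0 \<le> r i \<and> r i \<le> \<delta>" "\<And>p. p \<in> C \<Longrightarrow> \<exists>i. p = (a i, r i)"
    "(\<Sum>i. vol (ball (a i) (r i))) \<le> vol U"
proof -
  define e where "e i = (if i \<in> to_nat_on C ` C then from_nat_into C i else (0,0))" for i
  have e: "e i \<in> C \<or> e i = (0,0)" for i
    using assms(1) by (auto simp: e_def)
  have inj: "i = j" if "e i = e j" "e i \<in> C" "e j \<in> C" for i j
    using that r[of "(0,0)"] assms(1) unfolding e_def by (auto split: if_splits)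
  have sur: "\<exists>i. e i = p" if "p \<in> C" for p
    using that assms(1) by (intro exI[of _ "to_nat_on C p"]) (auto simp: e_def)
  have dis: "disjoint_family (\<lambda>i. ball (fst (e i)) (snd (e i)))"
    unfolding disjoint_family_on_def
  proof (intro ballI impI)
    fix i j :: nat assume "i \<noteq> j"
    then show "ball (fst (e i)) (snd (e i)) \<inter> ball (fst (e j)) (snd (e j)) = {}"
      using e[of i] e[of j] inj[of i j] dj
      by (auto simp: pairwise_def disjnt_def simp del: disjoint_iff)
  qed
  have "(\<Sum>i. vol (ball (fst (e i)) (snd (e i)))) = vol (\<Union>i. ball (fst (e i)) (snd (e i)))"
    using dis by (intro suminf_emeasure) auto
  also have "\<dots> \<le> vol U"
  proof (rule emeasure_mono)
    show "(\<Union>i. ball (fst (e i)) (snd (e i))) \<subseteq> U"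
    proof
      fix x assume "x \<in> (\<Union>i. ball (fst (e i)) (snd (e i)))"
      then obtain i where i: "x \<in> ball (fst (e i)) (snd (e i))" by blast
      then have "e i \<in> C" using e[of i] by auto
      with i U show "x \<in> U" by blast
    qed
  qed (use Um in auto)
  finally have s: "(\<Sum>i. vol (ball (fst (e i)) (snd (e i)))) \<le> vol U" .
  show ?thesis
  proof (rule that[of "\<lambda>i. snd (e i)" "\<lambda>i. fst (e i)"])
    show "0 \<le> snd (e i) \<and> snd (e i) \<le> \<delta>" for i
      using e[of i] r[of "e i"] \<open>\<delta> \<ge> 0\<close> by auto
    show "\<exists>i. p = (fst (e i), snd (e i))" if "p \<in> C" for p
      using sur[OF that] by auto
  qed (rule s)
qed

lemma vol_cball_eq_ball: "vol (cball a r) = vol (ball a (r::real) :: 'a::euclidean_space set)"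
  by (cases "r \<ge> 0") (auto simp: emeasure_cball emeasure_ball ball_empty)

lemma vol_cball_mult:
  assumes "k \<ge> 0" "r \<ge> 0"
  shows "vol (cball (a::'a::euclidean_space) (k * r)) = ennreal (k ^ DIM('a)) * vol (cball a r)"
  using assms by (simp add: emeasure_cball ennreal_mult[symmetric] power_mult_distrib mult_ac)

text \<open>
  Vitali's covering theorem fills \<open>U\<close> with disjoint small balls up to a null set. The
  null set is covered separately by balls of small total volume, through the covering lemma with
  fivefold enlargement. Covers that lose no volume give sharp upper bounds for Hausdorff measure
  and for the volume of contracted images.
\<close>

lemma efficient_ball_cover:
  fixes U :: "'a::euclidean_space set"
  assumes U: "open U" and \<delta>: "\<delta> > 0" and \<eta>: "\<eta> > 0"
  obtains a :: "nat \<Rightarrow> 'a" and r :: "nat \<Rightarrow> real"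
  where "\<And>i. 0 \<le> r i \<and> r i \<le> \<delta>" "U \<subseteq> (\<Union>i. cball (a i) (r i))"
    "(\<Sum>i. vol (cball (a i) (r i))) \<le> vol U + ennreal \<eta>"
proof -
  define K where "K = {p::'a \<times> real. 0 < snd p \<and> snd p \<le> \<delta> \<and> ball (fst p) (snd p) \<subseteq> U}"
  have fine: "\<exists>p. p \<in> K \<and> x \<in> ball (fst p) (snd p) \<and> snd p < d" if x: "x \<in> U" "0 < d" for x d
  proof -
    obtain e where e: "e > 0" "ball x e \<subseteq> U" using U x(1) by (meson openE)
    show ?thesis
      by (rule exI[of _ "(x, min e (min \<delta> (d/2)))"]) (use e x \<delta> in \<open>auto simp: K_def subset_iff\<close>)
  qed
  obtain C where C: "countable C" "C \<subseteq> K"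
     "pairwise (\<lambda>i j. disjnt (ball (fst i) (snd i)) (ball (fst j) (snd j))) C"
     "negligible (U - (\<Union>i \<in> C. ball (fst i) (snd i)))"
    by (rule Vitali_covering_theorem_balls[OF fine]) auto
  obtain a1 r1 where 1: "\<And>i::nat. 0 \<le> r1 i \<and> r1 i \<le> \<delta>" "\<And>p. p \<in> C \<Longrightarrow> \<exists>i. p = (a1 i, r1 i)"
    "(\<Sum>i. vol (ball (a1 i) (r1 i))) \<le> vol U"
  proof (rule countable_balls_enumerate[OF C(1) _ C(3), of \<delta> U])
    show "0 < snd p \<and> snd p \<le> \<delta>" if "p \<in> C" for p using that C(2) by (auto simp: K_def)
    show "ball (fst p) (snd p) \<subseteq> U" if "p \<in> C" for p using that C(2) by (auto simp: K_def)
  qed (use \<delta> U in auto)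
  \<comment> \<open>The remaining null set lies in an open set V of volume at most \<eta> / 5 ^ D; radii up to
    \<delta> / 5 leave room for the enlargement by five.\<close>
  define E where "E = U - (\<Union>i \<in> C. ball (fst i) (snd i))"
  define D where "D = DIM('a)"
  have "E \<in> sets lebesgue" unfolding E_def using U by (auto intro!: sets.Diff sets_completionI_sets) (simp add: borel_open open_UN)
  then obtain V where V: "open V" "E \<subseteq> V" "V - E \<in> lmeasurable" "emeasure lebesgue (V - E) < ennreal (\<eta> / 5 ^ D)"
    using sets_lebesgue_outer_open[of E "\<eta> / 5 ^ D"] \<eta> by auto
  have Veq: "(V - E) \<union> E = V" using V by auto
  have "emeasure lebesgue ((V - E) \<union> E) \<le> emeasure lebesgue (V - E) + emeasure lebesgue E"
    using V \<open>E \<in> sets lebesgue\<close> by (intro emeasure_subadditive) auto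
  also have "emeasure lebesgue E = 0"
    using C(4) \<open>E \<in> sets lebesgue\<close> negligible_iff_emeasure0 unfolding E_def by blast
  also have "emeasure lebesgue (V - E) + 0 \<le> ennreal (\<eta> / 5 ^ D)"
    using less_imp_le[OF V(4)] by (simp only: add_0_right)
  finally have "emeasure lebesgue V \<le> ennreal (\<eta> / 5 ^ D)" unfolding Veq .
  then have Vm: "vol V \<le> ennreal (\<eta> / 5 ^ D)" using V by simp
  define K2 where "K2 = {p::'a \<times> real. 0 < snd p \<and> snd p \<le> \<delta>/5 \<and> ball (fst p) (snd p) \<subseteq> V}"
  have cov: "E \<subseteq> (\<Union>p\<in>K2. ball (fst p) (snd p))"
  proof
    fix x assume "x \<in> E"
    then obtain e where e: "e > 0" "ball x e \<subseteq> V" using V by (meson openE subsetD)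
    show "x \<in> (\<Union>p\<in>K2. ball (fst p) (snd p))"
      by (rule UN_I[of "(x, min e (\<delta>/5))"]) (use e \<delta> in \<open>auto simp: K2_def subset_iff\<close>)
  qed
  obtain C2 where C2: "countable C2" "C2 \<subseteq> K2"
     "pairwise (\<lambda>i j. disjnt (ball (fst i) (snd i)) (ball (fst j) (snd j))) C2"
     "E \<subseteq> (\<Union>i\<in>C2. ball (fst i) (5 * snd i))"
    by (rule Vitali_covering_lemma_balls[OF cov, of "\<delta>/5"]) (auto simp: K2_def)
  obtain a2 r2 where 2: "\<And>i::nat. 0 \<le> r2 i \<and> r2 i \<le> \<delta>/5" "\<And>p. p \<in> C2 \<Longrightarrow> \<exists>i. p = (a2 i, r2 i)"
    "(\<Sum>i. vol (ball (a2 i) (r2 i))) \<le> vol V"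
  proof (rule countable_balls_enumerate[OF C2(1) _ C2(3), of "\<delta>/5" V])
    show "0 < snd p \<and> snd p \<le> \<delta>/5" if "p \<in> C2" for p using that C2(2) by (auto simp: K2_def)
    show "ball (fst p) (snd p) \<subseteq> V" if "p \<in> C2" for p using that C2(2) by (auto simp: K2_def)
  qed (use \<delta> V in auto)
  define a where "a i = (if even i then a1 (i div 2) else a2 (i div 2))" for i
  define r where "r i = (if even i then r1 (i div 2) else 5 * r2 (i div 2))" for i
  show ?thesis
  proof (rule that[of r a])
    show "0 \<le> r i \<and> r i \<le> \<delta>" for i
      using 1(1)[of "i div 2"] 2(1)[of "i div 2"] by (auto simp: r_def)
    show "U \<subseteq> (\<Union>i. cball (a i) (r i))"
    proof
      fix x assume x: "x \<in> U"
      show "x \<in> (\<Union>i. cball (a i) (r i))"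
      proof (cases "x \<in> E")
        case True
        then obtain p where p: "p \<in> C2" "x \<in> ball (fst p) (5 * snd p)" using C2 by blast
        then obtain i where "p = (a2 i, r2 i)" using 2 by blast
        with p have "x \<in> cball (a (2*i+1)) (r (2*i+1))" by (auto simp: a_def r_def)
        then show ?thesis by blast
      next
        case False
        then obtain p where p: "p \<in> C" "x \<in> ball (fst p) (snd p)" using x by (auto simp: E_def)
        then obtain i where "p = (a1 i, r1 i)" using 1 by blast
        with p have "x \<in> cball (a (2*i)) (r (2*i))" by (auto simp: a_def r_def)
        then show ?thesis by blast
      qed
    qed
    have "(\<Sum>i. vol (cball (a i) (r i))) =
      (\<Sum>i. if even i then vol (cball (a1 (i div 2)) (r1 (i div 2)))
            else vol (cball (a2 (i div 2)) (5 * r2 (i div 2))))"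
      by (intro suminf_cong) (auto simp: a_def r_def)
    also have "\<dots> = (\<Sum>i. vol (cball (a1 i) (r1 i))) + (\<Sum>i. vol (cball (a2 i) (5 * r2 i)))"
      by (rule suminf_interleave)
    also have "(\<Sum>i. vol (cball (a2 i) (5 * r2 i))) = ennreal (5^D) * (\<Sum>i. vol (cball (a2 i) (r2 i)))"
      using 2(1) by (simp add: vol_cball_mult D_def)
    also have "(\<Sum>i. vol (cball (a2 i) (r2 i))) \<le> ennreal (\<eta> / 5 ^ D)"
      using 2(3) Vm by (simp add: vol_cball_eq_ball)
    also have "ennreal (5^D) * ennreal (\<eta> / 5 ^ D) = ennreal \<eta>"
      using \<eta> by (simp add: ennreal_mult[symmetric])
    also have "(\<Sum>i. vol (cball (a1 i) (r1 i))) \<le> vol U"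
      using 1(3) by (simp add: vol_cball_eq_ball)
    finally show "(\<Sum>i. vol (cball (a i) (r i))) \<le> vol U + ennreal \<eta>"
      by (simp add: add_mono mult_left_mono add_left_mono)
  qed
qed

section \<open>Hausdorff measure\<close>

definition weight :: "nat \<Rightarrow> 'a::euclidean_space set \<Rightarrow> ennreal" where
  "weight d C = (if C = {} then 0 else ennreal (unit_ball_vol (real d) * (diameter C / 2) ^ d))"

definition fine_covers :: "real \<Rightarrow> 'a::euclidean_space set \<Rightarrow> (nat \<Rightarrow> 'a set) set" where
  "fine_covers \<delta> S = {C. S \<subseteq> (\<Union>i. C i) \<and> (\<forall>i. bounded (C i) \<and> diameter (C i) \<le> \<delta>)}"

lemma fine_coversD:
  assumes "C \<in> fine_covers \<delta> S"
  shows "S \<subseteq> (\<Union>i. C i)" "\<And>i. bounded (C i)" "\<And>i. diameter (C i) \<le> \<delta>"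
  using assms by (auto simp: fine_covers_def)

lemma hausdorff_content_eq: "hausdorff_content d \<delta> S = (INF C \<in> fine_covers \<delta> S. \<Sum>i. weight d (C i))"
  unfolding hausdorff_content_def weight_def fine_covers_def ..

lemma content_le_cover: "C \<in> fine_covers \<delta> S \<Longrightarrow> hausdorff_content d \<delta> S \<le> (\<Sum>i. weight d (C i))"
  unfolding hausdorff_content_eq by (rule INF_lower)

text \<open>
  Almost optimal covers of the pieces, with errors \<open>e / 2\<^sup>i\<^sup>+\<^sup>1\<close>,
  are merged into one sequence.
\<close>

lemma content_countable_subadditive:
  fixes A :: "nat \<Rightarrow> 'a::euclidean_space set"
  assumes "S \<subseteq> (\<Union>i. A i)"
  shows "hausdorff_content d \<delta> S \<le> (\<Sum>i. hausdorff_content d \<delta> (A i))"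
proof (cases "(\<Sum>i. hausdorff_content d \<delta> (A i)) = top")
  case False
  show ?thesis
  proof (rule ennreal_le_epsilon)
    fix e :: real assume e: "e > 0"
    have fin: "hausdorff_content d \<delta> (A i) < top" for i
      using False by (meson ennreal_suminf_lessD top.not_eq_extremum)
    have "\<exists>C. C \<in> fine_covers \<delta> (A i) \<and> (\<Sum>j. weight d (C j)) \<le> hausdorff_content d \<delta> (A i) + ennreal (e * (1/2) ^ Suc i)" for i
    proof -
      have "hausdorff_content d \<delta> (A i) < hausdorff_content d \<delta> (A i) + ennreal (e * (1/2) ^ Suc i)"
        using e fin[of i] by (simp add: ennreal_add_left_cancel_less[of _ 0, simplified])
      then show ?thesis
        unfolding hausdorff_content_eq[of d \<delta> "A i"] INF_less_iff by (auto intro: less_imp_le)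
    qed
    then obtain C where C: "\<And>i. C i \<in> fine_covers \<delta> (A i)"
      "\<And>i. (\<Sum>j. weight d (C i j)) \<le> hausdorff_content d \<delta> (A i) + ennreal (e * (1/2) ^ Suc i)" by metis
    define B where "B k = (case prod_decode k of (i,j) \<Rightarrow> C i j)" for k
    have BC: "B \<in> fine_covers \<delta> S"
    proof -
      have "x \<in> (\<Union>k. B k)" if xS: "x \<in> S" for x
      proof -
        obtain i where "x \<in> A i" using xS assms by blast
        moreover have "A i \<subseteq> (\<Union>j. C i j)" using C(1)[of i] unfolding fine_covers_def by simp
        ultimately obtain j where "x \<in> C i j" by blast
        then show ?thesis by (intro UN_I[of "prod_encode (i,j)"]) (auto simp: B_def)
      qed
      moreover have "bounded (B k) \<and> diameter (B k) \<le> \<delta>" for k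
        using C(1) unfolding fine_covers_def B_def by (auto split: prod.split)
      ultimately show ?thesis unfolding fine_covers_def by blast
    qed
    have "hausdorff_content d \<delta> S \<le> (\<Sum>k. weight d (B k))" using BC by (rule content_le_cover)
    also have "\<dots> = (\<Sum>k. (\<lambda>(i,j). weight d (C i j)) (prod_decode k))"
      by (intro suminf_cong) (auto simp: B_def split: prod.split)
    also have "\<dots> = (\<Sum>i. \<Sum>j. weight d (C i j))"
      by (subst suminf_ennreal_2dimen[where f="\<lambda>(i,j). weight d (C i j)"]) auto
    also have "\<dots> \<le> (\<Sum>i. hausdorff_content d \<delta> (A i) + ennreal (e * (1/2) ^ Suc i))"
      by (intro suminf_le C) auto
    also have "\<dots> = (\<Sum>i. hausdorff_content d \<delta> (A i)) + (\<Sum>i. ennreal (e * (1/2) ^ Suc i))"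
      by (rule suminf_add[symmetric]) auto
    also have "(\<Sum>i. ennreal (e * (1/2) ^ Suc i)) = ennreal e"
    proof -
      have "(\<lambda>i. e * (1/2) ^ Suc i) sums (e * 1)" by (intro sums_mult power_half_series)
      then show ?thesis using e by (subst suminf_ennreal2) (auto simp: sums_iff)
    qed
    finally show "hausdorff_content d \<delta> S \<le> (\<Sum>i. hausdorff_content d \<delta> (A i)) + ennreal e" .
  qed
qed simp

lemma content_single:
  assumes "S \<subseteq> C" "bounded C" "diameter C \<le> \<delta>" "\<delta> \<ge> 0"
  shows "hausdorff_content d \<delta> S \<le> weight d C"
proof -
  let ?C = "\<lambda>i::nat. if i = 0 then C else {}"
  have "hausdorff_content d \<delta> S \<le> (\<Sum>i. weight d (?C i))"
    by (rule content_le_cover) (use assms in \<open>auto simp: fine_covers_def intro: exI[of _ 0]\<close>)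
  also have "\<dots> = (\<Sum>i\<in>{0}. weight d (?C i))"
    by (rule suminf_finite) (auto simp: weight_def)
  also have "\<dots> = weight d C" by simp
  finally show ?thesis .
qed

lemma content_mono: "S \<subseteq> T \<Longrightarrow> hausdorff_content d \<delta> S \<le> hausdorff_content d \<delta> T"
  unfolding hausdorff_content_def by (rule INF_superset_mono) auto

lemma content_antimono: "\<delta> \<le> \<delta>' \<Longrightarrow> hausdorff_content d \<delta>' S \<le> hausdorff_content d \<delta> S"
  unfolding hausdorff_content_def by (rule INF_superset_mono) (auto intro: order_trans)

lemma hausdorff_measure_mono: "S \<subseteq> T \<Longrightarrow> hausdorff_measure d S \<le> hausdorff_measure d T"
  unfolding hausdorff_measure_def by (intro SUP_mono) (auto intro: content_mono)

lemma content_le_hausdorff: "\<delta> > 0 \<Longrightarrow> hausdorff_content d \<delta> S \<le> hausdorff_measure d S"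
  unfolding hausdorff_measure_def by (rule SUP_upper) auto

lemma content_empty: "\<delta> \<ge> 0 \<Longrightarrow> hausdorff_content d \<delta> {} = 0"
  using content_single[of "{}" "{}" \<delta> d] by (simp add: weight_def)

lemma hausdorff_measure_Un: "hausdorff_measure d (S \<union> T) \<le> hausdorff_measure d S + hausdorff_measure d T"
  unfolding hausdorff_measure_def[of d "S \<union> T"]
proof (rule SUP_least)
  fix \<delta> :: real assume "\<delta> \<in> {0<..}"
  then have \<delta>: "\<delta> > 0" by simp
  define A where "A i = (if i = 0 then S else if i = 1 then T else {})" for i :: nat
  have "hausdorff_content d \<delta> (S \<union> T) \<le> (\<Sum>i. hausdorff_content d \<delta> (A i))"
  proof (rule content_countable_subadditive)
    show "S \<union> T \<subseteq> (\<Union>i. A i)"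
    proof
      fix x assume "x \<in> S \<union> T"
      then have "x \<in> A 0 \<or> x \<in> A 1" by (auto simp: A_def)
      then show "x \<in> (\<Union>i. A i)" by blast
    qed
  qed
  also have "\<dots> = (\<Sum>i\<in>{0,1}. hausdorff_content d \<delta> (A i))"
    using \<delta> by (intro suminf_finite) (auto simp: A_def content_empty)
  also have "\<dots> \<le> hausdorff_measure d S + hausdorff_measure d T"
    using \<delta> by (auto simp: A_def intro!: add_mono content_le_hausdorff)
  finally show "hausdorff_content d \<delta> (S \<union> T) \<le> hausdorff_measure d S + hausdorff_measure d T" .
qed

lemma hausdorff_measure_empty: "hausdorff_measure d {} = 0"
  unfolding hausdorff_measure_def by (auto intro!: antisym SUP_least simp: content_empty)

lemma hausdorff_measure_UN:
  "finite I \<Longrightarrow> hausdorff_measure d (\<Union>i\<in>I. A i) \<le> (\<Sum>i\<in>I. hausdorff_measure d (A i))"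
proof (induction rule: finite_induct)
  case (insert i I)
  have "hausdorff_measure d (\<Union>i\<in>insert i I. A i) \<le> hausdorff_measure d (A i) + hausdorff_measure d (\<Union>i\<in>I. A i)"
    using hausdorff_measure_Un by simp
  also have "\<dots> \<le> hausdorff_measure d (A i) + (\<Sum>i\<in>I. hausdorff_measure d (A i))"
    using insert by (intro add_left_mono) auto
  finally show ?case using insert by simp
qed (simp add: hausdorff_measure_empty)

lemma diameter_image_lipschitz:
  fixes f :: "'a::euclidean_space \<Rightarrow> 'b::euclidean_space"
  assumes "bounded C" "L \<ge> 0" "\<And>x y. x \<in> C \<Longrightarrow> y \<in> C \<Longrightarrow> dist (f x) (f y) \<le> L * dist x y"
  shows "bounded (f ` C)" "diameter (f ` C) \<le> L * diameter C"
proof -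
  have 1: "dist (f x) (f y) \<le> L * diameter C" if "x \<in> C" "y \<in> C" for x y
    using assms that diameter_bounded_bound[OF assms(1) that]
    by (meson mult_left_mono order_trans)
  show "bounded (f ` C)"
    unfolding bounded_two_points using 1 by blast
  show "diameter (f ` C) \<le> L * diameter C"
  proof (cases "C = {}")
    case False
    then show ?thesis using 1 by (intro diameter_le) (auto simp: dist_norm)
  qed (simp add: diameter_def)
qed

text \<open>
  A cover of \<open>S\<close> with mesh \<open>\<delta> / L\<close> is mapped to a cover of the
  image with mesh \<open>\<delta>\<close>. Sets of the cover are cut down to \<open>S\<close>
  first, as \<open>f\<close> is Lipschitz only there.
\<close>

lemma hausdorff_measure_lipschitz:
  fixes f :: "'a::euclidean_space \<Rightarrow> 'a"
  assumes L: "L > 0" and lip: "\<And>x y. x \<in> S \<Longrightarrow> y \<in> S \<Longrightarrow> dist (f x) (f y) \<le> L * dist x y"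
  shows "hausdorff_measure d (f ` S) \<le> ennreal (L ^ d) * hausdorff_measure d S"
  unfolding hausdorff_measure_def[of d "f ` S"]
proof (rule SUP_least)
  fix \<delta> :: real assume "\<delta> \<in> {0<..}"
  then have \<delta>: "\<delta> > 0" by simp
  have w: "weight d (f ` (C \<inter> S)) \<le> ennreal (L ^ d) * weight d C" if "bounded C" for C
  proof (cases "C \<inter> S = {}")
    case False
    have "diameter (f ` (C \<inter> S)) \<le> L * diameter (C \<inter> S)"
      using that L lip by (intro diameter_image_lipschitz) (auto intro: bounded_subset)
    also have "\<dots> \<le> L * diameter C"
      using that L by (intro mult_left_mono diameter_subset) auto
    finally have "diameter (f ` (C \<inter> S)) / 2 \<le> L * (diameter C / 2)" by simp
    moreover have "diameter (f ` (C \<inter> S)) \<ge> 0"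
      using that L lip by (intro diameter_ge_0 diameter_image_lipschitz(1)[of _ L]) (auto intro: bounded_subset)
    ultimately have "(diameter (f ` (C \<inter> S)) / 2) ^ d \<le> (L * (diameter C / 2)) ^ d"
      by (intro power_mono) auto
    then have "unit_ball_vol (real d) * (diameter (f ` (C \<inter> S)) / 2) ^ d \<le> L ^ d * (unit_ball_vol (real d) * (diameter C / 2) ^ d)"
      unfolding power_mult_distrib by (simp add: mult_left_mono mult.left_commute)
    then show ?thesis using False L
      by (auto simp: weight_def ennreal_mult'[symmetric] intro!: ennreal_leI)
  qed (auto simp: weight_def)
  have "hausdorff_content d \<delta> (f ` S) / ennreal (L ^ d) \<le> hausdorff_content d (\<delta> / L) S"
    unfolding hausdorff_content_eq[of d "\<delta> / L"]
  proof (rule INF_greatest)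
    fix C assume "C \<in> fine_covers (\<delta> / L) S"
    note C = fine_coversD[OF this]
    have b: "bounded (f ` (C i \<inter> S))" for i
      using C(2)[of i] L lip by (intro diameter_image_lipschitz(1)[of _ L]) (auto intro: bounded_subset)
    have "diameter (f ` (C i \<inter> S)) \<le> \<delta>" for i
    proof -
      have "diameter (f ` (C i \<inter> S)) \<le> L * diameter (C i \<inter> S)"
        using C(2)[of i] L lip by (intro diameter_image_lipschitz) (auto intro: bounded_subset)
      also have "\<dots> \<le> L * diameter (C i)"
        using C(2) L by (intro mult_left_mono diameter_subset) auto
      also have "\<dots> \<le> \<delta>" using C(3)[of i] L by (simp add: field_simps)
      finally show ?thesis .
    qed
    moreover have "f ` S \<subseteq> (\<Union>i. f ` (C i \<inter> S))"
    proof
      fix y assume "y \<in> f ` S"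
      then obtain x where x: "x \<in> S" "y = f x" by blast
      then obtain i where "x \<in> C i" using C(1) by blast
      then show "y \<in> (\<Union>i. f ` (C i \<inter> S))" using x by (intro UN_I[of i]) auto
    qed
    ultimately have "hausdorff_content d \<delta> (f ` S) \<le> (\<Sum>i. weight d (f ` (C i \<inter> S)))"
      using b by (intro content_le_cover) (simp add: fine_covers_def)
    also have "\<dots> \<le> (\<Sum>i. ennreal (L ^ d) * weight d (C i))"
      by (intro suminf_le w C) auto
    also have "\<dots> = (\<Sum>i. weight d (C i)) * ennreal (L ^ d)" by (simp add: mult.commute)
    finally show "hausdorff_content d \<delta> (f ` S) / ennreal (L ^ d) \<le> (\<Sum>i. weight d (C i))"
      using L by (intro divide_le_posI_ennreal) (auto simp: mult.commute)
  qed
  also have "\<dots> \<le> hausdorff_measure d S" using \<delta> L by (intro content_le_hausdorff) auto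
  finally have "hausdorff_content d \<delta> (f ` S) / ennreal (L ^ d) \<le> hausdorff_measure d S" .
  then show "hausdorff_content d \<delta> (f ` S) \<le> ennreal (L ^ d) * hausdorff_measure d S"
  proof -
    have "hausdorff_content d \<delta> (f ` S) = hausdorff_content d \<delta> (f ` S) / ennreal (L ^ d) * ennreal (L ^ d)"
      using L by (simp add: ennreal_divide_times)
    also have "\<dots> \<le> hausdorff_measure d S * ennreal (L ^ d)"
      using \<open>hausdorff_content d \<delta> (f ` S) / ennreal (L ^ d) \<le> hausdorff_measure d S\<close>
      by (rule mult_right_mono) simp
    finally show ?thesis by (simp add: mult.commute)
  qed
qed

text \<open>
  Below the distance of the two sets, no covering set meets both of them, so a cover of the union
  splits into covers of the parts.
\<close>

lemma hausdorff_measure_separated: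
  fixes A B :: "'a::euclidean_space set"
  assumes "compact A" "compact B" "A \<inter> B = {}"
  shows "hausdorff_measure d A + hausdorff_measure d B \<le> hausdorff_measure d (A \<union> B)"
proof (cases "A = {} \<or> B = {}")
  case True
  then show ?thesis by (auto simp: hausdorff_measure_empty)
next
  case False
  define s where "s = setdist A B"
  have s: "s > 0" using assms False setdist_gt_0_compact_closed[of A B] by (simp add: s_def compact_imp_closed)
  have main: "hausdorff_content d \<delta> A + hausdorff_content d \<delta> B \<le> hausdorff_content d \<delta> (A \<union> B)" if \<delta>: "0 < \<delta>" "\<delta> < s" for \<delta>
    unfolding hausdorff_content_eq[of d \<delta> "A \<union> B"]
  proof (rule INF_greatest)
    fix C assume "C \<in> fine_covers \<delta> (A \<union> B)"
    note C = fine_coversD[OF this]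
    define CA where "CA i = (if C i \<inter> A = {} then {} else C i)" for i
    define CB where "CB i = (if C i \<inter> B = {} then {} else C i)" for i
    have sep: "C i \<inter> A = {} \<or> C i \<inter> B = {}" for i
    proof (rule ccontr)
      assume "\<not> ?thesis"
      then obtain x y where xy: "x \<in> C i" "x \<in> A" "y \<in> C i" "y \<in> B" by blast
      have "s \<le> dist x y" unfolding s_def using xy by (intro setdist_le_dist) auto
      also have "\<dots> \<le> \<delta>" using diameter_bounded_bound[OF C(2) xy(1,3)] C(3)[of i] by linarith
      finally show False using \<delta> by simp
    qed
    have "hausdorff_content d \<delta> A \<le> (\<Sum>i. weight d (CA i))"
      using C \<delta> by (intro content_le_cover) (fastforce simp: CA_def fine_covers_def)
    moreover have "hausdorff_content d \<delta> B \<le> (\<Sum>i. weight d (CB i))"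
      using C \<delta> by (intro content_le_cover) (fastforce simp: CB_def fine_covers_def)
    ultimately have "hausdorff_content d \<delta> A + hausdorff_content d \<delta> B \<le> (\<Sum>i. weight d (CA i)) + (\<Sum>i. weight d (CB i))"
      by (rule add_mono)
    also have "\<dots> = (\<Sum>i. weight d (CA i) + weight d (CB i))" by (rule suminf_add) auto
    also have "\<dots> \<le> (\<Sum>i. weight d (C i))"
    proof (intro suminf_le)
      show "weight d (CA i) + weight d (CB i) \<le> weight d (C i)" for i
        using sep[of i] by (auto simp: CA_def CB_def weight_def)
    qed auto
    finally show "hausdorff_content d \<delta> A + hausdorff_content d \<delta> B \<le> (\<Sum>i. weight d (C i))" .
  qed
  have "hausdorff_measure d A = (SUP \<delta>\<in>{0<..<s}. hausdorff_content d \<delta> A)" for A :: "'a set"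
    unfolding hausdorff_measure_def
  proof (intro antisym SUP_least)
    fix \<delta> :: real assume "\<delta> \<in> {0<..}"
    then show "hausdorff_content d \<delta> A \<le> (SUP \<delta>\<in>{0<..<s}. hausdorff_content d \<delta> A)"
      using s by (intro SUP_upper2[of "min \<delta> (s/2)"] content_antimono) auto
  qed (auto intro: SUP_upper)
  then have eq: "hausdorff_measure d A = (SUP \<delta>\<in>{0<..<s}. hausdorff_content d \<delta> A)" for A :: "'a set" .
  have "hausdorff_measure d A + hausdorff_measure d B
     = (SUP \<delta>\<in>{0<..<s}. hausdorff_content d \<delta> A + hausdorff_content d \<delta> B)"
    unfolding eq
  proof (rule SUP_add_directed_ennreal[symmetric])
    fix i j assume "i \<in> {0<..<s}" "j \<in> {0<..<s}"
    then show "\<exists>k\<in>{0<..<s}. hausdorff_content d i A + hausdorff_content d j B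
        \<le> hausdorff_content d k A + hausdorff_content d k B"
      by (intro bexI[of _ "min i j"] add_mono content_antimono) auto
  qed
  also have "\<dots> \<le> hausdorff_measure d (A \<union> B)"
    using main by (intro SUP_least) (auto intro: order_trans content_le_hausdorff)
  finally show ?thesis .
qed

lemma hausdorff_measure_disjoint_compacts:
  fixes F :: "'i \<Rightarrow> 'a::euclidean_space set"
  assumes "finite I" "\<And>i. i \<in> I \<Longrightarrow> compact (F i)" "disjoint_family_on F I"
  shows "(\<Sum>i\<in>I. hausdorff_measure d (F i)) \<le> hausdorff_measure d (\<Union>i\<in>I. F i)"
  using assms
proof (induction I rule: finite_induct)
  case (insert i I)
  have "(\<Sum>i\<in>I. hausdorff_measure d (F i)) \<le> hausdorff_measure d (\<Union>i\<in>I. F i)"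
    using insert by (intro insert.IH) (auto simp: disjoint_family_on_def)
  then have "(\<Sum>i\<in>insert i I. hausdorff_measure d (F i)) \<le> hausdorff_measure d (F i) + hausdorff_measure d (\<Union>i\<in>I. F i)"
    using insert by (simp add: add_left_mono)
  also have "\<dots> \<le> hausdorff_measure d (F i \<union> (\<Union>i\<in>I. F i))"
    using insert by (intro hausdorff_measure_separated compact_UN) (auto simp: disjoint_family_on_def)
  finally show ?case by simp
qed (simp add: hausdorff_measure_empty)

section \<open>Reflections and cylinders\<close>

text \<open>
  A contraction maps each ball of an efficient cover into a ball of the same radius.
\<close>

lemma vol_contraction_open:
  fixes f :: "'a::euclidean_space \<Rightarrow> 'a"
  assumes U: "open U" and f: "\<And>x y. dist (f x) (f y) \<le> dist x y" and fU: "f ` U \<in> sets borel"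
  shows "vol (f ` U) \<le> vol U"
proof (rule ennreal_le_epsilon)
  fix e :: real assume e: "e > 0"
  obtain a r where ar: "\<And>i::nat. 0 \<le> r i \<and> r i \<le> 1" "U \<subseteq> (\<Union>i. cball (a i) (r i))"
    "(\<Sum>i. vol (cball (a i) (r i))) \<le> vol U + ennreal e"
    by (rule efficient_ball_cover[OF U, of 1 e]) (use e in auto)
  have "f ` U \<subseteq> (\<Union>i. cball (f (a i)) (r i))"
  proof
    fix y assume "y \<in> f ` U"
    then obtain x i where "y = f x" "x \<in> cball (a i) (r i)" using ar(2) by blast
    then have "y \<in> cball (f (a i)) (r i)" using f[of "a i" x] by (auto)
    then show "y \<in> (\<Union>i. cball (f (a i)) (r i))" by blast
  qed
  then have "vol (f ` U) \<le> vol (\<Union>i. cball (f (a i)) (r i))"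
    by (intro emeasure_mono) auto
  also have "\<dots> \<le> (\<Sum>i. vol (cball (f (a i)) (r i)))"
    by (intro emeasure_subadditive_countably) auto
  also have "\<dots> = (\<Sum>i. vol (cball (a i) (r i)))"
    using ar(1) by (simp add: emeasure_cball)
  finally show "vol (f ` U) \<le> vol U + ennreal e" using ar(3) by simp
qed

text \<open>
  Since \<open>f\<close> is its own inverse, one inequality for all Borel sets suffices, and that
  one holds because \<open>f\<close> is a contraction.
\<close>

lemma vol_reflection_vimage:
  fixes f :: "'a::euclidean_space \<Rightarrow> 'a"
  assumes f: "orthogonal_transformation f" and ff: "\<And>x. f (f x) = x" and X: "X \<in> sets borel"
  shows "vol (f -` X) = vol X"
proof -
  have lin: "linear f" using f by (rule orthogonal_transformation_linear)
  have cont: "continuous_on UNIV f" using lin by (simp add: linear_continuous_on linear_linear)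
  have [measurable]: "f \<in> borel_measurable borel" using cont by (rule borel_measurable_continuous_onI)
  have d: "dist (f x) (f y) \<le> dist x y" for x y
    using f lin by (metis orthogonal_transformation_isometry order_refl)
  have im: "f -` S = f ` S" for S using ff by (auto simp: image_iff) metis
  have le: "vol (f -` X) \<le> vol X" if X: "X \<in> sets borel" for X
  proof (rule ennreal_le_epsilon)
    fix e :: real assume "e > 0"
    then obtain U where U: "open U" "X \<subseteq> U" "vol U \<le> vol X + ennreal e" using outer_open_approx[OF X] by blast
    have "vol (f -` X) \<le> vol (f -` U)"
      using U(1,2) by (intro emeasure_mono) (auto intro!: borel_open open_vimage cont)
    also have "\<dots> \<le> vol U"
      unfolding im by (rule vol_contraction_open[OF U(1) d])
       (auto simp flip: im intro!: borel_open open_vimage U(1) cont)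
    also note U(3)
    finally show "vol (f -` X) \<le> vol X + ennreal e" .
  qed
  have "f -` (f -` X) = X" using ff by auto
  moreover have "f -` X \<in> sets borel" using X measurable_sets[of f borel borel X] by simp
  ultimately show ?thesis using le[OF X] le[of "f -` X"] by auto
qed

text \<open>
  The reflection in the bisector of two vectors of equal length exchanges them. These involutions
  move any unit vector to a coordinate direction.
\<close>

lemma householder:
  fixes u v :: "'a::euclidean_space"
  assumes "norm u = norm v"
  obtains f where "orthogonal_transformation f" "\<And>x. f (f x) = x" "f u = v" "f v = u"
proof (cases "u = v")
  case True
  then show ?thesis by (intro that[of "\<lambda>x. x"]) auto
next
  case False
  define w where "w = u - v"
  define f where "f x = x - (2 * (x \<bullet> w) / (w \<bullet> w)) *\<^sub>R w" for x
  have ww: "w \<bullet> w \<noteq> 0" using False by (simp add: w_def)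
  have uw: "2 * (u \<bullet> w) = w \<bullet> w" "2 * (v \<bullet> w) = - (w \<bullet> w)"
    using assms by (auto simp: w_def inner_diff inner_commute norm_eq_sqrt_inner)
  have lin: "linear f" by (rule linearI) (auto simp: f_def algebra_simps inner_add_left add_divide_distrib)
  have "f x \<bullet> f y = x \<bullet> y" for x y
    using ww by (simp add: f_def inner_diff inner_commute field_simps)
  with lin have "orthogonal_transformation f" by (simp add: orthogonal_transformation_def)
  moreover have "f (f x) = x" for x
    using ww by (simp add: f_def inner_diff_left field_simps) 
  moreover have "f u = v" using ww by (simp add: f_def uw) (simp add: w_def)
  moreover have "f v = u" using ww by (simp add: f_def uw) (simp add: w_def)
  ultimately show ?thesis by (rule that)
qed

definition perp :: "'a::euclidean_space \<Rightarrow> 'a \<Rightarrow> 'a" where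
  "perp n x = x - (x \<bullet> n) *\<^sub>R n"

text \<open>
  In coordinates the cylinder is a product of an interval with a ball in one dimension less.
\<close>

lemma vol_cylinder_basis:
  fixes b :: "'a::euclidean_space"
  assumes b: "b \<in> Basis" and R: "R > 0" and h: "h \<ge> 0"
  shows "vol {x. norm (perp b x) \<le> R \<and> c \<le> x \<bullet> b \<and> x \<bullet> b \<le> c + h}
    = ennreal (h * (unit_ball_vol (real (DIM('a) - 1)) * R ^ (DIM('a) - 1)))"
proof -
  let ?I = "Basis - {b} :: 'a set"
  interpret product_sigma_finite "\<lambda>_. lborel :: real measure" by standard
  let ?P = "\<lambda>f. \<Sum>b\<in>Basis. f b *\<^sub>R b :: 'a"
  let ?C = "{x. norm (perp b x) \<le> R \<and> c \<le> x \<bullet> b \<and> x \<bullet> b \<le> c + h}"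
  have ins: "Basis = insert b ?I" using b by auto
  have np: "norm (perp b x) = sqrt (\<Sum>i\<in>?I. (x \<bullet> i)\<^sup>2)" for x
  proof -
    have "norm (perp b x) = sqrt (\<Sum>i\<in>Basis. (perp b x \<bullet> i)\<^sup>2)"
      by (subst euclidean_dist_l2[of "perp b x" 0, simplified dist_norm, simplified]) (simp add: L2_set_def)
    also have "(\<Sum>i\<in>Basis. (perp b x \<bullet> i)\<^sup>2) = (\<Sum>i\<in>?I. (perp b x \<bullet> i)\<^sup>2)"
      using b by (subst ins, subst sum.insert) (auto simp: perp_def inner_diff_left)
    also have "\<dots> = (\<Sum>i\<in>?I. (x \<bullet> i)\<^sup>2)"
      using b by (intro sum.cong) (auto simp: perp_def inner_diff_left inner_Basis)
    finally show ?thesis .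
  qed
  have Cm: "?C \<in> sets borel" unfolding perp_def by measurable
  have "vol ?C = emeasure (Pi\<^sub>M Basis (\<lambda>_. lborel)) (?P -` ?C \<inter> space (Pi\<^sub>M Basis (\<lambda>_. lborel)))"
    by (subst lborel_eq, subst emeasure_distr) (use Cm in auto)
  also have "?P -` ?C = {f. sqrt (\<Sum>i\<in>?I. (f i)\<^sup>2) \<le> R \<and> c \<le> f b \<and> f b \<le> c + h}"
    using b by (auto simp: np inner_sum_left inner_Basis if_distrib sum.delta cong: if_cong)
  also have "emeasure (Pi\<^sub>M Basis (\<lambda>_. lborel)) (\<dots> \<inter> space (Pi\<^sub>M Basis (\<lambda>_. lborel)))
    = nn_integral (Pi\<^sub>M (insert b ?I) (\<lambda>_. lborel)) (indicator ({f. sqrt (\<Sum>i\<in>?I. (f i)\<^sup>2) \<le> R \<and> c \<le> f b \<and> f b \<le> c + h} \<inter> space (Pi\<^sub>M (insert b ?I) (\<lambda>_. lborel))))"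
    unfolding ins[symmetric] using b by (subst nn_integral_indicator) auto
  also have "\<dots> = (\<integral>\<^sup>+ y. \<integral>\<^sup>+ x. indicator ({f. sqrt (\<Sum>i\<in>?I. (f i)\<^sup>2) \<le> R \<and> c \<le> f b \<and> f b \<le> c + h} \<inter> space (Pi\<^sub>M (insert b ?I) (\<lambda>_. lborel))) (x(b := y))
                   \<partial>Pi\<^sub>M ?I (\<lambda>_. lborel) \<partial>lborel)"
    by (subst product_nn_integral_insert_rev) auto
  also have "\<dots> = (\<integral>\<^sup>+ (y::real). \<integral>\<^sup>+ x. indicator {c..c+h} y * indicator ({f. sqrt (\<Sum>i\<in>?I. (f i)\<^sup>2) \<le> R} \<inter> space (Pi\<^sub>M ?I (\<lambda>_. lborel))) x \<partial>Pi\<^sub>M ?I (\<lambda>_. lborel) \<partial>lborel)"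
  proof (intro nn_integral_cong, goal_cases)
    case (1 y f)
    have "(\<Sum>x\<in>?I. (if x = b then y else f x)\<^sup>2) = (\<Sum>x\<in>?I. (f x)\<^sup>2)"
      by (intro sum.cong) auto
    then show ?case using 1 using b by (auto simp: indicator_def PiE_def space_PiM insert_absorb extensional_def)
  qed
  also have "\<dots> = (\<integral>\<^sup>+ (y::real). ennreal (unit_ball_vol (real (card ?I)) * R ^ card ?I) * indicator {c..c+h} y \<partial>lborel)"
    using R by (intro nn_integral_cong, subst nn_integral_cmult, force, subst nn_integral_indicator, force, subst emeasure_cball_aux)
       (auto simp: mult.commute)
  also have "\<dots> = ennreal (unit_ball_vol (real (card ?I)) * R ^ card ?I) * ennreal h"
    using h by (subst nn_integral_cmult_indicator) auto
  finally show ?thesis using b R h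
    by (simp add: ennreal_mult[symmetric] mult_ac)
qed

lemma vol_cylinder:
  fixes n :: "'a::euclidean_space"
  assumes n: "norm n = 1" and R: "R > 0" and h: "h \<ge> 0"
  shows "vol {x. norm (perp n x) \<le> R \<and> c \<le> x \<bullet> n \<and> x \<bullet> n \<le> c + h}
    = ennreal (h * (unit_ball_vol (real (DIM('a) - 1)) * R ^ (DIM('a) - 1)))"
proof -
  obtain b :: 'a where b: "b \<in> Basis" using nonempty_Basis by blast
  obtain f :: "'a \<Rightarrow> 'a" where f: "orthogonal_transformation f" "\<And>x. f (f x) = x" "f n = b"
    using householder[of n b] n b by auto
  have lin: "linear f" using f by (simp add: orthogonal_transformation_linear)
  have ib: "f x \<bullet> b = x \<bullet> n" for x
    using f by (metis orthogonal_transformation_def)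
  have "perp b (f x) = f (perp n x)" for x
    by (simp add: perp_def ib f(3) linear_diff[OF lin] linear_scale[OF lin])
  then have np: "norm (perp b (f x)) = norm (perp n x)" for x
    using f by (simp add: orthogonal_transformation_norm)
  let ?C = "{x. norm (perp b x) \<le> R \<and> c \<le> x \<bullet> b \<and> x \<bullet> b \<le> c + h}"
  have "{x. norm (perp n x) \<le> R \<and> c \<le> x \<bullet> n \<and> x \<bullet> n \<le> c + h} = f -` ?C"
    by (auto simp: np ib)
  also have "vol \<dots> = vol ?C"
    by (rule vol_reflection_vimage[OF f(1,2)]) (unfold perp_def, measurable)
  finally show ?thesis by (simp add: vol_cylinder_basis[OF b R h])
qed

section \<open>Hausdorff measure of flat sets\<close>

definition prism :: "'a::euclidean_space \<Rightarrow> 'a set \<Rightarrow> real \<Rightarrow> 'a set" where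
  "prism n F h = (\<lambda>(x,t). x + t *\<^sub>R n) ` (F \<times> {0..h})"

lemma compact_prism: "compact F \<Longrightarrow> compact (prism n F h)"
  unfolding prism_def
  by (rule compact_continuous_image) (auto intro!: continuous_intros compact_Times simp: case_prod_beta)

lemma norm_perp: "norm n = 1 \<Longrightarrow> (norm (perp n x))\<^sup>2 = (norm x)\<^sup>2 - (x \<bullet> n)\<^sup>2"
  by (simp only: power2_norm_eq_inner) (simp add: perp_def inner_diff inner_commute norm_eq_1 power2_eq_square algebra_simps)

lemma norm_perp_le: "norm n = 1 \<Longrightarrow> norm (perp n x) \<le> norm x"
  by (rule power2_le_imp_le) (auto simp: norm_perp)

lemma linear_perp: "linear (perp n)"
  by (rule linearI) (auto simp: perp_def algebra_simps inner_add_left)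

text \<open>
  Slices of a ball by parallel hyperplanes are balls with one dimension less; the volumes add up
  by the Beta integral.
\<close>

lemma ball_slice_integral:
  assumes r: "r \<ge> 0"
  shows "(\<integral>\<^sup>+t. indicator {c - r..c + r} t * ennreal (unit_ball_vol (real d) * sqrt (r\<^sup>2 - (t - c)\<^sup>2) ^ d) \<partial>lborel)
    = ennreal (unit_ball_vol (real (Suc d)) * r ^ Suc d)"
proof (cases "r = 0")
  case True
  have "(\<integral>\<^sup>+t. indicator {c - r..c + r} t * ennreal (unit_ball_vol (real d) * sqrt (r\<^sup>2 - (t - c)\<^sup>2) ^ d) \<partial>lborel)
     = (\<integral>\<^sup>+t. 0 \<partial>(lborel::real measure))"
    by (intro nn_integral_cong_AE AE_I[of _ _ "{c}"]) (auto simp: True indicator_def)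
  then show ?thesis using True by simp
next
  case False
  with r have r: "r > 0" by simp
  have "(\<integral>\<^sup>+t. indicator {c - r..c + r} t * ennreal (unit_ball_vol (real d) * sqrt (r\<^sup>2 - (t - c)\<^sup>2) ^ d) \<partial>lborel)
    = ennreal r * (\<integral>\<^sup>+s. indicator {c - r..c + r} (c + r * s) * ennreal (unit_ball_vol (real d) * sqrt (r\<^sup>2 - ((c + r * s) - c)\<^sup>2) ^ d) \<partial>lborel)"
    using r by (subst nn_integral_real_affine[of _ r c]) auto
  also have "(\<integral>\<^sup>+s. indicator {c - r..c + r} (c + r * s) * ennreal (unit_ball_vol (real d) * sqrt (r\<^sup>2 - ((c + r * s) - c)\<^sup>2) ^ d) \<partial>lborel)
    = (\<integral>\<^sup>+s. ennreal (unit_ball_vol (real d) * r ^ d) * ennreal (indicator {-1..1} s * sqrt (1 - s\<^sup>2) ^ d) \<partial>lborel)"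
  proof (rule nn_integral_cong)
    fix s :: real
    have "c + r * s \<in> {c - r..c + r} \<longleftrightarrow> s \<in> {-1..1}"
      using r mult_le_cancel_left_pos[of r s 1] mult_le_cancel_left_pos[of r "-1" s] by auto
    moreover have "r\<^sup>2 - ((c + r * s) - c)\<^sup>2 = r\<^sup>2 * (1 - s\<^sup>2)" by (simp add: algebra_simps power_mult_distrib)
    then have "sqrt (r\<^sup>2 - ((c + r * s) - c)\<^sup>2) = r * sqrt (1 - s\<^sup>2)" using r by (simp add: real_sqrt_mult)
    ultimately show "indicator {c - r..c + r} (c + r * s) * ennreal (unit_ball_vol (real d) * sqrt (r\<^sup>2 - ((c + r * s) - c)\<^sup>2) ^ d)
       = ennreal (unit_ball_vol (real d) * r ^ d) * ennreal (indicator {-1..1} s * sqrt (1 - s\<^sup>2) ^ d)"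
      using r by (auto simp: indicator_def power_mult_distrib ennreal_mult'[symmetric] mult_ac)
  qed
  also have "\<dots> = ennreal (unit_ball_vol (real d) * r ^ d) * ennreal (Beta (1/2) (real d / 2 + 1))"
    by (subst nn_integral_cmult) (auto simp: emeasure_cball_aux_integral)
  also have "ennreal r * \<dots> = ennreal ((unit_ball_vol (real d) * Beta (1/2) (real d / 2 + 1)) * r ^ Suc d)"
    using r by (simp add: ennreal_mult'[symmetric] mult_ac)
  also have "unit_ball_vol (real d) * Beta (1/2) (real d / 2 + 1) = unit_ball_vol (Suc d)"
    by (auto simp: unit_ball_vol_def Beta_def Gamma_eq_zero_iff field_simps
          Gamma_one_half_real powr_half_sqrt [symmetric] powr_add [symmetric])
  finally show ?thesis .
qed

text \<open>
  Take an efficient cover by balls of a neighbourhood of the prism of height one. The slices of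
  the balls at height \<open>t\<close> cover a translate of \<open>F\<close>, and averaged over
  \<open>t\<close> their total weight is at most the total volume of the balls. Hence some height
  gives a cover of \<open>F\<close> of almost that weight.
\<close>

lemma hausdorff_le_prism:
  fixes F :: "'a::euclidean_space set"
  assumes n: "norm n = 1" and F: "compact F" "\<And>x. x \<in> F \<Longrightarrow> x \<bullet> n = b"
  shows "hausdorff_measure (DIM('a) - 1) F \<le> vol (prism n F 1)"
  unfolding hausdorff_measure_def
proof (rule SUP_least)
  fix \<delta> :: real assume "\<delta> \<in> {0<..}"
  then have \<delta>: "\<delta> > 0" by simp
  define d where "d = DIM('a) - 1"
  have Dd: "DIM('a) = Suc d" using DIM_positive[where 'a='a] unfolding d_def by linarith
  have nn: "n \<bullet> n = 1" using n by (simp add: norm_eq_1)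
  define v where "v = vol (prism n F 1)"
  have vfin: "v < top" unfolding v_def using emeasure_compact_finite[OF compact_prism[OF F(1)]] by simp
  have "hausdorff_content d \<delta> F \<le> v"
  proof (rule ennreal_le_epsilon)
    fix e :: real assume e: "e > 0"
    have cm: "prism n F 1 \<in> sets borel" using compact_prism[OF F(1)] by (simp add: borel_compact)
    obtain U where U: "open U" "prism n F 1 \<subseteq> U" and Uv: "vol U \<le> v + ennreal (e/3)"
      using outer_open_approx[OF cm, of "e/3"] e unfolding v_def by auto
    obtain a r where ar: "\<And>i::nat. 0 \<le> r i \<and> r i \<le> \<delta>/2" "U \<subseteq> (\<Union>i. cball (a i) (r i))"
      "(\<Sum>i. vol (cball (a i) (r i))) \<le> vol U + ennreal (e/3)"
      by (rule efficient_ball_cover[OF U(1), of "\<delta>/2" "e/3"]) (use \<delta> e in auto)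
    define g where "g i t = indicator {a i \<bullet> n - r i..a i \<bullet> n + r i} t * ennreal (unit_ball_vol (real d) * sqrt ((r i)\<^sup>2 - (t - a i \<bullet> n)\<^sup>2) ^ d)" for i t
    have [measurable]: "g i \<in> borel_measurable borel" for i unfolding g_def by measurable
    have "(\<integral>\<^sup>+t. g i t \<partial>lborel) = vol (cball (a i) (r i))" for i
      unfolding g_def using ar(1)[of i] by (subst ball_slice_integral) (auto simp: emeasure_cball Dd)
    then have "(\<integral>\<^sup>+t. (\<Sum>i. g i t) \<partial>lborel) = (\<Sum>i. vol (cball (a i) (r i)))"
      by (subst nn_integral_suminf) auto
    also have "\<dots> \<le> (v + ennreal (e/3)) + ennreal (e/3)"
      using ar(3) Uv by (meson add_right_mono order_trans)
    also have "\<dots> < v + ennreal e"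
    proof -
      have "v + ennreal (e/3) + ennreal (e/3) = v + ennreal (2*e/3)"
        using e by (simp add: add.assoc ennreal_plus[symmetric] del: ennreal_plus)
      also have "\<dots> < v + ennreal e" using e vfin by (simp add: ennreal_add_left_cancel_less ennreal_less_iff)
      finally show ?thesis .
    qed
    finally have int: "(\<integral>\<^sup>+t. (\<Sum>i. g i t) \<partial>lborel) < v + ennreal e" .
    \<comment> \<open>An average over an interval of length one is attained or undercut somewhere.\<close>
    have "\<exists>t\<in>{b..b+1}. (\<Sum>i. g i t) \<le> v + ennreal e"
    proof (rule ccontr)
      assume *: "\<not> ?thesis"
      have "v + ennreal e = (\<integral>\<^sup>+t. (v + ennreal e) * indicator {b..b+1} t \<partial>lborel)"
        by (subst nn_integral_cmult_indicator) auto
      also have "\<dots> \<le> (\<integral>\<^sup>+t. (\<Sum>i. g i t) \<partial>lborel)"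
        using * by (intro nn_integral_mono) (auto simp: indicator_def not_le intro: less_imp_le)
      finally show False using int by simp
    qed
    then obtain t where t: "b \<le> t" "t \<le> b + 1" "(\<Sum>i. g i t) \<le> v + ennreal e" by auto
    \<comment> \<open>The slices are translated back from height t to the hyperplane of F.\<close>
    define A where "A i = {x. x \<bullet> n = b \<and> x + (t - b) *\<^sub>R n \<in> cball (a i) (r i)}" for i
    have "F \<subseteq> (\<Union>i. A i)"
    proof
      fix x assume x: "x \<in> F"
      have "x + (t - b) *\<^sub>R n \<in> prism n F 1"
        unfolding prism_def using x t by (intro image_eqI[of _ _ "(x, t - b)"]) auto
      then obtain i where "x + (t - b) *\<^sub>R n \<in> cball (a i) (r i)" using U(2) ar(2) by blast
      then show "x \<in> (\<Union>i. A i)" using F(2)[OF x] by (auto simp: A_def)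
    qed
    then have "hausdorff_content d \<delta> F \<le> (\<Sum>i. hausdorff_content d \<delta> (A i))"
      by (rule content_countable_subadditive)
    also have "\<dots> \<le> (\<Sum>i. g i t)"
    proof (rule suminf_le)
      fix i
      show "hausdorff_content d \<delta> (A i) \<le> g i t"
      proof (cases "A i = {}")
        case True
        then show ?thesis using \<delta> by (simp add: content_empty)
      next
        case False
        define \<rho> where "\<rho> = sqrt ((r i)\<^sup>2 - (t - a i \<bullet> n)\<^sup>2)"
        define c where "c = a i + (b - a i \<bullet> n) *\<^sub>R n"
        have *: "(t - a i \<bullet> n)\<^sup>2 \<le> (r i)\<^sup>2 \<and> norm (x - c) \<le> \<rho>" if "x \<in> A i" for x
        proof -
          define y where "y = x + (t - b) *\<^sub>R n"
          have xn: "x \<bullet> n = b" using that by (simp add: A_def)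
          have yn: "(y - a i) \<bullet> n = t - a i \<bullet> n" by (simp add: y_def inner_diff_left inner_add_left xn nn)
          have "x - c = perp n (y - a i)" unfolding perp_def yn by (simp add: y_def c_def algebra_simps)
          then have "(norm (x - c))\<^sup>2 = (norm (y - a i))\<^sup>2 - (t - a i \<bullet> n)\<^sup>2"
            using norm_perp[OF n, of "y - a i"] yn by simp
          also have "\<dots> \<le> (r i)\<^sup>2 - (t - a i \<bullet> n)\<^sup>2"
            using that by (auto simp: A_def y_def dist_norm norm_minus_commute intro!: power_mono)
          finally have "(norm (x - c))\<^sup>2 \<le> (r i)\<^sup>2 - (t - a i \<bullet> n)\<^sup>2" .
          moreover from this have "0 \<le> (r i)\<^sup>2 - (t - a i \<bullet> n)\<^sup>2" by (meson order_trans zero_le_power2)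
          ultimately show ?thesis unfolding \<rho>_def using real_le_rsqrt by auto
        qed
        from False have tr: "(t - a i \<bullet> n)\<^sup>2 \<le> (r i)\<^sup>2" using * by blast
        then have "\<bar>t - a i \<bullet> n\<bar> \<le> r i" using ar(1)[of i] by (simp add: abs_le_square_iff[symmetric])
        then have gi: "g i t = ennreal (unit_ball_vol (real d) * \<rho> ^ d)"
          by (auto simp: g_def \<rho>_def indicator_def)
        have \<rho>0: "\<rho> \<ge> 0" unfolding \<rho>_def using tr by simp
        have \<rho>r: "\<rho> \<le> r i" unfolding \<rho>_def using ar(1)[of i] by (intro real_le_lsqrt) auto
        have sub: "A i \<subseteq> cball c \<rho>" using * by (auto simp: dist_norm norm_minus_commute)
        then have bd: "bounded (A i)" using bounded_cball bounded_subset by blast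
        have dm: "diameter (A i) \<le> 2 * \<rho>"
          using diameter_subset[OF sub bounded_cball] \<rho>0 by simp
        have "hausdorff_content d \<delta> (A i) \<le> ennreal (unit_ball_vol (real d) * (diameter (A i) / 2) ^ d)"
          using content_single[of "A i" "A i" \<delta> d] bd dm \<rho>r ar(1)[of i] \<delta> False by (auto simp: weight_def)
        also have "\<dots> \<le> g i t" unfolding gi
          using dm diameter_ge_0[OF bd] by (intro ennreal_leI mult_left_mono power_mono) auto
        finally show ?thesis .
      qed
    qed auto
    finally show "hausdorff_content d \<delta> F \<le> v + ennreal e" using t(3) by simp
  qed
  then show "hausdorff_content (DIM('a) - 1) \<delta> F \<le> vol (prism n F 1)"
    by (simp add: d_def v_def)
qed

text \<open>
  With \<open>m\<close> and \<open>M\<close> the least and greatest elements of \<open>A\<close>,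
  the halved copies \<open>(A - m) / 2\<close> and \<open>(A - M) / 2\<close> lie in the
  half-difference set on opposite sides of zero, and each has half the length of \<open>A\<close>.
\<close>

lemma emeasure_half_difference_real:
  fixes A B :: "real set"
  assumes A: "compact A" and B: "B \<in> sets borel" and AB: "\<And>s t. s \<in> A \<Longrightarrow> t \<in> A \<Longrightarrow> (s - t) / 2 + k \<in> B"
  shows "vol A \<le> vol B"
proof (cases "A = {}")
  case False
  obtain m where m: "m \<in> A" "\<And>t. t \<in> A \<Longrightarrow> m \<le> t" using compact_attains_inf[OF A False] by auto
  obtain M where M: "M \<in> A" "\<And>t. t \<in> A \<Longrightarrow> t \<le> M" using compact_attains_sup[OF A False] by auto
  define B1 where "B1 = (\<lambda>s. (1/2) *\<^sub>R s + (k - m/2)) ` A"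
  define B2 where "B2 = (\<lambda>s. (1/2) *\<^sub>R s + (k - M/2)) ` A"
  have c: "compact B1" "compact B2" unfolding B1_def B2_def
    using A by (auto intro!: compact_continuous_image continuous_intros)
  then have bm: "B1 \<in> sets borel" "B2 \<in> sets borel" by (auto simp: borel_compact)
  have e: "vol ((\<lambda>s. (1/2) *\<^sub>R s + c) ` A) = ennreal (1/2) * vol A"
    if "(\<lambda>s. (1/2) *\<^sub>R s + c) ` A \<in> sets borel" for c
    using emeasure_lebesgue_affine[of "1/2" c A] that A by (simp add: borel_compact)
  have half: "ennreal (1/2) * z + ennreal (1/2) * z = z" for z
    by (simp add: distrib_right[symmetric] ennreal_plus[symmetric] del: ennreal_plus ennreal_half)
  have "vol A = vol B1 + vol B2"
    using e[of "k - m/2"] e[of "k - M/2"] bm unfolding B1_def[symmetric] B2_def[symmetric]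
    by (simp only: half)
  also have "vol B2 = vol (B2 - {k})"
    using bm by (intro emeasure_Diff_null_set[symmetric]) auto
  also have "vol B1 + vol (B2 - {k}) = vol (B1 \<union> (B2 - {k}))"
    using bm m(2) M(2) by (intro plus_emeasure) (force simp: B1_def B2_def)+
  also have "\<dots> \<le> vol B"
  proof (rule emeasure_mono)
    show "B1 \<union> (B2 - {k}) \<subseteq> B"
      using AB[OF _ m(1)] AB[OF _ M(1)] by (auto simp: B1_def B2_def diff_divide_distrib algebra_simps)
  qed (use B in simp)
  finally show ?thesis .
qed simp

text \<open>
  A variant of Steiner symmetrisation: a fibre \<open>A\<close> in direction \<open>b\<close> is
  replaced by \<open>(A - A) / 2\<close> instead of a centred interval of the same length. The
  result is a continuous image of a compact set of pairs, so no measurability question arises.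
\<close>

definition symmetrize :: "'a::euclidean_space \<Rightarrow> 'a set \<Rightarrow> 'a set" where
  "symmetrize b X = (\<lambda>(x,y). perp b x + ((x \<bullet> b - y \<bullet> b) / 2) *\<^sub>R b) ` {(x,y). x \<in> X \<and> y \<in> X \<and> perp b x = perp b y}"

lemma compact_symmetrize:
  assumes "compact X" shows "compact (symmetrize b X)"
proof -
  have "{(x,y). x \<in> X \<and> y \<in> X \<and> perp b x = perp b y} = (X \<times> X) \<inter> {p. perp b (fst p) = perp b (snd p)}" by auto
  moreover have "closed {p. perp b (fst p) = perp b (snd p)}"
    unfolding perp_def by (intro closed_Collect_eq continuous_intros)
  ultimately have "compact {(x,y). x \<in> X \<and> y \<in> X \<and> perp b x = perp b y}"
    using assms by (simp add: compact_Int_closed compact_Times)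
  then show ?thesis unfolding symmetrize_def perp_def
    by (intro compact_continuous_image) (auto intro!: continuous_intros simp: case_prod_beta)
qed

lemma compact_fibre:
  fixes n :: "'a::euclidean_space"
  assumes A: "compact A" and n: "norm n = 1"
  shows "compact {t::real. x + t *\<^sub>R n \<in> A}"
proof -
  have "closed ((\<lambda>t::real. x + t *\<^sub>R n) -` A)"
    using A by (intro closed_vimage continuous_intros) (auto simp: compact_imp_closed)
  moreover obtain B where B: "\<And>y. y \<in> A \<Longrightarrow> norm y \<le> B" using A compact_imp_bounded bounded_iff by metis
  have "norm t \<le> B + norm x" if "x + t *\<^sub>R n \<in> A" for t
  proof -
    have "\<bar>t\<bar> = norm ((x + t *\<^sub>R n) - x)" using n by simp
    also have "\<dots> \<le> B + norm x" using B[OF that] norm_triangle_ineq4[of "x + t *\<^sub>R n" x] by linarith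
    finally show ?thesis by simp
  qed
  then have "bounded {t::real. x + t *\<^sub>R n \<in> A}" by (auto simp: bounded_iff)
  ultimately show ?thesis by (simp add: compact_eq_bounded_closed vimage_def)
qed

lemma vol_symmetrize_ge:
  fixes b :: "'a::euclidean_space"
  assumes b: "norm b = 1" and X: "compact X"
  shows "vol X \<le> vol (symmetrize b X)"
proof -
  have bb: "b \<bullet> b = 1" using b by (simp add: norm_eq_1)
  have Xm: "X \<in> sets borel" and Ym: "symmetrize b X \<in> sets borel"
    using X compact_symmetrize[OF X] by (auto simp: borel_compact)
  have "vol {t::real. x + t *\<^sub>R b \<in> X} \<le> vol {t::real. x + t *\<^sub>R b \<in> symmetrize b X}" for x
  proof (rule emeasure_half_difference_real)
    show "compact {t::real. x + t *\<^sub>R b \<in> X}" by (rule compact_fibre[OF X b])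
    show "{t::real. x + t *\<^sub>R b \<in> symmetrize b X} \<in> sets borel"
      by (rule borel_compact[OF compact_fibre[OF compact_symmetrize[OF X] b]])
    fix s t :: real assume st: "s \<in> {t. x + t *\<^sub>R b \<in> X}" "t \<in> {t. x + t *\<^sub>R b \<in> X}"
    \<comment> \<open>The symmetrised fibre is centred on the hyperplane orthogonal to b, whose parameter on
      the line through x is - (x \<bullet> b).\<close>
    have "x + ((s - t) / 2 + - (x \<bullet> b)) *\<^sub>R b \<in> symmetrize b X"
      unfolding symmetrize_def using st
      by (intro image_eqI[of _ _ "(x + s *\<^sub>R b, x + t *\<^sub>R b)"])
         (auto simp: perp_def inner_add_left bb algebra_simps)
    then show "(s - t) / 2 + - (x \<bullet> b) \<in> {t. x + t *\<^sub>R b \<in> symmetrize b X}" by simp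
  qed
  then show ?thesis
    unfolding vol_slices[OF b Xm] vol_slices[OF b Ym]
    by (intro nn_integral_mono mult_left_mono) auto
qed

definition reflect :: "'a::euclidean_space \<Rightarrow> 'a \<Rightarrow> 'a" where
  "reflect b x = x - (2 * (x \<bullet> b)) *\<^sub>R b"

text \<open>
  Compact sets of thickness at most one in direction \<open>n\<close> whose projection along
  \<open>n\<close> has diameter at most \<open>D\<close>.
\<close>

definition in_slab :: "'a::euclidean_space \<Rightarrow> real \<Rightarrow> real \<Rightarrow> 'a set \<Rightarrow> bool" where
  "in_slab n c D X \<longleftrightarrow> compact X \<and> (\<forall>x\<in>X. c \<le> x \<bullet> n \<and> x \<bullet> n \<le> c + 1) \<and> (\<forall>x\<in>X. \<forall>y\<in>X. norm (perp n (x - y)) \<le> D)"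

text \<open>
  Let two pairs of points, each pair on one fibre, give the symmetrised points. If their
  \<open>b\<close>-components differ by \<open>\<alpha>\<close> and \<open>\<beta>\<close>, those
  of the symmetrised points differ by \<open>(\<alpha> - \<beta>) / 2\<close>, whose square is at
  most the mean of \<open>\<alpha>\<^sup>2\<close> and \<open>\<beta>\<^sup>2\<close>. The other
  components are unchanged, so the bound on the width orthogonal to \<open>n\<close> survives.
\<close>

lemma in_slab_symmetrize:
  assumes X: "in_slab n c D X" and n: "norm n = 1" and b: "norm b = 1" and bn: "b \<bullet> n = 0" and D: "D \<ge> 0"
  shows "in_slab n c D (symmetrize b X)"
  unfolding in_slab_def
proof (intro conjI ballI)
  have bb: "b \<bullet> b = 1" using b by (simp add: norm_eq_1)
  have nb: "n \<bullet> b = 0" using bn by (simp add: inner_commute)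
  show "compact (symmetrize b X)" using X by (simp add: in_slab_def compact_symmetrize)
  fix p assume p: "p \<in> symmetrize b X"
  then obtain x y where xy: "x \<in> X" "y \<in> X" "perp b x = perp b y" "p = perp b x + ((x \<bullet> b - y \<bullet> b) / 2) *\<^sub>R b"
    by (auto simp: symmetrize_def)
  have "p \<bullet> n = x \<bullet> n" unfolding xy(4) by (simp add: perp_def inner_add_left inner_diff_left bn)
  then show "c \<le> p \<bullet> n" "p \<bullet> n \<le> c + 1" using X xy(1) by (auto simp: in_slab_def)
  fix q assume q: "q \<in> symmetrize b X"
  then obtain x' y' where xy': "x' \<in> X" "y' \<in> X" "perp b x' = perp b y'" "q = perp b x' + ((x' \<bullet> b - y' \<bullet> b) / 2) *\<^sub>R b"
    by (auto simp: symmetrize_def)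
  define u where "u = perp n (perp b (x - x'))"
  have comm: "perp b (perp n z) = perp n (perp b z)" for z
    by (simp add: perp_def inner_diff_left bn nb)
  have pd: "perp b (x - x') = perp b (y - y')"
    using xy(3) xy'(3) by (simp add: linear_diff[OF linear_perp])
  have pnb: "perp n z \<bullet> b = z \<bullet> b" for z by (simp add: perp_def inner_diff_left nb)
  have pyth: "(norm (perp n z))\<^sup>2 = (norm (perp n (perp b z)))\<^sup>2 + (z \<bullet> b)\<^sup>2" for z
    using norm_perp[OF b, of "perp n z"] by (simp add: comm pnb)
  define \<alpha> where "\<alpha> = (x - x') \<bullet> b" define \<beta> where "\<beta> = (y - y') \<bullet> b"
  have 1: "(norm u)\<^sup>2 + \<alpha>\<^sup>2 \<le> D\<^sup>2"
    using pyth[of "x - x'"] X xy(1) xy'(1) power_mono[of "norm (perp n (x - x'))" D 2]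
    by (simp add: u_def \<alpha>_def in_slab_def)
  have 2: "(norm u)\<^sup>2 + \<beta>\<^sup>2 \<le> D\<^sup>2"
    using pyth[of "y - y'"] X xy(2) xy'(2) power_mono[of "norm (perp n (y - y'))" D 2]
    by (simp add: u_def \<beta>_def in_slab_def pd)
  have pb: "perp b (p - q) = perp b (x - x')"
    unfolding xy(4) xy'(4) by (simp add: perp_def inner_diff_left inner_add_left bb algebra_simps)
  have "(p - q) \<bullet> b = (\<alpha> - \<beta>) / 2"
    unfolding xy(4) xy'(4) \<alpha>_def \<beta>_def by (simp add: perp_def inner_diff_left inner_add_left bb field_simps)
  then have "(norm (perp n (p - q)))\<^sup>2 = (norm u)\<^sup>2 + ((\<alpha> - \<beta>) / 2)\<^sup>2"
    using pyth[of "p - q"] unfolding pb u_def by (simp only:)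
  also have "((\<alpha> - \<beta>) / 2)\<^sup>2 \<le> (\<alpha>\<^sup>2 + \<beta>\<^sup>2) / 2"
    using zero_le_power2[of "\<alpha> + \<beta>"] by (simp add: power2_eq_square field_simps)
  also have "(norm u)\<^sup>2 + (\<alpha>\<^sup>2 + \<beta>\<^sup>2) / 2 \<le> D\<^sup>2" using 1 2 by argo
  finally show "norm (perp n (p - q)) \<le> D" using D by (auto intro: power2_le_imp_le)
qed

lemma reflect_symmetrize_self: "norm b = 1 \<Longrightarrow> x \<in> symmetrize b X \<Longrightarrow> reflect b x \<in> symmetrize b X"
proof -
  assume b: "norm b = 1" and x: "x \<in> symmetrize b X"
  have bb: "b \<bullet> b = 1" using b by (simp add: norm_eq_1)
  from x obtain y z where yz: "y \<in> X" "z \<in> X" "perp b y = perp b z" "x = perp b y + ((y \<bullet> b - z \<bullet> b) / 2) *\<^sub>R b"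
    by (auto simp: symmetrize_def)
  have "x \<bullet> b = (y \<bullet> b - z \<bullet> b) / 2" unfolding yz(4) by (simp add: perp_def inner_add_left inner_diff_left bb)
  define k where "k = (y \<bullet> b - z \<bullet> b) / 2"
  have xk: "x \<bullet> b = k" unfolding k_def by fact
  have "reflect b x = x + (- (2 * k)) *\<^sub>R b" by (simp add: reflect_def xk)
  also have "\<dots> = perp b z + (- k) *\<^sub>R b"
    unfolding yz(4) k_def[symmetric] yz(3) by (simp only: add.assoc scaleR_add_left[symmetric]) simp
  also have "- k = (z \<bullet> b - y \<bullet> b) / 2" by (simp add: k_def field_simps)
  finally have "reflect b x = perp b z + ((z \<bullet> b - y \<bullet> b) / 2) *\<^sub>R b" .
  then show ?thesis unfolding symmetrize_def using yz by (intro image_eqI[of _ _ "(z,y)"]) auto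
qed

text \<open>
  Symmetrising in one direction preserves reflection symmetries in orthogonal directions, so that
  all symmetries of a frame can be acquired one after the other.
\<close>

lemma reflect_symmetrize_other:
  assumes "c \<bullet> b = 0" and X: "\<And>x. x \<in> X \<Longrightarrow> reflect c x \<in> X" and x: "x \<in> symmetrize b X"
  shows "reflect c x \<in> symmetrize b X"
proof -
  have bc: "b \<bullet> c = 0" using assms(1) by (simp add: inner_commute)
  from x obtain y z where yz: "y \<in> X" "z \<in> X" "perp b y = perp b z" "x = perp b y + ((y \<bullet> b - z \<bullet> b) / 2) *\<^sub>R b"
    by (auto simp: symmetrize_def)
  have rb: "reflect c w \<bullet> b = w \<bullet> b" for w by (simp add: reflect_def inner_diff_left assms(1))
  have rp: "perp b (reflect c w) = reflect c (perp b w)" for w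
    by (simp add: perp_def reflect_def inner_diff_left assms(1) bc algebra_simps)
  have "reflect c x = perp b (reflect c y) + ((reflect c y \<bullet> b - reflect c z \<bullet> b) / 2) *\<^sub>R b"
    unfolding rp rb yz(4) by (simp add: reflect_def inner_add_left bc)
  then show ?thesis unfolding symmetrize_def using X[OF yz(1)] X[OF yz(2)] yz(3)
    by (intro image_eqI[of _ _ "(reflect c y, reflect c z)"]) (auto simp: rp)
qed

lemma symmetrize_all:
  fixes n :: "'a::euclidean_space"
  assumes "finite B" and n: "norm n = 1" and D: "D \<ge> 0"
    and "\<And>b. b \<in> B \<Longrightarrow> norm b = 1 \<and> b \<bullet> n = 0"
    and "\<And>b c. b \<in> B \<Longrightarrow> c \<in> B \<Longrightarrow> b \<noteq> c \<Longrightarrow> b \<bullet> c = 0"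
    and X: "in_slab n c D X"
  shows "\<exists>Y. in_slab n c D Y \<and> vol X \<le> vol Y \<and> (\<forall>b\<in>B. \<forall>x\<in>Y. reflect b x \<in> Y)"
  using assms(1,4,5)
proof (induction B rule: finite_induct)
  case empty
  then show ?case using X by auto
next
  case (insert b B)
  then obtain Y where Y: "in_slab n c D Y" "vol X \<le> vol Y" "\<forall>b\<in>B. \<forall>x\<in>Y. reflect b x \<in> Y"
    by (metis insert_iff)
  have b: "norm b = 1" "b \<bullet> n = 0" using insert.prems by auto
  have cY: "compact Y" using Y by (simp add: in_slab_def)
  have "in_slab n c D (symmetrize b Y)" using in_slab_symmetrize[OF Y(1) n b D] .
  moreover have "vol X \<le> vol (symmetrize b Y)"
    using Y(2) vol_symmetrize_ge[OF b(1) cY] by simp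
  moreover have "reflect c' x \<in> symmetrize b Y" if "c' \<in> insert b B" "x \<in> symmetrize b Y" for c' x
  proof (cases "c' = b")
    case True
    then show ?thesis using reflect_symmetrize_self[OF b(1)] that by simp
  next
    case False
    then have "c' \<bullet> b = 0" "c' \<in> B" using that insert.prems(2)[of c' b] by auto
    then show ?thesis using reflect_symmetrize_other[of c' b Y x] Y(3) that by blast
  qed
  ultimately show ?case by blast
qed

text \<open>
  After symmetrising in all directions of an orthonormal basis of the complement of
  \<open>n\<close>, with each \<open>x\<close> the set contains the point with opposite component
  orthogonal to \<open>n\<close>. So this component has norm at most \<open>D / 2\<close>, and the
  set lies in a cylinder of radius \<open>D / 2\<close> and height one.
\<close>

lemma isodiametric_slab:
  fixes n :: "'a::euclidean_space"
  assumes n: "norm n = 1" and X: "in_slab n c D X" and D: "D \<ge> 0"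
  shows "vol X \<le> ennreal (unit_ball_vol (real (DIM('a) - 1)) * (D / 2) ^ (DIM('a) - 1))"
proof -
  obtain b0 :: 'a where b0: "b0 \<in> Basis" using nonempty_Basis by blast
  obtain f where f: "orthogonal_transformation f" "\<And>x. f (f x) = x" "f b0 = n"
    by (rule householder[of b0 n]) (use n b0 in simp_all)
  have lin: "linear f" using f by (simp add: orthogonal_transformation_linear)
  have ff: "f x \<bullet> f y = x \<bullet> y" for x y using f by (simp add: orthogonal_transformation_def)
  define B where "B = f ` (Basis - {b0})"
  have B1: "norm b = 1 \<and> b \<bullet> n = 0" if "b \<in> B" for b
    using that b0 f by (auto simp: B_def orthogonal_transformation_norm f(3)[symmetric] ff inner_Basis)
  have B2: "b \<bullet> c = 0" if "b \<in> B" "c \<in> B" "b \<noteq> c" for b c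
  proof -
    obtain x y where "b = f x" "c = f y" "x \<in> Basis" "y \<in> Basis" using \<open>b \<in> B\<close> \<open>c \<in> B\<close> by (auto simp: B_def)
    then show ?thesis using \<open>b \<noteq> c\<close> by (cases "x = y") (simp_all add: ff inner_Basis)
  qed
  have finB: "finite B" by (simp add: B_def)
  have "inj f" by (rule inj_on_inverseI[where g=f]) (rule f(2))
  have fxb: "f x \<bullet> b = x \<bullet> f b" for x b using ff[of "f x" b] by (simp add: f(2))
  have rep: "(\<Sum>b\<in>B. (x \<bullet> b) *\<^sub>R b) = perp n x" for x
  proof -
    have "x = f (\<Sum>b\<in>Basis. (f x \<bullet> b) *\<^sub>R b)" by (simp add: euclidean_representation f)
    also have "\<dots> = (\<Sum>b\<in>Basis. (f x \<bullet> b) *\<^sub>R f b)" by (simp add: linear_sum[OF lin] linear_scale[OF lin])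
    also have "\<dots> = (\<Sum>b\<in>Basis. (x \<bullet> f b) *\<^sub>R f b)" by (simp only: fxb)
    also have "\<dots> = (x \<bullet> n) *\<^sub>R n + (\<Sum>b\<in>Basis - {b0}. (x \<bullet> f b) *\<^sub>R f b)"
      using b0 f(3) by (simp add: sum.remove[of _ b0])
    also have "(\<Sum>b\<in>Basis - {b0}. (x \<bullet> f b) *\<^sub>R f b) = (\<Sum>b\<in>B. (x \<bullet> b) *\<^sub>R b)"
      unfolding B_def using \<open>inj f\<close> by (subst sum.reindex) (auto simp: inj_on_def)
    finally show ?thesis by (simp add: perp_def algebra_simps)
  qed
  obtain Y where Y: "in_slab n c D Y" "vol X \<le> vol Y" "\<forall>b\<in>B. \<forall>x\<in>Y. reflect b x \<in> Y"
    using symmetrize_all[OF finB n D B1 B2 X] by blast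
  \<comment> \<open>Reflections in orthogonal directions compose: together they reverse the components along
    all of S.\<close>
  have refl: "x - 2 *\<^sub>R (\<Sum>b\<in>S. (x \<bullet> b) *\<^sub>R b) \<in> Y" if "S \<subseteq> B" "x \<in> Y" for S x
    using finite_subset[OF that(1) finB] that(1)
  proof (induction S rule: finite_induct)
    case empty
    then show ?case using that by simp
  next
    case (insert b S)
    have "(x - 2 *\<^sub>R (\<Sum>b\<in>S. (x \<bullet> b) *\<^sub>R b)) \<bullet> b = x \<bullet> b"
    proof -
      have "(\<Sum>c\<in>S. (x \<bullet> c) *\<^sub>R c) \<bullet> b = (\<Sum>c\<in>S. (x \<bullet> c) * (c \<bullet> b))" by (simp add: inner_sum_left)
      also have "\<dots> = 0" using insert B2 by (intro sum.neutral) (metis insert_iff insert_subset mult_zero_right subsetD)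
      finally show ?thesis by (simp add: inner_diff_left)
    qed
    then have "reflect b (x - 2 *\<^sub>R (\<Sum>b\<in>S. (x \<bullet> b) *\<^sub>R b)) = x - 2 *\<^sub>R (\<Sum>b\<in>insert b S. (x \<bullet> b) *\<^sub>R b)"
      using insert.hyps by (simp add: reflect_def algebra_simps)
    then show ?case using insert Y(3) by (metis insert_subset)
  qed
  have half: "norm (perp n x) \<le> D / 2" if "x \<in> Y" for x
  proof -
    have "x - 2 *\<^sub>R perp n x \<in> Y" using refl[of B x] that by (simp add: rep)
    then have "norm (perp n (x - (x - 2 *\<^sub>R perp n x))) \<le> D"
      using Y(1) that unfolding in_slab_def by blast
    moreover have "perp n (perp n x) = perp n x" using n by (simp add: perp_def inner_diff_left norm_eq_1)
    ultimately show ?thesis by (simp add: linear_scale[OF linear_perp])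
  qed
  define w where "w = unit_ball_vol (real (DIM('a) - 1))"
  \<comment> \<open>The volume formula is stated for positive radius, so D / 2, possibly zero, is approached
    from above.\<close>
  have *: "vol X \<le> ennreal (w * R ^ (DIM('a) - 1))" if R: "R > D / 2" for R
  proof -
    have "R > 0" using R D by linarith
    have "vol Y \<le> vol {x. norm (perp n x) \<le> R \<and> c \<le> x \<bullet> n \<and> x \<bullet> n \<le> c + 1}"
    proof (rule emeasure_mono)
      show "Y \<subseteq> {x. norm (perp n x) \<le> R \<and> c \<le> x \<bullet> n \<and> x \<bullet> n \<le> c + 1}"
        using half R Y(1) by (fastforce simp: in_slab_def)
    qed (unfold perp_def, measurable)
    also have "\<dots> = ennreal (w * R ^ (DIM('a) - 1))"
      using vol_cylinder[OF n \<open>R > 0\<close>, of 1 c] by (simp add: w_def)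
    finally show ?thesis using Y(2) by simp
  qed
  have "((\<lambda>R. ennreal (w * R ^ (DIM('a) - 1))) \<longlongrightarrow> ennreal (w * (D/2) ^ (DIM('a) - 1))) (at_right (D/2))"
    by (intro tendsto_intros tendsto_ennrealI)
  then show ?thesis unfolding w_def[symmetric]
    by (rule tendsto_lowerbound) (use * in \<open>auto simp: eventually_at_filter\<close>)
qed

text \<open>
  The prisms over the pieces of a cover of \<open>F\<close> cover the prism over \<open>F\<close>,
  and the isodiametric inequality bounds the volume of each by the weight of its base. Replacing
  the pieces by their closures makes the prisms compact without changing diameters.
\<close>

lemma prism_le_content:
  fixes F :: "'a::euclidean_space set"
  assumes n: "norm n = 1" and F: "compact F" "\<And>x. x \<in> F \<Longrightarrow> x \<bullet> n = b"
  shows "vol (prism n F 1) \<le> hausdorff_content (DIM('a) - 1) \<delta> F"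
  unfolding hausdorff_content_eq
proof (rule INF_greatest)
  let ?d = "DIM('a) - 1"
  have nn: "n \<bullet> n = 1" using n by (simp add: norm_eq_1)
  fix C assume "C \<in> fine_covers \<delta> F"
  note C = fine_coversD(1,2)[OF this]
  define K where "K i = closure (C i \<inter> F)" for i
  have Kc: "compact (K i)" for i
    unfolding K_def using C(2) by (simp add: compact_closure bounded_Int)
  have KF: "K i \<subseteq> F" for i unfolding K_def using F(1) by (intro closure_minimal) (auto simp: compact_imp_closed)
  have m: "prism n (K i) 1 \<in> sets borel" for i using compact_prism[OF Kc] by (simp add: borel_compact)
  have "vol (prism n F 1) \<le> vol (\<Union>i. prism n (K i) 1)"
  proof (rule emeasure_mono)
    have sub: "C i \<inter> F \<subseteq> K i" for i unfolding K_def by (rule closure_subset)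
    show "prism n F 1 \<subseteq> (\<Union>i. prism n (K i) 1)"
    proof
      fix p assume "p \<in> prism n F 1"
      then obtain x t where p: "x \<in> F" "t \<in> {0..1}" "p = x + t *\<^sub>R n" by (auto simp: prism_def)
      then obtain i where "x \<in> C i" using C(1) by blast
      then have "x \<in> K i" using sub[of i] p(1) by auto
      then have "p \<in> prism n (K i) 1" unfolding prism_def using p by (intro image_eqI[of _ _ "(x,t)"]) auto
      then show "p \<in> (\<Union>i. prism n (K i) 1)" by blast
    qed
  qed (use m in auto)
  also have "\<dots> \<le> (\<Sum>i. vol (prism n (K i) 1))"
    using m by (intro emeasure_subadditive_countably) auto
  also have "\<dots> \<le> (\<Sum>i. weight ?d (C i))"
  proof (rule suminf_le)
    fix i
    show "vol (prism n (K i) 1) \<le> weight ?d (C i)"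
    proof (cases "C i \<inter> F = {}")
      case True
      then show ?thesis by (auto simp: K_def prism_def)
    next
      case False
      have dK: "norm (x - y) \<le> diameter (C i)" if "x \<in> K i" "y \<in> K i" for x y
      proof -
        have "dist x y \<le> diameter (K i)" using Kc that by (intro diameter_bounded_bound compact_imp_bounded)
        also have "\<dots> = diameter (C i \<inter> F)" unfolding K_def using C(2) by (intro diameter_closure) (simp add: bounded_Int)
        also have "\<dots> \<le> diameter (C i)" using C(2) by (intro diameter_subset) auto
        finally show ?thesis by (simp add: dist_norm)
      qed
      have "in_slab n b (diameter (C i)) (prism n (K i) 1)"
        unfolding in_slab_def
      proof (intro conjI ballI)
        show "compact (prism n (K i) 1)" by (rule compact_prism[OF Kc])
        fix p assume "p \<in> prism n (K i) 1"
        then obtain x s where p: "x \<in> K i" "0 \<le> s" "s \<le> 1" "p = x + s *\<^sub>R n" by (auto simp: prism_def)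
        have "x \<bullet> n = b" using p(1) KF F(2) by blast
        then show "b \<le> p \<bullet> n" "p \<bullet> n \<le> b + 1" using p by (auto simp: inner_add_left nn)
        fix q assume "q \<in> prism n (K i) 1"
        then obtain y t where q: "y \<in> K i" "0 \<le> t" "t \<le> 1" "q = y + t *\<^sub>R n" by (auto simp: prism_def)
        have "perp n (p - q) = perp n (x - y)"
          unfolding p(4) q(4) by (simp add: perp_def inner_diff_left inner_add_left nn algebra_simps)
        then show "norm (perp n (p - q)) \<le> diameter (C i)"
          using norm_perp_le[OF n, of "x - y"] dK[OF p(1) q(1)] by simp
      qed
      from isodiametric_slab[OF n this diameter_ge_0[OF C(2)]] False
      show ?thesis by (auto simp: weight_def)
    qed
  qed auto
  finally show "vol (prism n F 1) \<le> (\<Sum>i. weight ?d (C i))" .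
qed

text \<open>
  As \<open>F\<close> is flat, even the content with mesh one attains the volume, so the mesh may
  be chosen freely.
\<close>

theorem hausdorff_measure_flat:
  fixes F :: "'a::euclidean_space set"
  assumes n: "norm n = 1" and F: "compact F" "\<And>x. x \<in> F \<Longrightarrow> x \<bullet> n = b"
  shows "hausdorff_measure (DIM('a) - 1) F = vol (prism n F 1)"
  using hausdorff_le_prism[OF assms] prism_le_content[OF assms, of 1]
    content_le_hausdorff[of 1 "DIM('a) - 1" F] by auto

section \<open>Volume growth under Minkowski sums with zonotopes\<close>

text \<open>
  Minkowski sum with the segment \<open>[-v, v]\<close>.
\<close>

definition widen :: "'a::euclidean_space set \<Rightarrow> 'a \<Rightarrow> 'a set" where
  "widen A v = (\<lambda>(x,t). x + t *\<^sub>R v) ` (A \<times> {-1..1})"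

text \<open>
  Erosion by the segment \<open>[-v, v]\<close>: the dual operation to \<open>widen\<close>.
\<close>

definition shave :: "'a::euclidean_space set \<Rightarrow> 'a \<Rightarrow> 'a set" where
  "shave A v = {x. \<forall>t\<in>{-1..1}. x + t *\<^sub>R v \<in> A}"

definition msum :: "'a::euclidean_space set \<Rightarrow> 'a set \<Rightarrow> 'a set" where
  "msum A Z = (\<lambda>(x,y). x + y) ` (A \<times> Z)"

definition erode :: "'a::euclidean_space set \<Rightarrow> 'a set \<Rightarrow> 'a set" where
  "erode A Z = {x. \<forall>z\<in>Z. x + z \<in> A}"

lemma compact_widen: "compact A \<Longrightarrow> compact (widen A v)"
  unfolding widen_def
  by (rule compact_continuous_image) (auto intro!: continuous_intros compact_Times simp: case_prod_beta)

lemma convex_widen: assumes "convex A" shows "convex (widen A v)"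
proof -
  have "linear (\<lambda>p::'a \<times> real. fst p + snd p *\<^sub>R v)"
    by (rule linearI) (auto simp: algebra_simps)
  then have "convex ((\<lambda>p. fst p + snd p *\<^sub>R v) ` (A \<times> {-1..1}))"
    using assms by (intro convex_linear_image convex_Times) auto
  then show ?thesis by (simp add: widen_def case_prod_beta)
qed

lemma compact_msum: "compact A \<Longrightarrow> compact B \<Longrightarrow> compact (msum A B)"
  unfolding msum_def
  by (rule compact_continuous_image) (auto intro!: continuous_intros compact_Times simp: case_prod_beta)

lemma convex_msum: assumes "convex A" "convex B" shows "convex (msum A B)"
proof -
  have "linear (\<lambda>p::'a \<times> 'a. fst p + snd p)"
    by (rule linearI) (auto simp: algebra_simps)
  then have "convex ((\<lambda>p. fst p + snd p) ` (A \<times> B))"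
    using assms by (intro convex_linear_image convex_Times) auto
  then show ?thesis by (simp add: msum_def case_prod_beta)
qed

lemma compact_erode: assumes "compact A" "Z \<noteq> {}" shows "compact (erode A Z)"
proof -
  obtain z where z: "z \<in> Z" using assms by blast
  have eq: "erode A Z = (\<Inter>z\<in>Z. (\<lambda>x. x + z) -` A)" by (auto simp: erode_def)
  have "closed (erode A Z)" unfolding eq
    using assms(1) by (intro closed_INT ballI closed_vimage continuous_intros) (auto simp: compact_imp_closed)
  moreover have "erode A Z \<subseteq> (\<lambda>y. - z + y) ` A"
  proof
    fix x assume "x \<in> erode A Z"
    then have "x + z \<in> A" using z by (simp add: erode_def)
    then show "x \<in> (\<lambda>y. - z + y) ` A" by (intro image_eqI[of _ _ "x + z"]) auto
  qed
  ultimately show ?thesis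
    using assms(1) compact_imp_bounded[OF assms(1)]
    by (metis bounded_subset bounded_translation compact_eq_bounded_closed)
qed

lemma convex_erode: assumes "convex A" shows "convex (erode A Z)"
  unfolding convex_def
proof (intro ballI allI impI)
  fix x y u v assume *: "x \<in> erode A Z" "y \<in> erode A Z" "0 \<le> (u::real)" "0 \<le> v" "u + v = 1"
  have "u *\<^sub>R x + v *\<^sub>R y + z \<in> A" if z: "z \<in> Z" for z
  proof -
    have "u *\<^sub>R (x + z) + v *\<^sub>R (y + z) \<in> A"
      using * z assms by (intro convexD) (auto simp: erode_def)
    moreover have "u *\<^sub>R (x + z) + v *\<^sub>R (y + z) = u *\<^sub>R x + v *\<^sub>R y + (u + v) *\<^sub>R z"
      by (simp add: algebra_simps)
    ultimately show ?thesis using *(5) by simp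
  qed
  then show "u *\<^sub>R x + v *\<^sub>R y \<in> erode A Z" by (simp add: erode_def)
qed

lemma shave_eq_erode: "shave A v = erode A ((\<lambda>t. t *\<^sub>R v) ` {-1..1})"
  by (auto simp: shave_def erode_def)

text \<open>
  The area of the orthogonal projection along \<open>n\<close>, expressed as the volume of a
  cylinder of height one over it.
\<close>

definition shadow :: "'a::euclidean_space \<Rightarrow> 'a set \<Rightarrow> ennreal" where
  "shadow n A = vol {x. 0 \<le> x \<bullet> n \<and> x \<bullet> n < 1 \<and> perp n x \<in> perp n ` A}"

lemma perp_in_image_iff:
  assumes n: "norm n = 1"
  shows "perp n x \<in> perp n ` A \<longleftrightarrow> {t. x + t *\<^sub>R n \<in> A} \<noteq> {}"
proof
  assume "perp n x \<in> perp n ` A"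
  then obtain a where a: "a \<in> A" "perp n x = perp n a" by blast
  then have "x + (a \<bullet> n - x \<bullet> n) *\<^sub>R n = a" by (simp add: perp_def algebra_simps)
  then show "{t. x + t *\<^sub>R n \<in> A} \<noteq> {}" using a(1) by (metis (mono_tags, lifting) empty_iff mem_Collect_eq)
next
  assume "{t. x + t *\<^sub>R n \<in> A} \<noteq> {}"
  then obtain t where t: "x + t *\<^sub>R n \<in> A" by blast
  moreover have "perp n (x + t *\<^sub>R n) = perp n x"
    using n by (simp add: perp_def inner_add_left norm_eq_1 algebra_simps)
  ultimately show "perp n x \<in> perp n ` A" by (metis imageI)
qed

lemma shadow_set_borel: "compact A \<Longrightarrow> {x. 0 \<le> x \<bullet> n \<and> x \<bullet> n < 1 \<and> perp n x \<in> perp n ` A} \<in> sets borel"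
proof -
  assume A: "compact A"
  have cont: "continuous_on UNIV (perp n)" unfolding perp_def by (intro continuous_intros)
  have "compact (perp n ` A)" using A by (intro compact_continuous_image continuous_on_subset[OF cont]) auto
  then have "closed (perp n -` (perp n ` A))"
    using cont by (intro closed_vimage) (auto simp: compact_imp_closed)
  then have [measurable]: "perp n -` (perp n ` A) \<in> sets borel" by (rule borel_closed)
  have "{x. 0 \<le> x \<bullet> n \<and> x \<bullet> n < 1 \<and> perp n x \<in> perp n ` A} = {x. 0 \<le> x \<bullet> n \<and> x \<bullet> n < 1} \<inter> (perp n -` (perp n ` A))" by auto
  also have "\<dots> \<in> sets borel" by measurable
  finally show ?thesis .
qed

lemma fibre_interval:
  fixes A :: "'a::euclidean_space set"
  assumes A: "compact A" "convex A" and n: "norm n = 1" and ne: "{t::real. x + t *\<^sub>R n \<in> A} \<noteq> {}"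
  obtains \<alpha> \<beta> where "{t. x + t *\<^sub>R n \<in> A} = {\<alpha>..\<beta>}" "\<alpha> \<le> \<beta>"
proof -
  let ?I = "{t::real. x + t *\<^sub>R n \<in> A}"
  have "compact ?I" by (rule compact_fibre[OF A(1) n])
  moreover have "convex ?I"
  proof (rule convexI)
    fix s t u v :: real assume *: "s \<in> ?I" "t \<in> ?I" "0 \<le> u" "0 \<le> v" "u + v = 1"
    then have "u *\<^sub>R (x + s *\<^sub>R n) + v *\<^sub>R (x + t *\<^sub>R n) \<in> A" using A(2) by (auto intro: convexD)
    moreover have "u *\<^sub>R (x + s *\<^sub>R n) + v *\<^sub>R (x + t *\<^sub>R n) = (u + v) *\<^sub>R x + (u * s + v * t) *\<^sub>R n"
      by (simp add: algebra_simps)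
    ultimately show "u *\<^sub>R s + v *\<^sub>R t \<in> ?I" using *(5) by simp
  qed
  ultimately obtain \<alpha> \<beta> where "?I = {\<alpha>..\<beta>}"
    using connected_compact_interval_1[of ?I] convex_connected by metis
  then show ?thesis using that ne by auto
qed

lemma widen_fibre:
  assumes n: "v = s *\<^sub>R n" "s > 0"
  shows "{t. x + t *\<^sub>R n \<in> widen A v} = {t. \<exists>u\<in>{-s..s}. x + (t + u) *\<^sub>R n \<in> A}"
proof -
  have "x + t *\<^sub>R n \<in> widen A v \<longleftrightarrow> (\<exists>u\<in>{-s..s}. x + (t + u) *\<^sub>R n \<in> A)" for t
  proof
    assume "x + t *\<^sub>R n \<in> widen A v"
    then obtain a r where a: "a \<in> A" "-1 \<le> r" "r \<le> 1" "x + t *\<^sub>R n = a + r *\<^sub>R v" by (auto simp: widen_def)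
    then have "x + (t + - (r * s)) *\<^sub>R n = a" using n by (simp add: algebra_simps)
    moreover have "- (r * s) \<in> {-s..s}" using a n mult_right_mono[of r 1 s] mult_right_mono[of "-1" r s] by auto
    ultimately show "\<exists>u\<in>{-s..s}. x + (t + u) *\<^sub>R n \<in> A" using a(1) by metis
  next
    assume "\<exists>u\<in>{-s..s}. x + (t + u) *\<^sub>R n \<in> A"
    then obtain u where u: "-s \<le> u" "u \<le> s" "x + (t + u) *\<^sub>R n \<in> A" by auto
    show "x + t *\<^sub>R n \<in> widen A v" unfolding widen_def
      by (rule image_eqI[of _ _ "(x + (t + u) *\<^sub>R n, - u / s)"]) (use u n in \<open>auto simp: algebra_simps field_simps\<close>)
  qed
  then show ?thesis by auto
qed

text \<open>
  The fibres of a convex set in direction \<open>n\<close> are intervals. Adding the segment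
  lengthens each nonempty one by exactly \<open>2 s\<close>, and removing it shortens each by at
  most \<open>2 s\<close>; nonempty fibres are measured by the shadow.
\<close>

lemma vol_widen:
  fixes A :: "'a::euclidean_space set"
  assumes A: "compact A" "convex A" and n: "norm n = 1" and v: "v = s *\<^sub>R n" "s > 0"
  shows "vol (widen A v) = vol A + ennreal (2 * s) * shadow n A"
    and "vol A \<le> vol (shave A v) + ennreal (2 * s) * shadow n A"
proof -
  let ?Z = "{x. 0 \<le> x \<bullet> n \<and> x \<bullet> n < 1}"
  let ?P = "{x. 0 \<le> x \<bullet> n \<and> x \<bullet> n < 1 \<and> perp n x \<in> perp n ` A}"
  have Pm: "?P \<in> sets borel" by (rule shadow_set_borel[OF A(1)])
  have cer: "compact (shave A v)" unfolding shave_eq_erode using A by (intro compact_erode) auto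
  have Am: "A \<in> sets borel" "widen A v \<in> sets borel" "shave A v \<in> sets borel"
    using A(1) compact_widen[OF A(1)] cer by (auto simp: borel_compact)
  have meas: "(\<lambda>x. indicator ?Z x * vol {t::real. x + t *\<^sub>R n \<in> X}) \<in> borel_measurable lborel"
    if "X \<in> sets borel" for X :: "'a set"
  proof -
    have [measurable]: "X \<in> sets borel" by fact
    have "{p \<in> space (lborel \<Otimes>\<^sub>M lborel). (fst p :: 'a) + (snd p :: real) *\<^sub>R n \<in> X} \<in> sets (lborel \<Otimes>\<^sub>M lborel)"
      by measurable
    then have "{p::'a \<times> real. fst p + snd p *\<^sub>R n \<in> X} \<in> sets (lborel \<Otimes>\<^sub>M lborel)"
      by (simp add: space_pair_measure)
    then have "(\<lambda>x. vol (Pair x -` {p::'a \<times> real. fst p + snd p *\<^sub>R n \<in> X})) \<in> borel_measurable lborel"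
      by (rule lborel.measurable_emeasure_Pair)
    then have [measurable]: "(\<lambda>x. vol {t::real. x + t *\<^sub>R n \<in> X}) \<in> borel_measurable lborel"
      by (simp add: vimage_def)
    show ?thesis by measurable
  qed
  \<comment> \<open>The fibrewise form of both claims, to be integrated over the unit slab.\<close>
  have fib: "vol {t::real. x + t *\<^sub>R n \<in> widen A v} = vol {t::real. x + t *\<^sub>R n \<in> A} + ennreal (2 * s) * indicator (perp n -` (perp n ` A)) x \<and>
    vol {t::real. x + t *\<^sub>R n \<in> A} \<le> vol {t::real. x + t *\<^sub>R n \<in> shave A v} + ennreal (2 * s) * indicator (perp n -` (perp n ` A)) x"
    for x
  proof (cases "{t::real. x + t *\<^sub>R n \<in> A} = {}")
    case True
    then have "perp n x \<notin> perp n ` A" using perp_in_image_iff[OF n] by blast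
    moreover have "{t::real. x + t *\<^sub>R n \<in> widen A v} = {}"
      using True unfolding widen_fibre[OF v] by blast
    ultimately show ?thesis using True by simp
  next
    case False
    then obtain \<alpha> \<beta> where ab: "{t. x + t *\<^sub>R n \<in> A} = {\<alpha>..\<beta>}" "\<alpha> \<le> \<beta>"
      using fibre_interval[OF A n] by metis
    have mem: "x + t *\<^sub>R n \<in> A \<longleftrightarrow> t \<in> {\<alpha>..\<beta>}" for t using ab(1) by blast
    have P: "perp n x \<in> perp n ` A" using perp_in_image_iff[OF n] False by blast
    have 1: "{t. x + t *\<^sub>R n \<in> widen A v} = {\<alpha> - s..\<beta> + s}"
    proof -
      have "(\<exists>u\<in>{-s..s}. t + u \<in> {\<alpha>..\<beta>}) \<longleftrightarrow> t \<in> {\<alpha> - s..\<beta> + s}" for t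
      proof
        assume "t \<in> {\<alpha> - s..\<beta> + s}"
        then show "\<exists>u\<in>{-s..s}. t + u \<in> {\<alpha>..\<beta>}"
          using ab(2) v(2) by (intro bexI[of _ "max (-s) (\<alpha> - t)"]) (auto simp: max_def)
      qed auto
      then show ?thesis unfolding widen_fibre[OF v] mem by blast
    qed
    have 2: "{\<alpha> + s..\<beta> - s} \<subseteq> {t. x + t *\<^sub>R n \<in> shave A v}"
    proof
      fix t assume t: "t \<in> {\<alpha> + s..\<beta> - s}"
      have "x + t *\<^sub>R n + r *\<^sub>R v \<in> A" if r: "r \<in> {-1..1}" for r
      proof -
        have "x + t *\<^sub>R n + r *\<^sub>R v = x + (t + r * s) *\<^sub>R n" using v by (simp add: algebra_simps)
        moreover have "r * s \<le> 1 * s" "-1 * s \<le> r * s"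
          using r v(2) by (intro mult_right_mono; simp)+
        then have "t + r * s \<in> {\<alpha>..\<beta>}" using t by auto
        ultimately show ?thesis by (simp only: mem)
      qed
      then show "t \<in> {t. x + t *\<^sub>R n \<in> shave A v}" by (simp add: shave_def)
    qed
    have m: "{t. x + t *\<^sub>R n \<in> shave A v} \<in> sets borel" by (rule borel_compact[OF compact_fibre[OF cer n]])
    have "vol {\<alpha>..\<beta>} \<le> vol {\<alpha> + s..\<beta> - s} + ennreal (2 * s)"
    proof (cases "\<alpha> + s \<le> \<beta> - s")
      case True
      then have "ennreal (\<beta> - \<alpha>) = ennreal ((\<beta> - s) - (\<alpha> + s)) + ennreal (2 * s)"
        using v by (subst ennreal_plus[symmetric]) auto
      then show ?thesis using True ab(2) by simp
    next
      case False
      then show ?thesis using ab(2) v by (auto intro: ennreal_leI)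
    qed
    also have "\<dots> \<le> vol {t::real. x + t *\<^sub>R n \<in> shave A v} + ennreal (2 * s)"
      using 2 m by (intro add_right_mono emeasure_mono) auto
    finally have "vol {\<alpha>..\<beta>} \<le> vol {t::real. x + t *\<^sub>R n \<in> shave A v} + ennreal (2 * s)" .
    moreover have "vol {\<alpha> - s..\<beta> + s} = vol {\<alpha>..\<beta>} + ennreal (2 * s)"
      using ab(2) v(2) by (simp add: ennreal_plus[symmetric] del: ennreal_plus)
    ultimately show ?thesis using P unfolding 1 ab(1) by simp
  qed
  have [measurable]: "?Z \<in> sets borel" by measurable
  have pint: "(\<integral>\<^sup>+x. indicator ?Z x * (ennreal (2 * s) * indicator (perp n -` (perp n ` A)) x) \<partial>lborel) = ennreal (2 * s) * shadow n A"
  proof -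
    have "(\<integral>\<^sup>+x. indicator ?Z x * (ennreal (2 * s) * indicator (perp n -` (perp n ` A)) x) \<partial>lborel)
      = (\<integral>\<^sup>+x. ennreal (2 * s) * indicator ?P x \<partial>lborel)"
      by (intro nn_integral_cong) (auto simp: indicator_def)
    also have "\<dots> = ennreal (2 * s) * shadow n A"
      unfolding shadow_def using Pm by (subst nn_integral_cmult_indicator) auto
    finally show ?thesis .
  qed
  have pm: "(\<lambda>x. indicator ?Z x * (ennreal (2 * s) * indicator (perp n -` (perp n ` A)) x)) \<in> borel_measurable lborel"
  proof -
    have "(\<lambda>x. indicator ?Z x * (ennreal (2 * s) * indicator (perp n -` (perp n ` A)) x)) = (\<lambda>x. ennreal (2 * s) * indicator ?P x)"
      by (auto simp: fun_eq_iff indicator_def)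
    then show ?thesis using Pm by simp
  qed
  have "vol (widen A v) = (\<integral>\<^sup>+x. indicator ?Z x * vol {t::real. x + t *\<^sub>R n \<in> A} + indicator ?Z x * (ennreal (2 * s) * indicator (perp n -` (perp n ` A)) x) \<partial>lborel)"
    unfolding vol_slices[OF n Am(2)]
    by (intro nn_integral_cong) (simp add: fib distrib_left)
  also have "\<dots> = vol A + ennreal (2 * s) * shadow n A"
    unfolding vol_slices[OF n Am(1)] pint[symmetric]
    by (rule nn_integral_add[OF meas[OF Am(1)] pm])
  finally show "vol (widen A v) = vol A + ennreal (2 * s) * shadow n A" .
  have "vol A \<le> (\<integral>\<^sup>+x. indicator ?Z x * vol {t::real. x + t *\<^sub>R n \<in> shave A v} + indicator ?Z x * (ennreal (2 * s) * indicator (perp n -` (perp n ` A)) x) \<partial>lborel)"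
    unfolding vol_slices[OF n Am(1)]
    unfolding distrib_left[symmetric] using fib by (intro nn_integral_mono mult_left_mono) auto
  also have "\<dots> = vol (shave A v) + ennreal (2 * s) * shadow n A"
    unfolding vol_slices[OF n Am(3)] pint[symmetric]
    by (rule nn_integral_add[OF meas[OF Am(3)] pm])
  finally show "vol A \<le> vol (shave A v) + ennreal (2 * s) * shadow n A" .
qed

lemma vol_compact: "compact A \<Longrightarrow> vol A = ennreal (rvol A)"
  using emeasure_compact_finite[of A] by (intro emeasure_eq_ennreal_measure) auto

text \<open>
  Both quantities are governed by shadows, and the shadow of the smaller set is smaller. Erosion
  of \<open>A\<close> and growth of \<open>B\<close> thus compare directly.
\<close>

lemma widen_growth:
  fixes A B :: "'a::euclidean_space set"
  assumes A: "compact A" "convex A" and B: "compact B" "convex B" and sub: "A \<subseteq> B"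
  shows "rvol (widen A v) - rvol A \<le> rvol (widen B v) - rvol B"
    and "rvol A - rvol (shave A v) \<le> rvol (widen B v) - rvol B"
proof -
  have "rvol (widen A v) - rvol A \<le> rvol (widen B v) - rvol B \<and>
     rvol A - rvol (shave A v) \<le> rvol (widen B v) - rvol B"
  proof (cases "v = 0")
    case True
    have "widen C 0 = C" for C :: "'a set" by (force simp: widen_def image_iff)
    moreover have "shave A 0 = A" by (auto simp: shave_def) 
    ultimately show ?thesis using True by simp
  next
    case False
    define s where "s = norm v"
    define n where "n = v /\<^sub>R s"
    have s: "s > 0" and n: "norm n = 1" and v: "v = s *\<^sub>R n" using False by (auto simp: s_def n_def)
    have cer: "compact (shave A v)" unfolding shave_eq_erode using A by (intro compact_erode) auto
    have fin: "shadow n C < top" if C: "compact C" "convex C" for C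
    proof -
      have "ennreal (2 * s) * shadow n C \<le> vol (widen C v)"
        using vol_widen(1)[OF C n v s] by simp
      also have "\<dots> < top" using emeasure_compact_finite[OF compact_widen[OF C(1)]] by simp
      finally show ?thesis using s by (auto simp: ennreal_mult_less_top)
    qed
    define P where "P C = enn2real (shadow n C)" for C
    have P: "shadow n C = ennreal (P C)" "P C \<ge> 0" if "compact C" "convex C" for C
      using fin[OF that] by (auto simp: P_def)
    have e: "rvol (widen C v) = rvol C + 2 * s * P C" if C: "compact C" "convex C" for C
      using vol_widen(1)[OF C n v s] s P[OF C] C(1) compact_widen[OF C(1), of v]
      by (simp add: vol_compact ennreal_mult[symmetric] ennreal_plus[symmetric] del: ennreal_plus)
    have "rvol A \<le> rvol (shave A v) + 2 * s * P A"
      using vol_widen(2)[OF A n v s] s P[OF A] A(1) cer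
      by (simp add: vol_compact ennreal_mult[symmetric] ennreal_plus[symmetric] del: ennreal_plus)
    moreover have "P A \<le> P B"
    proof -
      have "shadow n A \<le> shadow n B"
        unfolding shadow_def using sub shadow_set_borel[OF B(1), of n] by (intro emeasure_mono) auto
      then show ?thesis using P[OF A] P[OF B] by simp
    qed
    ultimately show ?thesis using e[OF A] e[OF B] s by (smt (verit) mult_left_mono)
  qed
  then show "rvol (widen A v) - rvol A \<le> rvol (widen B v) - rvol B"
    "rvol A - rvol (shave A v) \<le> rvol (widen B v) - rvol B" by auto
qed

fun zonotope :: "'a::euclidean_space list \<Rightarrow> 'a set" where
  "zonotope [] = {0}" | "zonotope (v # vs) = widen (zonotope vs) v"

lemma zonotope: "compact (zonotope vs)" "convex (zonotope vs)" "0 \<in> zonotope vs"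
proof (induction vs)
  case (Cons v vs)
  { case 1 show ?case using Cons by (simp add: compact_widen) }
  { case 2 show ?case using Cons by (simp add: convex_widen) }
  { case 3 show ?case using Cons unfolding zonotope.simps widen_def by (intro image_eqI[of _ _ "(0,0)"]) auto }
qed auto

lemma msum_widen: "msum A (widen Z v) = widen (msum A Z) v"
proof (rule set_eqI)
  fix x
  have "x \<in> msum A (widen Z v) \<longleftrightarrow> (\<exists>a\<in>A. \<exists>z\<in>Z. \<exists>t\<in>{-1..1}. x = a + (z + t *\<^sub>R v))"
    unfolding msum_def widen_def image_iff by (simp add: Bex_def)
  moreover have "x \<in> widen (msum A Z) v \<longleftrightarrow> (\<exists>a\<in>A. \<exists>z\<in>Z. \<exists>t\<in>{-1..1}. x = (a + z) + t *\<^sub>R v)"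
    unfolding msum_def widen_def image_iff by (simp add: Bex_def)
  ultimately show "x \<in> msum A (widen Z v) \<longleftrightarrow> x \<in> widen (msum A Z) v" by (simp only: add.assoc)
qed

lemma erode_widen: "erode A (widen Z v) = shave (erode A Z) v"
proof (rule set_eqI)
  fix x
  have "x \<in> erode A (widen Z v) \<longleftrightarrow> (\<forall>z\<in>Z. \<forall>t\<in>{-1..1}. x + (z + t *\<^sub>R v) \<in> A)"
    unfolding erode_def widen_def by auto
  moreover have "x \<in> shave (erode A Z) v \<longleftrightarrow> (\<forall>z\<in>Z. \<forall>t\<in>{-1..1}. (x + t *\<^sub>R v) + z \<in> A)"
    unfolding erode_def shave_def by blast
  moreover have "(x + t *\<^sub>R v) + z = x + (z + t *\<^sub>R v)" for z t by (simp add: algebra_simps)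
  ultimately show "x \<in> erode A (widen Z v) \<longleftrightarrow> x \<in> shave (erode A Z) v" by presburger
qed

lemma msum_0: "msum C {0} = C"
  by (force simp: msum_def)

lemma erode_0: "erode C {0} = C"
  by (simp add: erode_def)

text \<open>
  One segment is added at a time: if \<open>A\<close> lies in \<open>B\<close>, then at each stage
  the sum of \<open>A\<close>, and the erosion of \<open>A\<close>, lie in the sum of
  \<open>B\<close>, so the one-segment estimate applies again.
\<close>

lemma zonotope_growth:
  fixes A B :: "'a::euclidean_space set"
  assumes A: "compact A" "convex A" and B: "compact B" "convex B" and sub: "A \<subseteq> B"
  shows "rvol (msum A (zonotope vs)) - rvol A \<le> rvol (msum B (zonotope vs)) - rvol B"
    and "rvol A - rvol (erode A (zonotope vs)) \<le> rvol (msum B (zonotope vs)) - rvol B"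
proof (induction vs)
  case Nil
  show "rvol (msum A (zonotope [])) - rvol A \<le> rvol (msum B (zonotope [])) - rvol B"
    "rvol A - rvol (erode A (zonotope [])) \<le> rvol (msum B (zonotope [])) - rvol B" by (simp_all add: msum_0 erode_0)
next
  case (Cons v vs)
  have C: "compact (msum C (zonotope vs)) \<and> convex (msum C (zonotope vs))" if "compact C" "convex C" for C :: "'a set"
    using that zonotope[of vs] by (simp add: compact_msum convex_msum)
  have ne: "zonotope vs \<noteq> {}" using zonotope(3) by blast
  have E: "compact (erode A (zonotope vs))" "convex (erode A (zonotope vs))"
    using A ne by (simp_all add: compact_erode convex_erode)
  have s1: "msum A (zonotope vs) \<subseteq> msum B (zonotope vs)" using sub by (auto simp: msum_def)
  have s2: "erode A (zonotope vs) \<subseteq> msum B (zonotope vs)"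
  proof
    fix x assume "x \<in> erode A (zonotope vs)"
    then have "x + 0 \<in> A" using zonotope(3)[of vs] unfolding erode_def by blast
    then show "x \<in> msum B (zonotope vs)" unfolding msum_def
      using sub zonotope(3)[of vs] by (intro image_eqI[of _ _ "(x, 0)"]) auto
  qed
  show "rvol (msum A (zonotope (v # vs))) - rvol A \<le> rvol (msum B (zonotope (v # vs))) - rvol B"
    using widen_growth(1)[of "msum A (zonotope vs)" "msum B (zonotope vs)" v] C[OF A] C[OF B] s1 Cons(1)
    by (simp add: msum_widen)
  show "rvol A - rvol (erode A (zonotope (v # vs))) \<le> rvol (msum B (zonotope (v # vs))) - rvol B"
    using widen_growth(2)[of "erode A (zonotope vs)" "msum B (zonotope vs)" v] E C[OF B] s2 Cons(2)
    by (simp add: msum_widen erode_widen)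
qed

text \<open>
  The support function of a sum of segments \<open>[-v, v]\<close>; the maximum is attained at the
  endpoints with matching signs.
\<close>

lemma zonotope_support:
  fixes u :: "'a::euclidean_space"
  shows "(\<forall>z\<in>zonotope vs. u \<bullet> z \<le> (\<Sum>v\<leftarrow>vs. \<bar>u \<bullet> v\<bar>)) \<and> (\<exists>z\<in>zonotope vs. u \<bullet> z = (\<Sum>v\<leftarrow>vs. \<bar>u \<bullet> v\<bar>))"
proof (induction vs)
  case (Cons v vs)
  have "u \<bullet> z \<le> (\<Sum>v\<leftarrow>v # vs. \<bar>u \<bullet> v\<bar>)" if "z \<in> zonotope (v # vs)" for z
  proof -
    obtain y t where y: "y \<in> zonotope vs" "-1 \<le> t" "t \<le> 1" "z = y + t *\<^sub>R v" using \<open>z \<in> zonotope (v # vs)\<close> by (auto simp: widen_def)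
    have "t * (u \<bullet> v) \<le> \<bar>t\<bar> * \<bar>u \<bullet> v\<bar>" by (metis abs_ge_self abs_mult)
    also have "\<dots> \<le> 1 * \<bar>u \<bullet> v\<bar>" using y by (intro mult_right_mono) auto
    finally have "t * (u \<bullet> v) \<le> \<bar>u \<bullet> v\<bar>" by simp
    moreover have "u \<bullet> y \<le> (\<Sum>v\<leftarrow>vs. \<bar>u \<bullet> v\<bar>)" using Cons y(1) by blast
    ultimately show ?thesis by (simp add: y(4) inner_add_right)
  qed
  moreover obtain y where y: "y \<in> zonotope vs" "u \<bullet> y = (\<Sum>v\<leftarrow>vs. \<bar>u \<bullet> v\<bar>)" using Cons by blast
  have "y + sgn (u \<bullet> v) *\<^sub>R v \<in> zonotope (v # vs)"
    unfolding zonotope.simps widen_def using y(1)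
    by (intro image_eqI[of _ _ "(y, sgn (u \<bullet> v))"]) (auto simp: sgn_if)
  moreover have "u \<bullet> (y + sgn (u \<bullet> v) *\<^sub>R v) = (\<Sum>v\<leftarrow>v # vs. \<bar>u \<bullet> v\<bar>)"
    using y(2) by (simp add: inner_add_right abs_sgn mult.commute)
  ultimately show ?case by blast
qed simp

section \<open>Approximating a ball by zonotopes\<close>

text \<open>
  The support function of the continuous Minkowski sum of the segments \<open>[-x, x]\<close> over
  the unit ball.
\<close>

definition absdot_integral :: "'a::euclidean_space \<Rightarrow> real" where
  "absdot_integral u = (LINT x|lborel. indicator (cball 0 1) x * \<bar>u \<bullet> x\<bar>)"

lemma absdot_integrable:
  fixes u :: "'a::euclidean_space"
  shows "integrable lborel (\<lambda>x. indicator (cball 0 1) x * \<bar>u \<bullet> x\<bar>)"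
proof -
  have "integrable lborel (\<lambda>x. indicator (cball 0 1) x *\<^sub>R \<bar>u \<bullet> x\<bar>)"
    by (intro borel_integrable_compact continuous_intros) auto
  then show ?thesis by simp
qed

text \<open>
  Reflections preserve the unit ball and Lebesgue measure, and exchange \<open>u\<close> and
  \<open>v\<close>.
\<close>

lemma absdot_isotropic:
  fixes u v :: "'a::euclidean_space"
  assumes "norm u = norm v"
  shows "absdot_integral u = absdot_integral v"
proof -
  obtain f where f: "orthogonal_transformation f" "\<And>x. f (f x) = x" "f u = v"
    using householder[OF assms] by metis
  have lin: "linear f" using f by (simp add: orthogonal_transformation_linear)
  then have [measurable]: "f \<in> borel_measurable borel"
    by (intro borel_measurable_continuous_onI) (simp add: linear_continuous_on linear_linear)
  have "distr lborel borel f = lborel"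
  proof (rule measure_eqI)
    fix X assume "X \<in> sets (distr lborel borel f)"
    then show "emeasure (distr lborel borel f) X = vol X"
      using vol_reflection_vimage[OF f(1,2), of X] by (simp add: emeasure_distr)
  qed simp
  then have "absdot_integral v = (LINT x|distr lborel borel f. indicator (cball 0 1) x * \<bar>v \<bullet> x\<bar>)"
    by (simp add: absdot_integral_def)
  also have "\<dots> = (LINT x|lborel. indicator (cball 0 1) (f x) * \<bar>v \<bullet> f x\<bar>)"
    using borel_measurable_integrable[OF absdot_integrable[of v]] by (intro integral_distr) auto
  also have "\<dots> = absdot_integral u"
    unfolding absdot_integral_def
  proof (rule Bochner_Integration.integral_cong[OF refl])
    fix x
    have "v \<bullet> f x = u \<bullet> x" using f by (metis orthogonal_transformation_def)
    moreover have "norm (f x) = norm x" using f(1) by (rule orthogonal_transformation_norm)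
    ultimately show "indicator (cball 0 1) (f x) * \<bar>v \<bullet> f x\<bar> = indicator (cball 0 1) x * \<bar>u \<bullet> x\<bar>"
      by (simp add: indicator_def)
  qed
  finally show ?thesis ..
qed

text \<open>
  The rotation invariant support function is a multiple of the norm, so the continuous sum of all
  segments \<open>[-x, x]\<close> over the unit ball is again a ball.
\<close>

lemma absdot_const:
  obtains c where "c > 0" "\<And>u::'a::euclidean_space. absdot_integral u = c * norm u"
proof -
  obtain b :: 'a where b: "b \<in> Basis" using nonempty_Basis by blast
  define c where "c = absdot_integral b"
  have "absdot_integral u = c * norm u" for u :: 'a
  proof -
    have "absdot_integral u = absdot_integral (norm u *\<^sub>R b)"
      using b by (intro absdot_isotropic) simp
    also have "\<dots> = norm u * absdot_integral b"
    proof -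
      have "absdot_integral (norm u *\<^sub>R b) = (LINT x|lborel. norm u * (indicator (cball 0 1) x * \<bar>b \<bullet> x\<bar>))"
        unfolding absdot_integral_def by (intro Bochner_Integration.integral_cong) (auto simp: abs_mult)
      then show ?thesis by (simp add: absdot_integral_def)
    qed
    finally show ?thesis by (simp add: c_def mult.commute)
  qed
  moreover have "c > 0"
  proof -
    \<comment> \<open>On the ball of radius 1/4 about b / 2, which lies in the unit ball, the integrand is at
      least 1/4.\<close>
    let ?B = "ball (b /\<^sub>R 2) (1/4)"
    have nb: "norm b = 1" "b \<bullet> b = 1" using b by (auto simp: inner_Basis)
    have fB: "vol ?B < \<infinity>" by (rule emeasure_bounded_finite) simp
    have "(LINT x|lborel. indicator ?B x * (1/4::real)) \<le> c"
      unfolding c_def absdot_integral_def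
    proof (rule integral_mono[OF _ absdot_integrable])
      show "integrable lborel (\<lambda>x. indicator ?B x * (1/4::real))"
        using fB by (intro integrable_mult_left integrable_real_indicator) auto
      fix x
      show "indicator ?B x * (1/4::real) \<le> indicator (cball 0 1) x * \<bar>b \<bullet> x\<bar>"
      proof (cases "x \<in> ?B")
        case True
        then have d: "norm (b /\<^sub>R 2 - x) < 1/4" by (simp add: dist_norm)
        have "norm x \<le> norm (b /\<^sub>R 2) + norm (b /\<^sub>R 2 - x)" by (metis norm_minus_commute norm_triangle_sub)
        then have "norm x \<le> 1" using d nb by simp
        moreover have "b \<bullet> (b /\<^sub>R 2 - x) \<le> norm b * norm (b /\<^sub>R 2 - x)" by (rule norm_cauchy_schwarz)
        then have "1/2 - b \<bullet> x \<le> 1/4" using d nb by (simp add: inner_diff_right)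
        ultimately show ?thesis using True by simp
      qed simp
    qed
    moreover have "(LINT x|lborel. indicator ?B x * (1/4::real)) = rvol ?B / 4" by simp
    moreover have "rvol ?B > 0" by (simp add: content_ball_gt_0_iff)
    ultimately show ?thesis by linarith
  qed
  ultimately show ?thesis using that by blast
qed

text \<open>
  A Riemann sum over a partition of the unit ball into pieces of size \<open>\<epsilon>\<close>.
  Each piece contributes one segment, weighted by the volume of the piece, and the error is
  uniform since \<open>\<bar>u \<bullet> x\<bar>\<close> varies by at most \<open>\<epsilon>
  \<bar>u\<bar>\<close> on it.
\<close>

lemma riemann_absdot:
  assumes \<epsilon>: "\<epsilon> > 0"
  obtains vs :: "'a::euclidean_space list"
  where "\<And>u. \<bar>absdot_integral u - (\<Sum>v\<leftarrow>vs. \<bar>u \<bullet> v\<bar>)\<bar> \<le> \<epsilon> * norm u * rvol (cball (0::'a) 1)"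
proof -
  let ?C = "cball (0::'a) 1"
  obtain T where T: "finite T" "T \<subseteq> ?C" "?C \<subseteq> (\<Union>x\<in>T. ball x \<epsilon>)"
  proof (rule compactE_image[of ?C ?C "\<lambda>x. ball x \<epsilon>"])
    show "?C \<subseteq> (\<Union>c\<in>?C. ball c \<epsilon>)" using \<epsilon> by (auto intro!: bexI centre_in_ball[THEN iffD2])
  qed auto
  obtain xs where xs: "set xs = T" using T(1) finite_list by blast
  define m where "m = length xs"
  define A where "A i = (if i < m then ball (xs ! i) \<epsilon> \<inter> ?C else {})" for i
  define E where "E = disjointed A"
  have EA: "E i \<subseteq> A i" for i by (simp add: E_def disjointed_subset)
  have dj: "disjoint_family E" unfolding E_def by (rule disjoint_family_disjointed)
  have U: "(\<Union>i\<in>{0..<m}. E i) = ?C"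
  proof -
    have "(\<Union>i\<in>{0..<m}. E i) = (\<Union>i\<in>{0..<m}. A i)" unfolding E_def by (rule finite_UN_disjointed_eq)
    also have "\<dots> = ?C"
    proof
      show "?C \<subseteq> (\<Union>i\<in>{0..<m}. A i)"
      proof
        fix x assume x: "x \<in> ?C"
        then obtain y where "y \<in> set xs" "x \<in> ball y \<epsilon>" using T(3) xs by blast
        then obtain i where "i < m" "x \<in> ball (xs ! i) \<epsilon>" unfolding m_def in_set_conv_nth by blast
        then show "x \<in> (\<Union>i\<in>{0..<m}. A i)" using x by (intro UN_I[of i]) (auto simp: A_def)
      qed
    qed (auto simp: A_def)
    finally show ?thesis .
  qed
  have "range E \<subseteq> sets borel" unfolding E_def by (rule sets.range_disjointed_sets) (auto simp: A_def)
  then have Em[measurable]: "E i \<in> sets borel" for i by blast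
  have EC: "E i \<subseteq> ?C" for i using EA[of i] by (auto simp: A_def split: if_splits)
  have Ef: "vol (E i) < \<infinity>" for i
    using EC[of i] by (intro emeasure_bounded_finite) (meson bounded_cball bounded_subset)
  define vs where "vs = map (\<lambda>i. rvol (E i) *\<^sub>R (xs ! i)) [0..<m]"
  show ?thesis
  proof (rule that[of vs])
    fix u :: 'a
    \<comment> \<open>The step function whose integral is the Riemann sum.\<close>
    define s where "s x = (\<Sum>i\<in>{0..<m}. indicator (E i) x * \<bar>u \<bullet> xs ! i\<bar>)" for x
    have sint: "integrable lborel s" unfolding s_def
      using Ef by (intro Bochner_Integration.integrable_sum integrable_mult_left integrable_real_indicator) auto
    have "(\<Sum>v\<leftarrow>vs. \<bar>u \<bullet> v\<bar>) = (\<Sum>i\<in>{0..<m}. rvol (E i) * \<bar>u \<bullet> xs ! i\<bar>)"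
      by (simp add: vs_def o_def abs_mult interv_sum_list_conv_sum_set_nat)
    also have "\<dots> = (LINT x|lborel. s x)"
      unfolding s_def using Ef
      by (subst Bochner_Integration.integral_sum) (auto intro!: integrable_mult_left integrable_real_indicator)
    finally have ss: "(\<Sum>v\<leftarrow>vs. \<bar>u \<bullet> v\<bar>) = (LINT x|lborel. s x)" .
    have pt: "\<bar>indicator ?C x * \<bar>u \<bullet> x\<bar> - s x\<bar> \<le> indicator ?C x * (\<epsilon> * norm u)" for x
    proof (cases "x \<in> ?C")
      case True
      then have "x \<in> (\<Union>i\<in>{0..<m}. E i)" unfolding U .
      then obtain i where i: "i < m" "x \<in> E i" by auto
      have "indicator (E j) x * \<bar>u \<bullet> xs ! j\<bar> = (if j = i then \<bar>u \<bullet> xs ! i\<bar> else 0)" for j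
        using i dj by (auto simp: indicator_def disjoint_family_on_def)
      then have "s x = \<bar>u \<bullet> xs ! i\<bar>" using i(1) by (simp add: s_def)
      moreover have "\<bar>\<bar>u \<bullet> x\<bar> - \<bar>u \<bullet> xs ! i\<bar>\<bar> \<le> \<epsilon> * norm u"
      proof -
        have "\<bar>\<bar>u \<bullet> x\<bar> - \<bar>u \<bullet> xs ! i\<bar>\<bar> \<le> \<bar>u \<bullet> (x - xs ! i)\<bar>" by (simp add: inner_diff_right abs_triangle_ineq3)
        also have "\<dots> \<le> norm u * norm (x - xs ! i)" by (rule Cauchy_Schwarz_ineq2)
        also have "\<dots> \<le> norm u * \<epsilon>" using EA[of i] i
          by (intro mult_left_mono) (auto simp: A_def dist_norm norm_minus_commute)
        finally show ?thesis by (simp add: mult.commute)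
      qed
      ultimately show ?thesis using True by simp
    next
      case False
      then have "x \<notin> E i" for i using EC by blast
      then show ?thesis using False by (simp add: s_def)
    qed
    have "\<bar>absdot_integral u - (LINT x|lborel. s x)\<bar> = \<bar>LINT x|lborel. indicator ?C x * \<bar>u \<bullet> x\<bar> - s x\<bar>"
      unfolding absdot_integral_def using absdot_integrable sint by (subst Bochner_Integration.integral_diff) auto
    also have "\<dots> \<le> (LINT x|lborel. \<bar>indicator ?C x * \<bar>u \<bullet> x\<bar> - s x\<bar>)" by (rule integral_abs_bound)
    also have "\<dots> \<le> (LINT x|lborel. indicator ?C x * (\<epsilon> * norm u))"
      using absdot_integrable sint emeasure_compact_finite[of ?C]
      by (intro integral_mono pt Bochner_Integration.integrable_abs Bochner_Integration.integrable_diff integrable_mult_left integrable_real_indicator) auto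
    also have "\<dots> = \<epsilon> * norm u * rvol ?C" by simp
    finally show "\<bar>absdot_integral u - (\<Sum>v\<leftarrow>vs. \<bar>u \<bullet> v\<bar>)\<bar> \<le> \<epsilon> * norm u * rvol ?C" by (simp add: ss)
  qed
qed

text \<open>
  The support function of the Riemann sum zonotope is nearly a multiple of the norm, and
  inclusions of closed convex sets are read off from support functions.
\<close>

lemma zonotope_near_ball:
  assumes \<delta>: "0 < \<delta>" "\<delta> < 1" and r: "r > 0"
  obtains vs :: "'a::euclidean_space list"
  where "cball 0 ((1 - \<delta>) * r) \<subseteq> zonotope vs" "zonotope vs \<subseteq> cball 0 r"
proof -
  let ?C = "cball (0::'a) 1"
  obtain c where c: "c > 0" "\<And>u::'a. absdot_integral u = c * norm u" using absdot_const by blast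
  have mC: "rvol ?C > 0" by (simp add: content_cball_gt_0_iff)
  \<comment> \<open>With this tolerance (c - h) / (c + h) is at least 1 - \<delta>.\<close>
  define h where "h = \<delta> * c / 2"
  have h: "h > 0" using c \<delta> by (simp add: h_def)
  obtain ws :: "'a list" where ws: "\<And>u. \<bar>absdot_integral u - (\<Sum>v\<leftarrow>ws. \<bar>u \<bullet> v\<bar>)\<bar> \<le> (h / rvol ?C) * norm u * rvol ?C"
    using riemann_absdot[of "h / rvol ?C"] h mC by (metis divide_pos_pos)
  then have W: "(c - h) * norm u \<le> (\<Sum>v\<leftarrow>ws. \<bar>u \<bullet> v\<bar>)" "(\<Sum>v\<leftarrow>ws. \<bar>u \<bullet> v\<bar>) \<le> (c + h) * norm u" for u
    using ws[of u] mC by (auto simp: c(2) abs_le_iff algebra_simps)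
  define k where "k = r / (c + h)"
  have k: "k > 0" using r c h by (simp add: k_def)
  define vs where "vs = map (\<lambda>v. k *\<^sub>R v) ws"
  have "(\<Sum>v\<leftarrow>vs. \<bar>u \<bullet> v\<bar>) = k * (\<Sum>v\<leftarrow>ws. \<bar>u \<bullet> v\<bar>)" for u
    using k by (simp add: vs_def o_def abs_mult sum_list_const_mult)
  then have V2: "(\<Sum>v\<leftarrow>vs. \<bar>u \<bullet> v\<bar>) \<le> r * norm u" and V1: "(1 - \<delta>) * r * norm u \<le> (\<Sum>v\<leftarrow>vs. \<bar>u \<bullet> v\<bar>)" for u
  proof -
    assume eq: "\<And>u. (\<Sum>v\<leftarrow>vs. \<bar>u \<bullet> v\<bar>) = k * (\<Sum>v\<leftarrow>ws. \<bar>u \<bullet> v\<bar>)"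
    have "k * (\<Sum>v\<leftarrow>ws. \<bar>u \<bullet> v\<bar>) \<le> k * ((c + h) * norm u)" using k W(2) by (intro mult_left_mono) auto
    also have "\<dots> = r * norm u" using c h by (simp add: k_def)
    finally show "(\<Sum>v\<leftarrow>vs. \<bar>u \<bullet> v\<bar>) \<le> r * norm u" by (simp add: eq)
    have "(1 - \<delta>) * (c + h) \<le> c - h"
      using c \<delta> by (simp add: h_def algebra_simps)
    then have "(1 - \<delta>) * (c + h) * k \<le> (c - h) * k" using k by (intro mult_right_mono) auto
    moreover have "(1 - \<delta>) * (c + h) * k = (1 - \<delta>) * r" using c h by (simp add: k_def)
    ultimately have "(1 - \<delta>) * r \<le> k * (c - h)" by (simp only: mult.commute[of k])
    then have "(1 - \<delta>) * r * norm u \<le> k * ((c - h) * norm u)"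
      by (metis mult.assoc mult_right_mono norm_ge_zero)
    also have "\<dots> \<le> k * (\<Sum>v\<leftarrow>ws. \<bar>u \<bullet> v\<bar>)" using k W(1) by (intro mult_left_mono) auto
    finally show "(1 - \<delta>) * r * norm u \<le> (\<Sum>v\<leftarrow>vs. \<bar>u \<bullet> v\<bar>)" by (simp add: eq)
  qed
  show ?thesis
  proof (rule that[of vs])
    show "zonotope vs \<subseteq> cball 0 r"
    proof
      fix z assume "z \<in> zonotope vs"
      then have "z \<bullet> z \<le> (\<Sum>v\<leftarrow>vs. \<bar>z \<bullet> v\<bar>)" using zonotope_support[of vs z] by blast
      then have "norm z * norm z \<le> r * norm z" using V2[of z] by (simp add: dot_square_norm power2_eq_square)
      then show "z \<in> cball 0 r" using r by (cases "z = 0") auto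
    qed
    show "cball 0 ((1 - \<delta>) * r) \<subseteq> zonotope vs"
    proof (rule ccontr)
      assume "\<not> cball 0 ((1 - \<delta>) * r) \<subseteq> zonotope vs"
      then obtain y where "y \<in> cball 0 ((1 - \<delta>) * r)" and y': "y \<notin> zonotope vs" by blast
      then have y: "norm y \<le> (1 - \<delta>) * r" "y \<notin> zonotope vs" by auto
      obtain a b where ab: "a \<bullet> y < b" "\<And>z. z \<in> zonotope vs \<Longrightarrow> a \<bullet> z > b"
        using separating_hyperplane_closed_point[OF zonotope(2) compact_imp_closed[OF zonotope(1)] y(2)] by blast
      obtain z where z: "z \<in> zonotope vs" "(- a) \<bullet> z = (\<Sum>v\<leftarrow>vs. \<bar>(- a) \<bullet> v\<bar>)" using zonotope_support[of vs "- a"] by blast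
      have "(1 - \<delta>) * r * norm a \<le> - (a \<bullet> z)" using V1[of "- a"] z(2) by simp
      also have "\<dots> < - (a \<bullet> y)" using ab(1) ab(2)[OF z(1)] by simp
      also have "\<dots> \<le> norm a * norm y" using norm_cauchy_schwarz[of "- a" y] by simp
      also have "\<dots> \<le> norm a * ((1 - \<delta>) * r)" using y(1) by (intro mult_left_mono) auto
      finally show False by (simp add: mult.commute)
    qed
  qed
qed

lemma msum_mono: "A \<subseteq> B \<Longrightarrow> Y \<subseteq> Z \<Longrightarrow> msum A Y \<subseteq> msum B Z"
  unfolding msum_def by (intro image_mono Sigma_mono) auto

lemma erode_antimono: "Y \<subseteq> Z \<Longrightarrow> erode A Z \<subseteq> erode A Y"
  unfolding erode_def by blast

lemma rvol_mono_compact: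
  fixes A B :: "'a::euclidean_space set"
  shows "compact A \<Longrightarrow> compact B \<Longrightarrow> A \<subseteq> B \<Longrightarrow> rvol A \<le> rvol B"
  using emeasure_mono[of A B lborel] by (simp add: vol_compact borel_compact)

text \<open>
  Squeeze a zonotope between the balls of radii \<open>(1 - \<delta>) r\<close> and
  \<open>r\<close>.
\<close>

lemma parallel_growth_mono:
  fixes A B :: "'a::euclidean_space set"
  assumes A: "compact A" "convex A" and B: "compact B" "convex B" and sub: "A \<subseteq> B"
    and \<delta>: "0 < \<delta>" "\<delta> < 1" and r: "r > 0"
  shows "rvol (msum A (cball 0 ((1 - \<delta>) * r))) - rvol A \<le> rvol (msum B (cball 0 r)) - rvol B"
    and "rvol A - rvol (erode A (cball 0 ((1 - \<delta>) * r))) \<le> rvol (msum B (cball 0 r)) - rvol B"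
proof -
  obtain vs :: "'a list" where vs: "cball 0 ((1 - \<delta>) * r) \<subseteq> zonotope vs" "zonotope vs \<subseteq> cball 0 r"
    using zonotope_near_ball[OF \<delta> r] by blast
  have ne: "cball (0::'a) ((1 - \<delta>) * r) \<noteq> {}" "zonotope vs \<noteq> {}"
    using \<delta> r zonotope(3)[of vs] mult_nonneg_nonneg[of "1 - \<delta>" r] by (auto simp: not_less)
  have 1: "rvol (msum A (cball 0 ((1 - \<delta>) * r))) \<le> rvol (msum A (zonotope vs))"
    using A vs zonotope by (intro rvol_mono_compact msum_mono compact_msum) auto
  have 2: "rvol (msum B (zonotope vs)) \<le> rvol (msum B (cball 0 r))"
    using B vs zonotope by (intro rvol_mono_compact msum_mono compact_msum) auto
  have 3: "rvol (erode A (zonotope vs)) \<le> rvol (erode A (cball 0 ((1 - \<delta>) * r)))"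
    using A vs ne by (intro rvol_mono_compact erode_antimono compact_erode) auto
  show "rvol (msum A (cball 0 ((1 - \<delta>) * r))) - rvol A \<le> rvol (msum B (cball 0 r)) - rvol B"
    using zonotope_growth(1)[OF A B sub, of vs] 1 2 by linarith
  show "rvol A - rvol (erode A (cball 0 ((1 - \<delta>) * r))) \<le> rvol (msum B (cball 0 r)) - rvol B"
    using zonotope_growth(2)[OF A B sub, of vs] 2 3 by linarith
qed

section \<open>Support planes and monotonicity of convex boundaries\<close>

lemma support_at_frontier:
  fixes S :: "'a::euclidean_space set"
  assumes S: "convex S" and x: "x \<in> frontier S"
  obtains u where "norm u = 1" "\<And>y. y \<in> closure S \<Longrightarrow> u \<bullet> y \<le> u \<bullet> x"
proof -
  have "interior (closure S) = interior S" using S by (rule convex_interior_closure)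
  then have xf: "x \<in> closure S" "x \<notin> interior (closure S)" using x by (auto simp: frontier_def)
  have "\<exists>a. a \<noteq> 0 \<and> (\<forall>y\<in>closure S. a \<bullet> x \<le> a \<bullet> y)"
  proof (cases "interior (closure S) = {}")
    case True
    then obtain a b where ab: "a \<noteq> 0" "closure S \<subseteq> {x. a \<bullet> x = b}"
      using empty_interior_subset_hyperplane[of "closure S"] S convex_closure by metis
    then have "\<forall>y\<in>closure S. a \<bullet> x \<le> a \<bullet> y" using xf(1) by (auto simp: subset_iff)
    then show ?thesis using ab(1) by blast
  next
    case False
    then have "x \<notin> rel_interior (closure S)" using xf(2) by (simp add: interior_rel_interior_gen split: if_splits)
    then show ?thesis
      using supporting_hyperplane_rel_boundary[OF convex_closure[OF S] xf(1)] by metis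
  qed
  then obtain a where a: "a \<noteq> 0" "\<And>y. y \<in> closure S \<Longrightarrow> a \<bullet> x \<le> a \<bullet> y" by blast
  show ?thesis
  proof (rule that[of "- (a /\<^sub>R norm a)"])
    show "norm (- (a /\<^sub>R norm a)) = 1" using a(1) by simp
    fix y assume "y \<in> closure S"
    then have "inverse (norm a) * (a \<bullet> x) \<le> inverse (norm a) * (a \<bullet> y)" using a by (intro mult_left_mono) auto
    then show "- (a /\<^sub>R norm a) \<bullet> y \<le> - (a /\<^sub>R norm a) \<bullet> x" by simp
  qed
qed

text \<open>
  A linear functional cannot be maximal at an interior point.
\<close>

lemma support_strict:
  fixes K :: "'a::euclidean_space set"
  assumes K: "open K" and u: "norm u = 1" "\<And>y. y \<in> closure K \<Longrightarrow> u \<bullet> y \<le> m" and w: "w \<in> K"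
  shows "u \<bullet> w < m"
proof -
  obtain e where e: "e > 0" "ball w e \<subseteq> K" using K w by (meson openE)
  have "w + (e / 2) *\<^sub>R u \<in> ball w e" using e(1) u by (simp add: dist_norm)
  then have "w + (e / 2) *\<^sub>R u \<in> closure K" using e(2) closure_subset by blast
  then have "u \<bullet> (w + (e / 2) *\<^sub>R u) \<le> m" by (rule u(2))
  moreover have "u \<bullet> u = 1" using u by (simp add: norm_eq_1)
  ultimately show ?thesis using e(1) by (simp add: inner_add_right)
qed

lemma closest_point_normal:
  fixes A :: "'a::euclidean_space set"
  assumes A: "convex A" "closed A" and x: "x \<in> A" and u: "\<And>y. y \<in> A \<Longrightarrow> u \<bullet> y \<le> u \<bullet> x" and t: "t \<ge> 0"
  shows "closest_point A (x + t *\<^sub>R u) = x"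
proof (rule closest_point_unique[symmetric, OF A x], intro ballI)
  fix y assume y: "y \<in> A"
  have "(norm (x + t *\<^sub>R u - x))\<^sup>2 \<le> (norm (x + t *\<^sub>R u - y))\<^sup>2"
  proof -
    have "(norm (x + t *\<^sub>R u - y))\<^sup>2 = (norm (x - y))\<^sup>2 + 2 * t * (u \<bullet> (x - y)) + (norm (t *\<^sub>R u))\<^sup>2"
      by (simp only: power2_norm_eq_inner) (simp add: inner_diff inner_add inner_commute algebra_simps)
    moreover have "0 \<le> t * (u \<bullet> (x - y))" using u[OF y] t by (simp add: inner_diff_right)
    ultimately show ?thesis by simp
  qed
  then show "dist (x + t *\<^sub>R u) x \<le> dist (x + t *\<^sub>R u) y"
    unfolding dist_norm by (rule power2_le_imp_le) simp
qed

definition dilate :: "'a::euclidean_space \<Rightarrow> real \<Rightarrow> 'a \<Rightarrow> 'a" where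
  "dilate z s x = z + s *\<^sub>R (x - z)"

text \<open>
  Following an outer normal from a boundary point of the smaller body leads to a boundary point of
  the larger one whose nearest point is the starting point. So nearest-point projection, a
  contraction, maps the outer boundary onto a set containing the inner one; rescaling accounts for
  the factor.
\<close>

lemma hausdorff_frontier_mono:
  fixes A B :: "'a::euclidean_space set"
  assumes A: "compact A" "convex A" and B: "bounded B" and s: "s > 0" and AB: "dilate z s ` A \<subseteq> B"
  shows "hausdorff_measure d (frontier A) \<le> ennreal ((1 / s) ^ d) * hausdorff_measure d (frontier B)"
proof (cases "A = {}")
  case True
  then show ?thesis by (simp add: hausdorff_measure_empty)
next
  case False
  have cA: "closed A" using A by (simp add: compact_imp_closed)
  \<comment> \<open>Instead of enlarging A, the boundary of B is shrunk by the inverse ratio before it is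
    projected to A.\<close>
  define \<phi> where "\<phi> y = closest_point A (dilate z (1 / s) y)" for y
  have "frontier A \<subseteq> \<phi> ` frontier B"
  proof
    fix x assume x: "x \<in> frontier A"
    then have xA: "x \<in> A" using cA frontier_subset_closed by blast
    obtain u where u: "norm u = 1" "\<And>y. y \<in> closure A \<Longrightarrow> u \<bullet> y \<le> u \<bullet> x"
      using support_at_frontier[OF A(2) x] by blast
    define x' where "x' = dilate z s x"
    have x'B: "x' \<in> B" using AB xA by (auto simp: x'_def)
    obtain t where t: "t \<ge> 0" "x' + t *\<^sub>R u \<in> frontier B"
    proof (cases "x' \<in> interior B")
      case True
      then obtain d where "0 < d" "x' + d *\<^sub>R u \<in> frontier B"
        using ray_to_frontier[OF B, of x' u] u(1) by (metis norm_zero zero_neq_one)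
      then show ?thesis using that[of d] by auto
    next
      case False
      then have "x' \<in> frontier B" using x'B closure_subset by (auto simp: frontier_def)
      then show ?thesis using that[of 0] by auto
    qed
    have "dilate z (1 / s) (x' + t *\<^sub>R u) = x + (t / s) *\<^sub>R u"
      using s by (simp add: dilate_def x'_def algebra_simps)
    then have "\<phi> (x' + t *\<^sub>R u) = x"
      unfolding \<phi>_def using closest_point_normal[OF A(2) cA xA, of u "t / s"] u(2) t s closure_closed[OF cA] by auto
    then show "x \<in> \<phi> ` frontier B" using t(2) by (metis imageI)
  qed
  then have "hausdorff_measure d (frontier A) \<le> hausdorff_measure d (\<phi> ` frontier B)"
    by (rule hausdorff_measure_mono)
  also have "\<dots> \<le> ennreal ((1 / s) ^ d) * hausdorff_measure d (frontier B)"
  proof (rule hausdorff_measure_lipschitz)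
    fix x y
    have "dist (\<phi> x) (\<phi> y) \<le> dist (dilate z (1 / s) x) (dilate z (1 / s) y)"
      unfolding \<phi>_def by (rule closest_point_lipschitz[OF A(2) cA False])
    also have "dilate z (1 / s) x - dilate z (1 / s) y = (1 / s) *\<^sub>R (x - y)" by (simp add: dilate_def algebra_simps)
    then have "dist (dilate z (1 / s) x) (dilate z (1 / s) y) = (1 / s) * dist x y"
      using s unfolding dist_norm by (metis abs_of_pos norm_scaleR zero_less_divide_1_iff)
    finally show "dist (\<phi> x) (\<phi> y) \<le> (1 / s) * dist x y" .
  qed (use s in auto)
  finally show ?thesis .
qed

text \<open>
  Estimates between dilates of ratio \<open>1 - \<eta>\<close> lose powers of this ratio, which
  disappear in the limit.
\<close>

lemma le_of_dilated_bounds: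
  fixes a b :: ennreal
  assumes le: "\<And>\<eta>::real. 0 < \<eta> \<Longrightarrow> \<eta> < 1 \<Longrightarrow> a \<le> ennreal ((1 / (1 - \<eta>)) ^ k) * b"
  shows "a \<le> b"
proof (cases b)
  case (real r)
  have "((\<lambda>\<eta>. ennreal ((1 / (1 - \<eta>)) ^ k * r)) \<longlongrightarrow> ennreal ((1 / (1 - 0)) ^ k * r)) (at_right (0::real))"
    by (intro tendsto_ennrealI tendsto_intros) auto
  moreover have "eventually (\<lambda>\<eta>. a \<le> ennreal ((1 / (1 - \<eta>)) ^ k * r)) (at_right (0::real))"
    using eventually_at_right_real[of 0 1, simplified]
  proof (rule eventually_mono)
    fix \<eta> :: real assume "0 < \<eta> \<and> \<eta> < 1"
    then show "a \<le> ennreal ((1 / (1 - \<eta>)) ^ k * r)" using le[of \<eta>] real by (simp add: ennreal_mult')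
  qed
  ultimately have "a \<le> ennreal ((1 / (1 - 0)) ^ k * r)"
    by (rule tendsto_lowerbound) simp
  then show ?thesis using real by simp
qed simp

section \<open>Facet area of a polytope\<close>

text \<open>
  The facets of a full-dimensional polytope \<open>P\<close>, with a choice of outer unit normals
  and offsets of their hyperplanes.
\<close>

definition facet_data :: "'a::euclidean_space set \<Rightarrow> 'a set set \<Rightarrow> ('a set \<Rightarrow> 'a) \<Rightarrow> ('a set \<Rightarrow> real) \<Rightarrow> bool" where
  "facet_data P I n b \<longleftrightarrow> finite I \<and> frontier P = \<Union>I \<and>
     (\<forall>F\<in>I. F face_of P \<and> F \<noteq> {} \<and> compact F \<and> norm (n F) = 1 \<and> (\<forall>x\<in>P. x \<bullet> n F \<le> b F) \<and> (\<forall>x. x \<in> F \<longleftrightarrow> x \<in> P \<and> x \<bullet> n F = b F))"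

lemma facet_dataD:
  assumes "facet_data P I n b"
  shows "finite I" "frontier P = \<Union>I"
    and "F \<in> I \<Longrightarrow> F face_of P" "F \<in> I \<Longrightarrow> F \<noteq> {}" "F \<in> I \<Longrightarrow> compact F" "F \<in> I \<Longrightarrow> norm (n F) = 1"
    and "F \<in> I \<Longrightarrow> x \<in> P \<Longrightarrow> x \<bullet> n F \<le> b F" "F \<in> I \<Longrightarrow> x \<in> F \<longleftrightarrow> x \<in> P \<and> x \<bullet> n F = b F"
  using assms unfolding facet_data_def by auto

lemma facet_data_exists:
  fixes P :: "'a::euclidean_space set"
  assumes P: "polytope P" and int: "interior P \<noteq> {}"
  obtains I n b where "facet_data P I n b"
proof -
  define I where "I = {F. F facet_of P}"
  have pP: "polyhedron P" using P by (rule polytope_imp_polyhedron)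
  have fin: "finite I" unfolding I_def by (rule finite_polyhedron_facets[OF pP])
  have fr: "frontier P = \<Union>I"
    using rel_frontier_of_polyhedron[OF pP] rel_frontier_nonempty_interior[OF int] by (simp add: I_def)
  have "\<exists>n b. norm n = 1 \<and> (\<forall>x\<in>P. x \<bullet> n \<le> b) \<and> F = P \<inter> {x. x \<bullet> n = b}" if "F \<in> I" for F
  proof -
    have "F facet_of P" using that by (simp add: I_def)
    then obtain a c where ac: "a \<noteq> 0" "P \<subseteq> {x. a \<bullet> x \<le> c}" "F = P \<inter> {x. a \<bullet> x = c}"
      using facet_of_polyhedron[OF pP] by metis
    let ?n = "a /\<^sub>R norm a" let ?b = "c / norm a"
    have 1: "x \<bullet> ?n = (a \<bullet> x) / norm a" for x by (simp add: inner_commute divide_inverse_commute)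
    have "norm ?n = 1" using ac(1) by simp
    moreover have "\<forall>x\<in>P. x \<bullet> ?n \<le> ?b" unfolding 1 using ac by (auto simp: divide_right_mono)
    moreover have "F = P \<inter> {x. x \<bullet> ?n = ?b}" unfolding 1 using ac(1,3) by auto
    ultimately show ?thesis by blast
  qed
  then obtain n b where nb: "\<And>F. F \<in> I \<Longrightarrow> norm (n F) = 1 \<and> (\<forall>x\<in>P. x \<bullet> n F \<le> b F) \<and> F = P \<inter> {x. x \<bullet> n F = b F}"
    by metis
  have "F face_of P \<and> F \<noteq> {} \<and> compact F" if "F \<in> I" for F
  proof -
    have "F facet_of P" using that by (simp add: I_def)
    then have "F face_of P" "F \<noteq> {}" by (auto simp: facet_of_def)
    then show ?thesis using face_of_imp_compact polytope_imp_convex[OF P] polytope_imp_compact[OF P] by blast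
  qed
  moreover have "x \<in> F \<longleftrightarrow> x \<in> P \<and> x \<bullet> n F = b F" if "F \<in> I" for F x
    using nb[OF that] by auto
  ultimately have "facet_data P I n b" using nb fin fr unfolding facet_data_def by auto
  then show ?thesis by (rule that)
qed

text \<open>
  The offset of a nonempty face is the maximum of its normal functional over \<open>P\<close>, so
  the normal determines the face.
\<close>

lemma facet_normals_distinct:
  assumes I: "facet_data P I n b" and F: "F \<in> I" and G: "G \<in> I" and eq: "n F = n G"
  shows "F = G"
proof -
  note D = facet_dataD[OF I]
  obtain x y where x: "x \<in> F" and y: "y \<in> G" using D(4)[OF F] D(4)[OF G] by blast
  have xF: "x \<in> P" "x \<bullet> n F = b F" and yG: "y \<in> P" "y \<bullet> n G = b G"
    using x y D(8)[OF F] D(8)[OF G] by auto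
  have "b F = b G" using D(7)[OF F yG(1)] D(7)[OF G xF(1)] xF yG eq by simp
  then have "x \<in> F \<longleftrightarrow> x \<in> G" for x using D(8)[OF F] D(8)[OF G] eq by simp
  then show ?thesis by blast
qed

text \<open>
  Facets overlap in lower-dimensional faces. Shrinking each facet towards a point of its relative
  interior makes them disjoint compact sets, on which Hausdorff measure is additive, at the cost
  of a factor that tends to one.
\<close>

lemma facets_hausdorff_sum_le:
  fixes P :: "'a::euclidean_space set"
  assumes I: "facet_data P I n b" and P: "convex P"
  shows "(\<Sum>F\<in>I. hausdorff_measure d F) \<le> hausdorff_measure d (frontier P)"
proof (rule le_of_dilated_bounds)
  fix \<eta> :: real assume \<eta>: "0 < \<eta>" "\<eta> < 1"
  have face: "F face_of P" "F \<noteq> {}" "compact F" if "F \<in> I" for F using facet_dataD[OF I] that by auto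
  have "\<exists>c. c \<in> rel_interior F" if "F \<in> I" for F
    using face[OF that] face_of_imp_convex[OF face(1)[OF that]] rel_interior_eq_empty by blast
  then obtain c where c: "\<And>F. F \<in> I \<Longrightarrow> c F \<in> rel_interior F" by metis
  define s where "s F = (\<lambda>x. x - \<eta> *\<^sub>R (x - c F)) ` F" for F
  have sub: "s F \<subseteq> rel_interior F" if "F \<in> I" for F
    unfolding s_def using rel_interior_convex_shrink[OF face_of_imp_convex[OF face(1)[OF that]] c[OF that]] \<eta> by auto
  have comp: "compact (s F)" if "F \<in> I" for F
    unfolding s_def using face(3)[OF that] by (intro compact_continuous_image continuous_intros)
  have dj: "disjoint_family_on s I"
    unfolding disjoint_family_on_def
  proof (intro ballI impI)
    fix F G assume "F \<in> I" "G \<in> I" "F \<noteq> G"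
    then show "s F \<inter> s G = {}" using sub[of F] sub[of G] face_of_eq[OF face(1) face(1), of F G] by blast
  qed
  have fin: "finite I" using I by (simp add: facet_data_def)
  have H: "hausdorff_measure d F \<le> ennreal ((1 / (1 - \<eta>)) ^ d) * hausdorff_measure d (s F)" if "F \<in> I" for F
  proof -
    define g where "g y = c F + (1 / (1 - \<eta>)) *\<^sub>R (y - c F)" for y
    have "g (x - \<eta> *\<^sub>R (x - c F)) = x" for x
    proof -
      have "x - \<eta> *\<^sub>R (x - c F) - c F = (1 - \<eta>) *\<^sub>R (x - c F)" by (simp add: algebra_simps)
      then show ?thesis using \<eta> by (simp add: g_def)
    qed
    then have "g ` s F = F" by (simp add: s_def image_image)
    moreover have "hausdorff_measure d (g ` s F) \<le> ennreal ((1 / (1 - \<eta>)) ^ d) * hausdorff_measure d (s F)"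
    proof (rule hausdorff_measure_lipschitz)
      fix x y
      have "g x - g y = (1 / (1 - \<eta>)) *\<^sub>R (x - y)" by (simp add: g_def algebra_simps)
      then show "dist (g x) (g y) \<le> (1 / (1 - \<eta>)) * dist x y" using \<eta> by (simp add: dist_norm)
    qed (use \<eta> in auto)
    ultimately show ?thesis by simp
  qed
  have "(\<Sum>F\<in>I. hausdorff_measure d F) \<le> (\<Sum>F\<in>I. ennreal ((1 / (1 - \<eta>)) ^ d) * hausdorff_measure d (s F))"
    by (rule sum_mono[OF H])
  also have "\<dots> = ennreal ((1 / (1 - \<eta>)) ^ d) * (\<Sum>F\<in>I. hausdorff_measure d (s F))" by (simp add: sum_distrib_left)
  also have "(\<Sum>F\<in>I. hausdorff_measure d (s F)) \<le> hausdorff_measure d (\<Union>F\<in>I. s F)"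
    by (rule hausdorff_measure_disjoint_compacts[OF fin comp dj])
  also have "\<dots> \<le> hausdorff_measure d (frontier P)"
  proof (rule hausdorff_measure_mono)
    have "frontier P = \<Union>I" using I by (simp add: facet_data_def)
    then show "(\<Union>F\<in>I. s F) \<subseteq> frontier P" using sub rel_interior_subset by blast
  qed
  finally show "(\<Sum>F\<in>I. hausdorff_measure d F) \<le> ennreal ((1 / (1 - \<eta>)) ^ d) * hausdorff_measure d (frontier P)"
    by (simp add: mult_left_mono)
qed

definition facet_area :: "'a::euclidean_space set set \<Rightarrow> ('a set \<Rightarrow> 'a) \<Rightarrow> ennreal" where
  "facet_area I n = (\<Sum>F\<in>I. vol (prism (n F) F 1))"

lemma facet_area_eq_hausdorff:
  fixes P :: "'a::euclidean_space set"
  assumes I: "facet_data P I n b" and P: "convex P"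
  shows "facet_area I n = hausdorff_measure (DIM('a) - 1) (frontier P)"
proof -
  have "vol (prism (n F) F 1) = hausdorff_measure (DIM('a) - 1) F" if "F \<in> I" for F
  proof (rule hausdorff_measure_flat[symmetric])
    show "x \<bullet> n F = b F" if "x \<in> F" for x using facet_dataD(8)[OF I \<open>F \<in> I\<close>] that by blast
  qed (use I that in \<open>auto simp: facet_data_def\<close>)
  then have eq: "facet_area I n = (\<Sum>F\<in>I. hausdorff_measure (DIM('a) - 1) F)"
    unfolding facet_area_def by (intro sum.cong) auto
  have "frontier P = (\<Union>F\<in>I. F)" "finite I" using I by (auto simp: facet_data_def)
  then have "hausdorff_measure (DIM('a) - 1) (frontier P) \<le> facet_area I n"
    unfolding eq using hausdorff_measure_UN[of I "DIM('a) - 1" "\<lambda>F. F"] by simp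
  then show ?thesis using facets_hausdorff_sum_le[OF I P, of "DIM('a) - 1"] eq by simp
qed

text \<open>
  The facet swept along \<open>n\<close> through the unit slab, so that its fibres match those of
  the slicing formula.
\<close>

definition prism_base :: "'a::euclidean_space \<Rightarrow> real \<Rightarrow> 'a set \<Rightarrow> 'a set" where
  "prism_base n b F = {x. 0 \<le> x \<bullet> n \<and> x \<bullet> n < 1 \<and> x + (b - x \<bullet> n) *\<^sub>R n \<in> F}"

lemma prism_base_borel: assumes "compact F" shows "prism_base n b F \<in> sets borel"
proof -
  have "closed ((\<lambda>x. x + (b - x \<bullet> n) *\<^sub>R n) -` F)"
    using assms by (intro closed_vimage continuous_intros) (auto simp: compact_imp_closed)
  then have [measurable]: "(\<lambda>x. x + (b - x \<bullet> n) *\<^sub>R n) -` F \<in> sets borel" by (rule borel_closed)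
  have "prism_base n b F = {x. 0 \<le> x \<bullet> n \<and> x \<bullet> n < 1} \<inter> (\<lambda>x. x + (b - x \<bullet> n) *\<^sub>R n) -` F"
    by (auto simp: prism_base_def)
  also have "\<dots> \<in> sets borel" by measurable
  finally show ?thesis .
qed

lemma vol_prism:
  fixes F :: "'a::euclidean_space set"
  assumes n: "norm n = 1" and F: "compact F" "\<And>x. x \<in> F \<Longrightarrow> x \<bullet> n = b" and h: "h \<ge> 0"
  shows "vol (prism n F h) = ennreal h * vol (prism_base n b F)"
proof -
  have nn: "n \<bullet> n = 1" using n by (simp add: norm_eq_1)
  have cm: "prism n F h \<in> sets borel" using compact_prism[OF F(1)] by (simp add: borel_compact)
  let ?Z = "{x. 0 \<le> x \<bullet> n \<and> x \<bullet> n < 1}"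
  have fib: "{t. x + t *\<^sub>R n \<in> prism n F h} = (if x + (b - x \<bullet> n) *\<^sub>R n \<in> F then {b - x \<bullet> n..b - x \<bullet> n + h} else {})" for x
  proof -
    have "x + t *\<^sub>R n \<in> prism n F h \<longleftrightarrow> x + (b - x \<bullet> n) *\<^sub>R n \<in> F \<and> t \<in> {b - x \<bullet> n..b - x \<bullet> n + h}" for t
    proof
      assume "x + t *\<^sub>R n \<in> prism n F h"
      then obtain y s where y: "y \<in> F" "0 \<le> s" "s \<le> h" "x + t *\<^sub>R n = y + s *\<^sub>R n" by (auto simp: prism_def)
      have "(x + t *\<^sub>R n) \<bullet> n = (y + s *\<^sub>R n) \<bullet> n" using y(4) by simp
      then have ts: "t = b - x \<bullet> n + s" using F(2)[OF y(1)] by (simp add: inner_add_left nn)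
      have "x + (b - x \<bullet> n) *\<^sub>R n = y" using y(4) unfolding ts by (simp add: algebra_simps)
      then show "x + (b - x \<bullet> n) *\<^sub>R n \<in> F \<and> t \<in> {b - x \<bullet> n..b - x \<bullet> n + h}" using y ts by auto
    next
      assume *: "x + (b - x \<bullet> n) *\<^sub>R n \<in> F \<and> t \<in> {b - x \<bullet> n..b - x \<bullet> n + h}"
      show "x + t *\<^sub>R n \<in> prism n F h" unfolding prism_def
        by (rule image_eqI[of _ _ "(x + (b - x \<bullet> n) *\<^sub>R n, t - (b - x \<bullet> n))"]) (use * in \<open>auto simp: algebra_simps\<close>)
    qed
    then show ?thesis by (simp del: atLeastAtMost_iff)
  qed
  have "vol (prism n F h) = (\<integral>\<^sup>+x. ennreal h * indicator (prism_base n b F) x \<partial>lborel)"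
    unfolding vol_slices[OF n cm] fib
    using h by (intro nn_integral_cong) (auto simp: indicator_def prism_base_def)
  also have "\<dots> = ennreal h * vol (prism_base n b F)"
    using prism_base_borel[OF F(1)] by (subst nn_integral_cmult_indicator) auto
  finally show ?thesis .
qed

section \<open>Boundary neighbourhoods and inner polytopes\<close>

definition tube :: "'a::euclidean_space set \<Rightarrow> real \<Rightarrow> 'a set" where
  "tube S \<epsilon> = {x. S \<noteq> {} \<and> infdist x S < \<epsilon>}"

lemma tube_borel: "tube S \<epsilon> \<in> sets borel"
  unfolding tube_def by (cases "S = {}") (auto intro!: borel_open open_Collect_less continuous_intros)

lemma tubeI: "y \<in> S \<Longrightarrow> dist x y < \<epsilon> \<Longrightarrow> x \<in> tube S \<epsilon>"
  using infdist_le[of y S x] by (auto simp: tube_def)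

lemma tubeE:
  assumes "x \<in> tube S \<epsilon>" "closed S"
  obtains y where "y \<in> S" "dist x y < \<epsilon>"
  using assms infdist_attains_inf[of S x] unfolding tube_def by (metis (mono_tags, lifting) mem_Collect_eq)

lemma codim1_volume_eq: "codim1_volume S = Liminf (at_right 0) (\<lambda>\<epsilon>. vol (tube S \<epsilon>) / ennreal (2 * \<epsilon>))"
  using tube_borel[of S] unfolding codim1_volume_def tube_def[symmetric] by simp

text \<open>
  From each point of the facet, which lies deeper than \<open>\<epsilon>\<close> in
  \<open>K\<close>, the normal ray leaves \<open>K\<close> at some boundary point. Around this
  point the ray stays in the tube for length \<open>2 \<epsilon>\<close>. Integrating over the
  facet gives the bound.
\<close>

lemma prism_layer_lower_bound:
  fixes P K :: "'a::euclidean_space set"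
  assumes I: "facet_data P I n b" and F: "F \<in> I" and K: "bounded K" "open K"
    and e: "e > 0" "\<And>x. x \<in> P \<Longrightarrow> cball x e \<subseteq> K" and \<epsilon>: "0 < \<epsilon>" "\<epsilon> < e"
  defines "R \<equiv> {x. x \<bullet> n F > b F \<and> x + (b F - x \<bullet> n F) *\<^sub>R n F \<in> F}"
  shows "R \<in> sets borel"
    "ennreal (2 * \<epsilon>) * vol (prism (n F) F 1) \<le> vol (tube (frontier K) \<epsilon> \<inter> R)"
proof -
  let ?n = "n F" let ?N = "tube (frontier K) \<epsilon>"
  have n: "norm ?n = 1" and cF: "compact F" and Fb: "\<And>x. x \<in> F \<Longrightarrow> x \<bullet> ?n = b F" and FP: "F \<subseteq> P"
    using facet_dataD[OF I] F by auto
  have nn: "?n \<bullet> ?n = 1" using n by (simp add: norm_eq_1)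
  have "closed ((\<lambda>x. x + (b F - x \<bullet> ?n) *\<^sub>R ?n) -` F)"
    using cF by (intro closed_vimage continuous_intros) (auto simp: compact_imp_closed)
  then have [measurable]: "(\<lambda>x. x + (b F - x \<bullet> ?n) *\<^sub>R ?n) -` F \<in> sets borel" by (rule borel_closed)
  have "R = {x. x \<bullet> ?n > b F} \<inter> (\<lambda>x. x + (b F - x \<bullet> ?n) *\<^sub>R ?n) -` F" by (auto simp: R_def)
  also have "\<dots> \<in> sets borel" by measurable
  finally show Rm: "R \<in> sets borel" .
  have Nm: "?N \<in> sets borel" by (rule tube_borel)
  have Wm: "?N \<inter> R \<in> sets borel" using Rm Nm by (rule sets.Int[rotated])
  have fib: "ennreal (2 * \<epsilon>) \<le> vol {t. x + t *\<^sub>R ?n \<in> ?N \<inter> R}" if x: "x + (b F - x \<bullet> ?n) *\<^sub>R ?n \<in> F" for x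
  proof -
    define f where "f = x + (b F - x \<bullet> ?n) *\<^sub>R ?n"
    have fF: "f \<in> F" using x by (simp add: f_def)
    have ball: "cball f e \<subseteq> K" using e(2) fF FP by blast
    have fK: "f \<in> interior K" using ball e(1) K(2) by (simp add: interior_open subset_iff)
    obtain s0 where s0: "0 < s0" "f + s0 *\<^sub>R ?n \<in> frontier K"
      using ray_to_frontier[OF K(1) fK, of ?n] n by (metis norm_zero zero_neq_one)
    \<comment> \<open>So the whole interval of length 2 \<epsilon> about the exit point lies above the
      facet.\<close>
    have "s0 > e"
    proof (rule ccontr)
      assume "\<not> s0 > e"
      then have "f + s0 *\<^sub>R ?n \<in> cball f e" using s0(1) n by (simp add: dist_norm)
      then have "f + s0 *\<^sub>R ?n \<in> K" using ball by blast
      then show False using s0(2) K(2) by (simp add: frontier_def interior_open)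
    qed
    have "{b F - x \<bullet> ?n + s0 - \<epsilon> <..< b F - x \<bullet> ?n + s0 + \<epsilon>} \<subseteq> {t. x + t *\<^sub>R ?n \<in> ?N \<inter> R}"
    proof
      fix t assume t: "t \<in> {b F - x \<bullet> ?n + s0 - \<epsilon> <..< b F - x \<bullet> ?n + s0 + \<epsilon>}"
      define s where "s = t - (b F - x \<bullet> ?n)"
      have xt: "x + t *\<^sub>R ?n = f + s *\<^sub>R ?n" by (simp add: f_def s_def algebra_simps)
      have s: "\<bar>s - s0\<bar> < \<epsilon>" "s > 0" using t \<open>s0 > e\<close> \<epsilon> by (auto simp: s_def)
      have "dist (f + s *\<^sub>R ?n) (f + s0 *\<^sub>R ?n) = \<bar>s - s0\<bar>"
        using n by (simp add: dist_norm scaleR_left_diff_distrib[symmetric])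
      then have "dist (f + s *\<^sub>R ?n) (f + s0 *\<^sub>R ?n) < \<epsilon>" using s(1) by (simp only:)
      then have "f + s *\<^sub>R ?n \<in> ?N" by (rule tubeI[OF s0(2)])
      moreover have "f + s *\<^sub>R ?n \<in> R"
        using s(2) Fb[OF fF] fF by (simp add: R_def inner_add_left nn)
      ultimately show "t \<in> {t. x + t *\<^sub>R ?n \<in> ?N \<inter> R}" by (simp add: xt)
    qed
    moreover have "{t. x + t *\<^sub>R ?n \<in> ?N \<inter> R} \<in> sets borel"
    proof -
      have "(\<lambda>t. x + t *\<^sub>R ?n) \<in> borel_measurable borel" by measurable
      from measurable_sets[OF this Wm] show ?thesis by (simp add: vimage_def)
    qed
    ultimately have "vol {b F - x \<bullet> ?n + s0 - \<epsilon> <..< b F - x \<bullet> ?n + s0 + \<epsilon>} \<le> vol {t. x + t *\<^sub>R ?n \<in> ?N \<inter> R}"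
      by (intro emeasure_mono) auto
    moreover have "vol {b F - x \<bullet> ?n + s0 - \<epsilon> <..< b F - x \<bullet> ?n + s0 + \<epsilon>} = ennreal (2 * \<epsilon>)"
      using \<epsilon> by simp
    ultimately show ?thesis by simp
  qed
  have "ennreal (2 * \<epsilon>) * vol (prism ?n F 1) = (\<integral>\<^sup>+x. ennreal (2 * \<epsilon>) * indicator (prism_base ?n (b F) F) x \<partial>lborel)"
    using prism_base_borel[OF cF] vol_prism[OF n cF Fb, of 1] by (subst nn_integral_cmult_indicator) auto
  also have "\<dots> \<le> vol (?N \<inter> R)"
    unfolding vol_slices[OF n Wm]
  proof (rule nn_integral_mono)
    fix x
    show "ennreal (2 * \<epsilon>) * indicator (prism_base ?n (b F) F) x
      \<le> indicator {x. 0 \<le> x \<bullet> ?n \<and> x \<bullet> ?n < 1} x * vol {t. x + t *\<^sub>R ?n \<in> ?N \<inter> R}"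
      using fib[of x] by (cases "x \<in> prism_base ?n (b F) F") (auto simp: prism_base_def)
  qed
  finally show "ennreal (2 * \<epsilon>) * vol (prism ?n F 1) \<le> vol (?N \<inter> R)" .
qed

text \<open>
  A point above a facet, over that facet, has its unique nearest point of \<open>P\<close> there.
  Two facets would share this foot point, hence also the direction of the normal.
\<close>

lemma prisms_disjoint:
  fixes P :: "'a::euclidean_space set"
  assumes I: "facet_data P I n b" and F: "F \<in> I" and G: "G \<in> I" and FG: "F \<noteq> G"
  shows "{x. x \<bullet> n F > b F \<and> x + (b F - x \<bullet> n F) *\<^sub>R n F \<in> F} \<inter> {x. x \<bullet> n G > b G \<and> x + (b G - x \<bullet> n G) *\<^sub>R n G \<in> G} = {}"
proof (rule ccontr)
  assume "\<not> ?thesis"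
  then obtain x where x: "x \<bullet> n F > b F" "x + (b F - x \<bullet> n F) *\<^sub>R n F \<in> F" "x \<bullet> n G > b G" "x + (b G - x \<bullet> n G) *\<^sub>R n G \<in> G"
    by blast
  define f where "f = x + (b F - x \<bullet> n F) *\<^sub>R n F" define s where "s = x \<bullet> n F - b F"
  define g where "g = x + (b G - x \<bullet> n G) *\<^sub>R n G" define t where "t = x \<bullet> n G - b G"
  have st: "s > 0" "t > 0" using x by (auto simp: s_def t_def)
  have xf: "x - f = s *\<^sub>R n F" "x - g = t *\<^sub>R n G" by (simp_all add: f_def g_def s_def t_def algebra_simps)
  have "f \<in> F" "g \<in> G" using x by (auto simp: f_def g_def)
  then have fP: "f \<in> P" "f \<bullet> n F = b F" "g \<in> P" "g \<bullet> n G = b G"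
    using facet_dataD(8)[OF I F] facet_dataD(8)[OF I G] by auto
  have le: "g \<bullet> n F \<le> b F" "f \<bullet> n G \<le> b G" and nF: "norm (n F) = 1" "norm (n G) = 1"
    using facet_dataD(6,7)[OF I F] facet_dataD(6,7)[OF I G] fP by auto
  \<comment> \<open>Both foot points satisfy the variational inequality of a nearest point, so they
    coincide.\<close>
  have "(x - f) \<bullet> (g - f) \<le> 0" unfolding xf using le fP st by (simp add: inner_diff_right inner_commute mult_nonneg_nonpos)
  moreover have "(x - g) \<bullet> (f - g) \<le> 0" unfolding xf using le fP st by (simp add: inner_diff_right inner_commute mult_nonneg_nonpos)
  ultimately have "(f - g) \<bullet> (f - g) \<le> 0" by (simp add: inner_diff inner_commute)
  then have "(f - g) \<bullet> (f - g) = 0" using inner_ge_zero[of "f - g"] by linarith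
  then have fg: "f = g" by simp
  then have eq: "s *\<^sub>R n F = t *\<^sub>R n G" using xf by simp
  then have "norm (s *\<^sub>R n F) = norm (t *\<^sub>R n G)" by simp
  then have "s = t" using st nF by simp
  then have "n F = n G" using eq st by simp
  then show False using facet_normals_distinct[OF I F G] FG by blast
qed

lemma facet_area_le_codim1:
  fixes P K :: "'a::euclidean_space set"
  assumes I: "facet_data P I n b" and P: "compact P" and K: "bounded K" "open K" and PK: "P \<subseteq> K"
  shows "facet_area I n \<le> codim1_volume (frontier K)"
proof -
  obtain e where e: "e > 0" "(\<Union>x\<in>P. cball x e) \<subseteq> K"
    using compact_subset_open_imp_cball_epsilon_subset[OF P K(2) PK] by blast
  have e2: "\<And>x. x \<in> P \<Longrightarrow> cball x e \<subseteq> K" using e(2) by blast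
  define R where "R F = {x. x \<bullet> n F > b F \<and> x + (b F - x \<bullet> n F) *\<^sub>R n F \<in> F}" for F
  have fin: "finite I" using I by (simp add: facet_data_def)
  have main: "facet_area I n \<le> vol (tube (frontier K) \<epsilon>) / ennreal (2 * \<epsilon>)"
    if \<epsilon>: "0 < \<epsilon>" "\<epsilon> < e" for \<epsilon>
  proof -
    let ?N = "tube (frontier K) \<epsilon>"
    have Nm: "?N \<in> sets borel" by (rule tube_borel)
    note pr = prism_layer_lower_bound[OF I _ K e(1) e2 \<epsilon>, folded R_def]
    have "ennreal (2 * \<epsilon>) * facet_area I n = (\<Sum>F\<in>I. ennreal (2 * \<epsilon>) * vol (prism (n F) F 1))"
      by (simp add: facet_area_def sum_distrib_left)
    also have "\<dots> \<le> (\<Sum>F\<in>I. vol (?N \<inter> R F))" by (rule sum_mono) (rule pr(2))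
    also have "\<dots> = vol (\<Union>F\<in>I. ?N \<inter> R F)"
    proof (rule sum_emeasure)
      show "disjoint_family_on (\<lambda>F. ?N \<inter> R F) I"
        unfolding disjoint_family_on_def using prisms_disjoint[OF I] unfolding R_def by blast
      show "(\<lambda>F. ?N \<inter> R F) ` I \<subseteq> sets lborel" using pr(1) Nm by auto
    qed (rule fin)
    also have "\<dots> \<le> vol ?N" using Nm by (intro emeasure_mono) auto
    finally have "ennreal (2 * \<epsilon>) * facet_area I n / ennreal (2 * \<epsilon>) \<le> vol ?N / ennreal (2 * \<epsilon>)"
      by (rule divide_right_mono_ennreal)
    moreover have "ennreal (2 * \<epsilon>) * facet_area I n / ennreal (2 * \<epsilon>) = facet_area I n"
      using \<epsilon> mult_divide_eq_ennreal[of "ennreal (2 * \<epsilon>)" "facet_area I n"] by (simp add: mult.commute)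
    ultimately show ?thesis by simp
  qed
  have "eventually (\<lambda>\<epsilon>. \<epsilon> \<in> {0<..<e}) (at_right 0)" using e(1) by (rule eventually_at_right_real)
  then show ?thesis unfolding codim1_volume_eq
    by (intro Liminf_bounded) (auto elim!: eventually_mono intro: main)
qed

section \<open>Dilations\<close>

lemma dilate_into_open_convex:
  assumes K: "open K" "convex K" and c: "c \<in> K" and x: "x \<in> closure K" and s: "0 \<le> s" "s < 1"
  shows "dilate c s x \<in> K"
proof -
  have "x - (1 - s) *\<^sub>R (x - c) \<in> interior K"
    using K c x s by (intro mem_interior_closure_convex_shrink) (auto simp: interior_open)
  moreover have "x - (1 - s) *\<^sub>R (x - c) = dilate c s x" by (simp add: dilate_def algebra_simps)
  ultimately show ?thesis using K by (simp add: interior_open)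
qed

lemma frontier_disjoint_open: "open K \<Longrightarrow> x \<in> frontier K \<Longrightarrow> x \<notin> K"
  by (simp add: frontier_def interior_open)

lemma bounded_closure_distance:
  fixes K :: "'a::euclidean_space set"
  assumes "bounded K"
  obtains D where "D > 0" "\<And>x. x \<in> closure K \<Longrightarrow> norm (x - c) \<le> D"
proof -
  obtain D where "D > 0" "\<And>x. x \<in> closure K \<Longrightarrow> norm x \<le> D"
    using bounded_closure[OF assms] bounded_pos by metis
  then show ?thesis
    using that[of "D + norm c"] norm_triangle_ineq4[of _ c] by (metis add_mono add_pos_nonneg norm_ge_zero order_refl order_trans)
qed

lemma dilate_inverse: "s > 0 \<Longrightarrow> dilate z s (dilate z (1 / s) x) = x" "s > 0 \<Longrightarrow> dilate z (1 / s) (dilate z s x) = x"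
  by (simp_all add: dilate_def)

lemma dilate_dilate: "dilate z s (dilate z t x) = dilate z (s * t) x"
  by (simp add: dilate_def)

lemma continuous_dilate: "continuous_on S (dilate z s)"
  unfolding dilate_def by (intro continuous_intros)

lemma open_dilate:
  assumes s: "s > 0" and K: "open K"
  shows "open (dilate z s ` K)"
proof -
  have "dilate z s ` K = dilate z (1 / s) -` K"
  proof (intro set_eqI iffI)
    fix x assume "x \<in> dilate z s ` K"
    then show "x \<in> dilate z (1 / s) -` K" by (auto simp: dilate_inverse(2)[OF s])
  next
    fix x assume "x \<in> dilate z (1 / s) -` K"
    then show "x \<in> dilate z s ` K" by (intro image_eqI[of _ _ "dilate z (1 / s) x"]) (auto simp: dilate_inverse(1)[OF s])
  qed
  then show ?thesis using K by (simp add: open_vimage continuous_dilate)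
qed

section \<open>Parallel sets and outer polytopes\<close>

lemma prism_mono: "A \<subseteq> B \<Longrightarrow> prism n A h \<subseteq> prism n B h"
  unfolding prism_def by (intro image_mono Sigma_mono) auto

text \<open>
  The prism over \<open>F\<close> is compact, so a neighbourhood of it lies in an open set of
  little larger volume.
\<close>

lemma prism_thickening:
  fixes F :: "'a::euclidean_space set"
  assumes n: "norm n = 1" and F: "compact F" "F \<noteq> {}" and \<eta>: "\<eta> > 0"
  obtains \<rho> where "\<rho> > 0" "compact {y. y \<bullet> n = b \<and> infdist y F \<le> \<rho>}"
    "rvol (prism n {y. y \<bullet> n = b \<and> infdist y F \<le> \<rho>} 1) \<le> rvol (prism n F 1) + \<eta>"
proof -
  have cF: "closed F" using F by (simp add: compact_imp_closed)
  have comp: "compact {y. y \<bullet> n = b \<and> infdist y F \<le> \<rho>}" for \<rho>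
  proof -
    obtain B where B: "\<And>y. y \<in> F \<Longrightarrow> norm y \<le> B" using F compact_imp_bounded bounded_iff by metis
    have "norm y \<le> B + \<rho>" if "infdist y F \<le> \<rho>" for y
    proof -
      obtain f where "f \<in> F" "infdist y F = dist y f" using infdist_attains_inf[OF cF F(2)] by blast
      then have "norm f \<le> B" "norm (y - f) \<le> \<rho>" using B that by (auto simp: dist_norm)
      then show ?thesis using norm_triangle_ineq[of f "y - f"] by simp
    qed
    then have "bounded {y. y \<bullet> n = b \<and> infdist y F \<le> \<rho>}" by (auto simp: bounded_iff)
    moreover have "closed {y. y \<bullet> n = b \<and> infdist y F \<le> \<rho>}"
      by (intro closed_Collect_conj closed_Collect_eq closed_Collect_le continuous_intros)
    ultimately show ?thesis by (simp add: compact_eq_bounded_closed)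
  qed
  have cc: "compact (prism n F 1)" by (rule compact_prism[OF F(1)])
  have cm: "prism n F 1 \<in> sets borel" using cc by (simp add: borel_compact)
  obtain U where U: "open U" "prism n F 1 \<subseteq> U" "vol U \<le> vol (prism n F 1) + ennreal \<eta>"
    using outer_open_approx[OF cm \<eta>] by blast
  obtain \<rho> where \<rho>: "\<rho> > 0" "(\<Union>x\<in>prism n F 1. cball x \<rho>) \<subseteq> U"
    using compact_subset_open_imp_cball_epsilon_subset[OF cc U(1,2)] by blast
  let ?F = "{y. y \<bullet> n = b \<and> infdist y F \<le> \<rho>}"
  have sub: "prism n ?F 1 \<subseteq> U"
  proof
    fix x assume "x \<in> prism n ?F 1"
    then obtain y t where y: "infdist y F \<le> \<rho>" "0 \<le> t" "t \<le> 1" "x = y + t *\<^sub>R n" by (auto simp: prism_def)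
    obtain f where f: "f \<in> F" "infdist y F = dist y f" using infdist_attains_inf[OF cF F(2)] by blast
    have "f + t *\<^sub>R n \<in> prism n F 1" unfolding prism_def using f y by (intro image_eqI[of _ _ "(f,t)"]) auto
    moreover have "x \<in> cball (f + t *\<^sub>R n) \<rho>" using y f by (simp add: dist_norm norm_minus_commute)
    ultimately show "x \<in> U" using \<rho>(2) by blast
  qed
  have "vol (prism n ?F 1) \<le> vol U" using sub U(1) by (intro emeasure_mono) auto
  also note U(3)
  finally have "rvol (prism n ?F 1) \<le> rvol (prism n F 1) + \<eta>"
    using \<eta> by (simp add: vol_compact[OF compact_prism[OF comp]] vol_compact[OF cc] ennreal_plus[symmetric] del: ennreal_plus)
  then show ?thesis using that[OF \<rho>(1) comp] by blast
qed

lemma rvol_prism_scale: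
  fixes F :: "'a::euclidean_space set"
  assumes n: "norm n = 1" and F: "compact F" "\<And>x. x \<in> F \<Longrightarrow> x \<bullet> n = b" and h: "h \<ge> 0"
  shows "rvol (prism n F h) = h * rvol (prism n F 1)"
  using vol_prism[OF n F h] vol_prism[OF n F, of 1] h by (simp add: measure_def enn2real_mult)

text \<open>
  Joining \<open>x\<close> to the centre \<open>z\<close> of an inner ball, the segment crosses
  the boundary at a point \<open>y\<close> of some facet. As \<open>Q\<close> contains a ball of
  radius \<open>r\<close> about \<open>z\<close>, the parallel set of radius
  \<open>\<epsilon>\<close> lies in the dilate of \<open>Q\<close> with ratio \<open>1 +
  \<epsilon> / r\<close>, so \<open>y\<close> is within a multiple of \<open>\<epsilon>\<close>
  from \<open>x\<close>. Hence \<open>x\<close> lies in the prism of height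
  \<open>\<epsilon>\<close> over a slight thickening of that facet.
\<close>

lemma outer_layer_point:
  fixes Q :: "'a::euclidean_space set"
  assumes I: "facet_data Q I n b" and Q: "compact Q" "convex Q"
    and r: "r > 0" "cball z r \<subseteq> Q" and D: "\<And>q. q \<in> Q \<Longrightarrow> norm (q - z) \<le> D"
    and \<epsilon>: "0 < \<epsilon>" "\<epsilon> \<le> 1" and x: "x \<in> msum Q (cball 0 \<epsilon>)" "x \<notin> Q"
  shows "\<exists>F\<in>I. x \<in> prism (n F) {y. y \<bullet> n F = b F \<and> infdist y F \<le> \<epsilon> * ((D + 1) / r)} \<epsilon>"
proof -
  obtain q e where q: "q \<in> Q" "norm e \<le> \<epsilon>" "x = q + e" using x(1) by (auto simp: msum_def)
  have zQ: "z \<in> Q" using r by auto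
  have zi: "z \<in> interior Q" using r by (meson centre_in_ball ball_subset_cball interior_maximal open_ball subset_eq)
  have xz: "x - z \<noteq> 0" using zQ x(2) by auto
  obtain d where d: "0 < d" "z + d *\<^sub>R (x - z) \<in> frontier Q" "\<And>e. 0 \<le> e \<Longrightarrow> e < d \<Longrightarrow> z + e *\<^sub>R (x - z) \<in> interior Q"
    using ray_to_frontier[OF compact_imp_bounded[OF Q(1)] zi xz] by blast
  define y where "y = z + d *\<^sub>R (x - z)"
  have yQ: "y \<in> Q" "y \<in> frontier Q" using d(2) frontier_subset_closed[OF compact_imp_closed[OF Q(1)]] by (auto simp: y_def)
  have d1: "d < 1"
  proof (rule ccontr)
    assume "\<not> d < 1"
    then consider "d = 1" | "d > 1" by linarith
    then show False
    proof cases
      case 1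
      then show ?thesis using yQ x(2) by (simp add: y_def)
    next
      case 2
      then have "z + 1 *\<^sub>R (x - z) \<in> interior Q" by (intro d(3)) auto
      then show ?thesis using x(2) interior_subset by auto
    qed
  qed
  \<comment> \<open>Shrinking x towards z by r / (r + \<epsilon>) gives a convex combination of q and a point
    of the ball about z, so the exit parameter d is at least t.\<close>
  define t where "t = r / (r + \<epsilon>)"
  have t: "0 < t" "t < 1" "1 - t = \<epsilon> / (r + \<epsilon>)" using r \<epsilon> by (auto simp: t_def field_simps)
  have tQ: "z + t *\<^sub>R (x - z) \<in> Q"
  proof -
    have "(r / \<epsilon>) * norm e \<le> (r / \<epsilon>) * \<epsilon>" using q(2) r \<epsilon> by (intro mult_left_mono) auto
    then have "norm ((r / \<epsilon>) *\<^sub>R e) \<le> (r / \<epsilon>) * \<epsilon>" using r \<epsilon> by simp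
    then have "z + (r / \<epsilon>) *\<^sub>R e \<in> cball z r" using \<epsilon> by (simp add: dist_norm)
    then have "z + (r / \<epsilon>) *\<^sub>R e \<in> Q" using r by blast
    then have "t *\<^sub>R q + (1 - t) *\<^sub>R (z + (r / \<epsilon>) *\<^sub>R e) \<in> Q" using t q(1) Q(2) by (intro convexD) auto
    moreover have "(1 - t) * (r / \<epsilon>) = t" unfolding t(3) using r \<epsilon> by (simp add: t_def)
    ultimately have "t *\<^sub>R q + (1 - t) *\<^sub>R z + t *\<^sub>R e \<in> Q" by (simp add: scaleR_add_right add.assoc)
    moreover have "t *\<^sub>R q + (1 - t) *\<^sub>R z + t *\<^sub>R e = z + t *\<^sub>R (x - z)" by (simp add: q(3) algebra_simps)
    ultimately show ?thesis by simp
  qed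
  have td: "t \<le> d"
  proof (rule ccontr)
    assume "\<not> t \<le> d"
    then have "d < t" by simp
    define w where "w = z + t *\<^sub>R (x - z)"
    have "open_segment z w \<subseteq> interior Q"
      using in_interior_closure_convex_segment[OF Q(2) zi] tQ closure_subset unfolding w_def by blast
    moreover have "y \<in> open_segment z w"
    proof -
      have "z \<noteq> w" using t xz by (simp add: w_def)
      moreover have "y = (1 - d / t) *\<^sub>R z + (d / t) *\<^sub>R w" using t by (simp add: y_def w_def algebra_simps)
      ultimately show ?thesis using d(1) \<open>d < t\<close> t unfolding in_segment by (intro conjI exI[of _ "d / t"]) auto
    qed
    ultimately show False using yQ(2) by (auto simp: frontier_def)
  qed
  have "norm (x - z) \<le> D + 1" using D[OF q(1)] q \<epsilon> norm_triangle_ineq[of "q - z" e] by (simp add: algebra_simps)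
  have "x - y = (1 - d) *\<^sub>R (x - z)" by (simp add: y_def algebra_simps)
  then have "norm (x - y) = (1 - d) * norm (x - z)" using d1 by simp
  also have "\<dots> \<le> (\<epsilon> / r) * (D + 1)"
  proof (rule mult_mono)
    have "1 - d \<le> \<epsilon> / (r + \<epsilon>)" using td t(3) by linarith
    also have "\<dots> \<le> \<epsilon> / r" using r \<epsilon> by (simp add: frac_le)
    finally show "1 - d \<le> \<epsilon> / r" .
  qed (use r \<epsilon> \<open>norm (x - z) \<le> D + 1\<close> in auto)
  finally have xy: "norm (x - y) \<le> \<epsilon> * ((D + 1) / r)" by simp
  obtain F where F: "F \<in> I" "y \<in> F" using yQ(2) facet_dataD(2)[OF I] by blast
  note fd = facet_dataD(6-8)[OF I F(1)]
  have yb: "y \<bullet> n F = b F" using fd(3) F(2) by blast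
  have zb: "z \<bullet> n F \<le> b F" by (rule fd(2)[OF zQ])
  have nn: "n F \<bullet> n F = 1" using fd(1) by (simp add: norm_eq_1)
  \<comment> \<open>The centre z lies below the facet plane and y on it, so x, farther along the ray, lies
    above.\<close>
  have lo: "x \<bullet> n F \<ge> b F"
  proof -
    have "d * ((x - z) \<bullet> n F) = b F - z \<bullet> n F" using yb by (simp add: y_def inner_add_left)
    then have "b F - z \<bullet> n F \<le> (x - z) \<bullet> n F"
      using zb d(1) d1 by (smt (verit) mult_less_cancel_right1 mult_nonneg_nonneg zero_le_mult_iff mult_le_cancel_right1)
    then show ?thesis by (simp add: inner_diff_left)
  qed
  have hi: "x \<bullet> n F \<le> b F + \<epsilon>"
  proof -
    have "e \<bullet> n F \<le> norm e * norm (n F)" by (rule norm_cauchy_schwarz)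
    then show ?thesis using fd(1) fd(2)[OF q(1)] q by (simp add: inner_add_left)
  qed
  define x' where "x' = x + (b F - x \<bullet> n F) *\<^sub>R n F"
  have "x' - y = perp (n F) (x - y)" by (simp add: perp_def x'_def inner_diff_left yb algebra_simps)
  then have "dist x' y \<le> norm (x - y)" using norm_perp_le[OF fd(1)] by (simp add: dist_norm)
  then have "infdist x' F \<le> \<epsilon> * ((D + 1) / r)" using infdist_le[OF F(2), of x'] xy by linarith
  moreover have "x' \<bullet> n F = b F" by (simp add: x'_def inner_add_left nn)
  ultimately have "x \<in> prism (n F) {y. y \<bullet> n F = b F \<and> infdist y F \<le> \<epsilon> * ((D + 1) / r)} \<epsilon>"
    unfolding prism_def using lo hi
    by (intro image_eqI[of _ _ "(x', x \<bullet> n F - b F)"]) (auto simp: x'_def algebra_simps)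
  then show ?thesis using F(1) by blast
qed

text \<open>
  The prisms over thickened facets cover the layer. For small \<open>\<epsilon>\<close> the
  thickening adds only a negligible area, which controls the edges and corners without describing
  them.
\<close>

lemma outer_layer_polytope:
  fixes Q :: "'a::euclidean_space set"
  assumes I: "facet_data Q I n b" and Q: "compact Q" "convex Q" and int: "interior Q \<noteq> {}" and \<eta>: "\<eta> > 0"
  obtains \<epsilon>0 where "\<epsilon>0 > 0" "\<And>\<epsilon>. 0 < \<epsilon> \<Longrightarrow> \<epsilon> < \<epsilon>0 \<Longrightarrow>
    rvol (msum Q (cball 0 \<epsilon>)) - rvol Q \<le> \<epsilon> * ((\<Sum>F\<in>I. rvol (prism (n F) F 1)) + \<eta>)"
proof -
  note fd = facet_dataD[OF I]
  define k where "k = \<eta> / (real (card I) + 1)"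
  have k: "k > 0" using \<eta> by (simp add: k_def)
  obtain z where "z \<in> interior Q" using int by blast
  then obtain r where r: "r > 0" "cball z r \<subseteq> Q" by (meson mem_interior_cball)
  have clQ: "closure Q = Q" using Q(1) by (simp add: compact_imp_closed)
  obtain D where D0: "D > 0" and D: "\<And>q. q \<in> Q \<Longrightarrow> norm (q - z) \<le> D"
    using bounded_closure_distance[OF compact_imp_bounded[OF Q(1)]] unfolding clQ by metis
  have "\<exists>\<rho>. \<rho> > 0 \<and> compact {y. y \<bullet> n F = b F \<and> infdist y F \<le> \<rho>} \<and>
    rvol (prism (n F) {y. y \<bullet> n F = b F \<and> infdist y F \<le> \<rho>} 1) \<le> rvol (prism (n F) F 1) + k" if "F \<in> I" for F
    by (rule prism_thickening[OF fd(6)[OF that] fd(5)[OF that] fd(4)[OF that] k, of "b F"]) blast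
  then have "\<forall>F\<in>I. \<exists>\<rho>. \<rho> > 0 \<and> compact {y. y \<bullet> n F = b F \<and> infdist y F \<le> \<rho>} \<and>
    rvol (prism (n F) {y. y \<bullet> n F = b F \<and> infdist y F \<le> \<rho>} 1) \<le> rvol (prism (n F) F 1) + k" by blast
  from bchoice[OF this] obtain \<rho> where "\<forall>F\<in>I. \<rho> F > 0 \<and> compact {y. y \<bullet> n F = b F \<and> infdist y F \<le> \<rho> F} \<and>
    rvol (prism (n F) {y. y \<bullet> n F = b F \<and> infdist y F \<le> \<rho> F} 1) \<le> rvol (prism (n F) F 1) + k"
    by blast
  then have \<rho>: "\<And>F. F \<in> I \<Longrightarrow> \<rho> F > 0" "\<And>F. F \<in> I \<Longrightarrow> compact {y. y \<bullet> n F = b F \<and> infdist y F \<le> \<rho> F}"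
    "\<And>F. F \<in> I \<Longrightarrow> rvol (prism (n F) {y. y \<bullet> n F = b F \<and> infdist y F \<le> \<rho> F} 1) \<le> rvol (prism (n F) F 1) + k"
    by simp_all
  define \<rho>0 where "\<rho>0 = Min (insert 1 (\<rho> ` I))"
  have \<rho>0: "\<rho>0 > 0" "\<And>F. F \<in> I \<Longrightarrow> \<rho>0 \<le> \<rho> F" using fd(1) \<rho>(1) by (auto simp: \<rho>0_def)
  define \<kappa> where "\<kappa> = (D + 1) / r"
  have \<kappa>: "\<kappa> > 0" using D0 r by (simp add: \<kappa>_def)
  define T where "T F = {y. y \<bullet> n F = b F \<and> infdist y F \<le> \<rho> F}" for F
  show ?thesis
  proof (rule that[of "min 1 (\<rho>0 / \<kappa>)"])
    show "min 1 (\<rho>0 / \<kappa>) > 0" using \<rho>0 \<kappa> by simp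
    fix \<epsilon> :: real assume \<epsilon>: "0 < \<epsilon>" "\<epsilon> < min 1 (\<rho>0 / \<kappa>)"
    then have ek: "\<epsilon> * \<kappa> \<le> \<rho>0" using \<kappa> by (simp add: field_simps)
    have cT: "compact (prism (n F) (T F) \<epsilon>)" if "F \<in> I" for F
      using \<rho>(2)[OF that] by (simp add: T_def compact_prism)
    have "msum Q (cball 0 \<epsilon>) \<subseteq> Q \<union> (\<Union>F\<in>I. prism (n F) (T F) \<epsilon>)"
    proof
      fix x assume x: "x \<in> msum Q (cball 0 \<epsilon>)"
      show "x \<in> Q \<union> (\<Union>F\<in>I. prism (n F) (T F) \<epsilon>)"
      proof (cases "x \<in> Q")
        case False
        obtain F where F: "F \<in> I" "x \<in> prism (n F) {y. y \<bullet> n F = b F \<and> infdist y F \<le> \<epsilon> * ((D + 1) / r)} \<epsilon>"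
          using outer_layer_point[OF I Q r D _ _ x False] \<epsilon> by auto
        have "{y. y \<bullet> n F = b F \<and> infdist y F \<le> \<epsilon> * ((D + 1) / r)} \<subseteq> T F"
          using ek \<rho>0(2)[OF F(1)] by (auto simp: T_def \<kappa>_def)
        then have "x \<in> prism (n F) (T F) \<epsilon>" using F(2) prism_mono by blast
        then show ?thesis using F(1) by blast
      qed simp
    qed
    moreover have "compact (\<Union>F\<in>I. prism (n F) (T F) \<epsilon>)" using fd(1) cT by (intro compact_UN) auto
    ultimately have "rvol (msum Q (cball 0 \<epsilon>)) \<le> rvol (Q \<union> (\<Union>F\<in>I. prism (n F) (T F) \<epsilon>))"
      using Q by (intro rvol_mono_compact compact_msum compact_Un) auto
    also have "\<dots> \<le> rvol Q + rvol (\<Union>F\<in>I. prism (n F) (T F) \<epsilon>)"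
      using Q \<open>compact (\<Union>F\<in>I. prism (n F) (T F) \<epsilon>)\<close> by (intro measure_Un_le) (auto simp: borel_compact)
    also have "rvol (\<Union>F\<in>I. prism (n F) (T F) \<epsilon>) \<le> (\<Sum>F\<in>I. rvol (prism (n F) (T F) \<epsilon>))"
      using fd(1) cT by (intro measure_UNION_le) (auto simp: borel_compact)
    also have "\<dots> \<le> (\<Sum>F\<in>I. \<epsilon> * (rvol (prism (n F) F 1) + k))"
    proof (rule sum_mono)
      fix F assume F: "F \<in> I"
      have "rvol (prism (n F) (T F) \<epsilon>) = \<epsilon> * rvol (prism (n F) (T F) 1)"
        using \<epsilon> \<rho>(2)[OF F] fd(6)[OF F] by (intro rvol_prism_scale[where b = "b F"]) (auto simp: T_def)
      also have "\<dots> \<le> \<epsilon> * (rvol (prism (n F) F 1) + k)"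
        using \<epsilon> \<rho>(3)[OF F] by (intro mult_left_mono) (auto simp: T_def)
      finally show "rvol (prism (n F) (T F) \<epsilon>) \<le> \<epsilon> * (rvol (prism (n F) F 1) + k)" .
    qed
    also have "\<dots> = \<epsilon> * ((\<Sum>F\<in>I. rvol (prism (n F) F 1)) + real (card I) * k)"
      by (simp add: sum_distrib_left[symmetric] sum.distrib)
    also have "\<dots> \<le> \<epsilon> * ((\<Sum>F\<in>I. rvol (prism (n F) F 1)) + \<eta>)"
    proof -
      have "real (card I) * k \<le> (real (card I) + 1) * k" using k by simp
      also have "\<dots> = \<eta>" by (simp add: k_def add_nonneg_eq_0_iff)
      finally show ?thesis using \<epsilon> by simp
    qed
    finally show "rvol (msum Q (cball 0 \<epsilon>)) - rvol Q \<le> \<epsilon> * ((\<Sum>F\<in>I. rvol (prism (n F) F 1)) + \<eta>)"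
      by simp
  qed
qed

text \<open>
  The tube about the boundary of \<open>K\<close> lies in the parallel set and avoids the erosion
  of the closure. The outer gain and the inner loss are both at most the gain of \<open>Q\<close>,
  which accounts for the factor two in \<open>2 \<epsilon>\<close>.
\<close>

lemma codim1_le_facet_area:
  fixes K Q :: "'a::euclidean_space set"
  assumes K: "convex_body K" and I: "facet_data Q I n b" and Q: "compact Q" "convex Q" "interior Q \<noteq> {}"
    and KQ: "closure K \<subseteq> Q" and \<delta>: "0 < \<delta>" "\<delta> < 1"
  shows "codim1_volume (frontier K) \<le> ennreal (1 / (1 - \<delta>)) * facet_area I n"
proof -
  let ?A = "closure K"
  let ?S = "\<Sum>F\<in>I. rvol (prism (n F) F 1)"
  have bK: "bounded K" "open K" "convex K" "K \<noteq> {}" using K by (auto simp: convex_body_def)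
  have A: "compact ?A" "convex ?A" using bK by (auto simp: compact_closure convex_closure)
  have fa: "facet_area I n = ennreal ?S"
  proof -
    have "facet_area I n = (\<Sum>F\<in>I. ennreal (rvol (prism (n F) F 1)))"
      unfolding facet_area_def using facet_dataD(5)[OF I] by (intro sum.cong vol_compact compact_prism) auto
    then show ?thesis by simp
  qed
  have S0: "?S \<ge> 0" by (intro sum_nonneg) auto
  have "codim1_volume (frontier K) \<le> ennreal (1 / (1 - \<delta>)) * facet_area I n + ennreal e" if e: "e > 0" for e
  proof -
    define \<eta> where "\<eta> = e * (1 - \<delta>)"
    have \<eta>: "\<eta> > 0" using e \<delta> by (simp add: \<eta>_def)
    obtain \<epsilon>0 where \<epsilon>0: "\<epsilon>0 > 0" "\<And>\<epsilon>. 0 < \<epsilon> \<Longrightarrow> \<epsilon> < \<epsilon>0 \<Longrightarrow>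
      rvol (msum Q (cball 0 \<epsilon>)) - rvol Q \<le> \<epsilon> * (?S + \<eta>)"
      using outer_layer_polytope[OF I Q \<eta>] by blast
    have main: "vol (tube (frontier K) \<epsilon>') / ennreal (2 * \<epsilon>') \<le> ennreal ((?S + \<eta>) / (1 - \<delta>))"
      if \<epsilon>': "0 < \<epsilon>'" "\<epsilon>' < (1 - \<delta>) * \<epsilon>0" for \<epsilon>'
    proof -
      let ?N = "tube (frontier K) \<epsilon>'"
      let ?M = "msum ?A (cball 0 \<epsilon>')" let ?E = "erode ?A (cball 0 \<epsilon>')"
      \<comment> \<open>Comparison of growth costs a factor 1 - \<delta> in the radius.\<close>
      define \<epsilon> where "\<epsilon> = \<epsilon>' / (1 - \<delta>)"
      have \<epsilon>: "0 < \<epsilon>" "\<epsilon> < \<epsilon>0" "(1 - \<delta>) * \<epsilon> = \<epsilon>'" using \<epsilon>' \<delta> by (auto simp: \<epsilon>_def field_simps)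
      have cM: "compact ?M" "compact ?E" using A \<epsilon>' by (auto intro!: compact_msum compact_erode)
      have EM: "?E \<subseteq> ?M"
      proof
        fix x assume "x \<in> ?E"
        then have "x + 0 \<in> ?A" unfolding erode_def using \<epsilon>' by (metis (mono_tags, lifting) centre_in_cball less_imp_le mem_Collect_eq)
        then show "x \<in> ?M" unfolding msum_def using \<epsilon>' by (intro image_eqI[of _ _ "(x, 0)"]) auto
      qed
      have NM: "?N \<subseteq> ?M - ?E"
      proof
        fix x assume x: "x \<in> ?N"
        then obtain y where y: "y \<in> frontier K" "dist x y < \<epsilon>'" by (rule tubeE[OF _ frontier_closed])
        then have xy: "norm (x - y) < \<epsilon>'" by (simp add: dist_norm)
        have yA: "y \<in> ?A" using y(1) by (simp add: frontier_def)
        have "x \<in> ?M" unfolding msum_def using yA xy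
          by (intro image_eqI[of _ _ "(y, x - y)"]) auto
        moreover have "x \<notin> ?E"
        proof
          assume xE: "x \<in> ?E"
          have "ball x \<epsilon>' \<subseteq> ?A"
          proof
            fix w assume "w \<in> ball x \<epsilon>'"
            then have "x + (w - x) \<in> ?A" using xE unfolding erode_def
              by (metis (mono_tags, lifting) dist_norm less_imp_le mem_Collect_eq mem_ball mem_cball_0 norm_minus_commute)
            then show "w \<in> ?A" by simp
          qed
          then have "ball x \<epsilon>' \<subseteq> interior ?A" by (simp add: interior_maximal)
          moreover have "y \<in> ball x \<epsilon>'" using xy by (simp add: dist_norm)
          ultimately have "y \<in> interior ?A" by blast
          then show False using y(1) bK by (simp add: frontier_def convex_interior_closure)
        qed
        ultimately show "x \<in> ?M - ?E" by blast
      qed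
      have bM: "?M \<in> sets borel" "?E \<in> sets borel" using cM by (auto simp: borel_compact)
      have Nm: "?N \<in> sets borel" by (rule tube_borel)
      have "rvol ?M - rvol ?E = (rvol ?M - rvol ?A) + (rvol ?A - rvol ?E)"
        by simp
      also have "\<dots> \<le> (rvol (msum Q (cball 0 \<epsilon>)) - rvol Q) + (rvol (msum Q (cball 0 \<epsilon>)) - rvol Q)"
        using parallel_growth_mono[OF A Q(1,2) KQ \<delta> \<epsilon>(1)] unfolding \<epsilon>(3) by (rule add_mono)
      also have "\<dots> = 2 * (rvol (msum Q (cball 0 \<epsilon>)) - rvol Q)" by (rule mult_2[symmetric])
      also have "\<dots> \<le> 2 * (\<epsilon> * (?S + \<eta>))" using \<epsilon>0(2)[OF \<epsilon>(1,2)] by simp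
      also have "\<dots> = (2 * \<epsilon>') * ((?S + \<eta>) / (1 - \<delta>))" using \<delta> by (simp add: \<epsilon>_def)
      finally have le: "rvol ?M - rvol ?E \<le> (2 * \<epsilon>') * ((?S + \<eta>) / (1 - \<delta>))" .
      have "vol ?N \<le> vol (?M - ?E)" using NM bM by (intro emeasure_mono) auto
      also have "\<dots> = vol ?M - vol ?E"
        using bM EM emeasure_compact_finite[OF cM(2)] by (intro emeasure_Diff) auto
      also have "\<dots> = ennreal (rvol ?M - rvol ?E)"
        by (simp add: vol_compact[OF cM(1)] vol_compact[OF cM(2)] ennreal_minus)
      also have "\<dots> \<le> ennreal ((2 * \<epsilon>') * ((?S + \<eta>) / (1 - \<delta>)))" using le by (rule ennreal_leI)
      finally have "vol ?N / ennreal (2 * \<epsilon>') \<le> ennreal ((2 * \<epsilon>') * ((?S + \<eta>) / (1 - \<delta>))) / ennreal (2 * \<epsilon>')"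
        by (rule divide_right_mono_ennreal)
      also have "\<dots> = ennreal ((?S + \<eta>) / (1 - \<delta>))"
        using \<epsilon>' S0 \<eta> \<delta> by (subst divide_ennreal) auto
      finally show ?thesis .
    qed
    have "eventually (\<lambda>\<epsilon>. \<epsilon> \<in> {0<..<(1 - \<delta>) * \<epsilon>0}) (at_right 0)" using \<epsilon>0(1) \<delta> by (intro eventually_at_right_real) simp
    then have "codim1_volume (frontier K) \<le> ennreal ((?S + \<eta>) / (1 - \<delta>))"
      unfolding codim1_volume_eq by (intro Liminf_le) (auto elim!: eventually_mono intro: main)
    also have "(?S + \<eta>) / (1 - \<delta>) = (1 / (1 - \<delta>)) * ?S + e" using \<delta> by (simp add: \<eta>_def add_divide_distrib)
    also have "ennreal ((1 / (1 - \<delta>)) * ?S + e) = ennreal (1 / (1 - \<delta>)) * facet_area I n + ennreal e"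
      using \<delta> e S0 unfolding fa by (simp add: ennreal_mult[symmetric])
    finally show ?thesis .
  qed
  then show ?thesis by (rule ennreal_le_epsilon)
qed

section \<open>The two boundary measures agree\<close>

text \<open>
  The convex hull of finitely many boxes that cover the compact set.
\<close>

lemma polytope_between:
  fixes C K :: "'a::euclidean_space set"
  assumes C: "compact C" and K: "open K" "convex K" and CK: "C \<subseteq> K"
  obtains P where "polytope P" "C \<subseteq> P" "P \<subseteq> K"
proof -
  have "\<exists>a b. cbox a b \<subseteq> K \<and> x \<in> box a b" if "x \<in> C" for x
    using open_contains_cbox[OF K(1)] CK that by (metis subsetD)
  then obtain a b where ab: "\<And>x. x \<in> C \<Longrightarrow> cbox (a x) (b x) \<subseteq> K" "\<And>x. x \<in> C \<Longrightarrow> x \<in> box (a x) (b x)" by metis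
  obtain T where T: "T \<subseteq> C" "finite T" "C \<subseteq> (\<Union>x\<in>T. box (a x) (b x))"
  proof (rule compactE_image[OF C, of C "\<lambda>x. box (a x) (b x)"])
    show "C \<subseteq> (\<Union>c\<in>C. box (a c) (b c))" using ab(2) by blast
  qed (auto simp: open_box)
  have "\<exists>S. finite S \<and> cbox (a x) (b x) = convex hull S" for x
    using closed_interval_as_convex_hull by metis
  then obtain V where V: "\<And>x. finite (V x)" "\<And>x. cbox (a x) (b x) = convex hull (V x)" by metis
  define P where "P = convex hull (\<Union>x\<in>T. V x)"
  show ?thesis
  proof (rule that[of P])
    show "polytope P" unfolding P_def using T V by (intro polytope_convex_hull) auto
    show "C \<subseteq> P"
    proof
      fix y assume "y \<in> C"
      then obtain x where x: "x \<in> T" "y \<in> box (a x) (b x)" using T by blast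
      then have "y \<in> convex hull (V x)" using box_subset_cbox V(2) by blast
      also have "\<dots> \<subseteq> P" unfolding P_def using x by (intro hull_mono) auto
      finally show "y \<in> P" .
    qed
    have "V x \<subseteq> K" if "x \<in> T" for x using hull_subset[of "V x" convex] V(2) ab(1) T(1) that by blast
    then show "P \<subseteq> K" unfolding P_def using K(2) by (intro hull_minimal) auto
  qed
qed

text \<open>
  An inner polytope that contains the dilate of \<open>K\<close> with ratio \<open>1 -
  \<eta>\<close> gives the lower bound, an outer polytope inside the dilate with ratio \<open>1 /
  (1 - \<eta>)\<close> the upper bound.
\<close>

theorem codim1_volume_eq_hausdorff:
  fixes K :: "'a::euclidean_space set"
  assumes K: "convex_body K"
  shows "codim1_volume (frontier K) = hausdorff_measure (DIM('a) - 1) (frontier K)"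
proof -
  let ?d = "DIM('a) - 1" let ?A = "closure K"
  have bK: "bounded K" "open K" "convex K" "K \<noteq> {}" using K by (auto simp: convex_body_def)
  have A: "compact ?A" "convex ?A" using bK by (auto simp: compact_closure convex_closure)
  have intA: "interior ?A = K" using bK by (simp add: convex_interior_closure interior_open)
  have fA: "frontier ?A = frontier K" using intA bK by (simp add: frontier_def interior_open)
  obtain z where z: "z \<in> K" using bK by blast
  have zi: "z \<in> interior K" using z bK by (simp add: interior_open)
  have dilin: "dilate z (1 - \<eta>) x \<in> K" if "0 < \<eta>" "\<eta> < 1" "x \<in> ?A" for \<eta> x
    using bK z that by (intro dilate_into_open_convex) auto
  have lower: "hausdorff_measure ?d (frontier K) \<le> codim1_volume (frontier K)"
  proof (rule le_of_dilated_bounds)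
    fix \<eta> :: real assume \<eta>: "0 < \<eta>" "\<eta> < 1"
    have "compact (dilate z (1 - \<eta>) ` ?A)" using A by (intro compact_continuous_image continuous_dilate) auto
    moreover have "dilate z (1 - \<eta>) ` ?A \<subseteq> K" using dilin[OF \<eta>] by blast
    ultimately obtain P where P: "polytope P" "dilate z (1 - \<eta>) ` ?A \<subseteq> P" "P \<subseteq> K"
      using polytope_between bK by metis
    have "dilate z (1 - \<eta>) ` K \<subseteq> interior P"
      using P(2) closure_subset[of K] \<eta> bK by (intro interior_maximal open_dilate) auto
    then have "interior P \<noteq> {}" using bK by blast
    then obtain I n b where I: "facet_data P I n b" using facet_data_exists[OF P(1)] by blast
    have "hausdorff_measure ?d (frontier ?A) \<le> ennreal ((1 / (1 - \<eta>)) ^ ?d) * hausdorff_measure ?d (frontier P)"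
      using \<eta> polytope_imp_bounded[OF P(1)] P(2) by (intro hausdorff_frontier_mono[OF A]) auto
    also have "hausdorff_measure ?d (frontier P) = facet_area I n"
      using facet_area_eq_hausdorff[OF I polytope_imp_convex[OF P(1)]] by simp
    also have "\<dots> \<le> codim1_volume (frontier K)"
      by (rule facet_area_le_codim1[OF I polytope_imp_compact[OF P(1)] bK(1,2) P(3)])
    finally show "hausdorff_measure ?d (frontier K) \<le> ennreal ((1 / (1 - \<eta>)) ^ ?d) * codim1_volume (frontier K)"
      unfolding fA by (simp add: mult_left_mono)
  qed
  have upper: "codim1_volume (frontier K) \<le> hausdorff_measure ?d (frontier K)"
  proof (rule le_of_dilated_bounds)
    fix \<eta> :: real assume \<eta>: "0 < \<eta>" "\<eta> < 1"
    let ?K = "dilate z (1 / (1 - \<eta>)) ` K"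
    have inv: "dilate z (1 - \<eta>) (dilate z (1 / (1 - \<eta>)) x) = x" "dilate z (1 / (1 - \<eta>)) (dilate z (1 - \<eta>) x) = x" for x
      using dilate_inverse[of "1 - \<eta>" z x] \<eta> by simp_all
    have oK: "open ?K" using \<eta> bK by (intro open_dilate) auto
    have cK: "convex ?K"
    proof -
      have "?K = (\<lambda>x. (z - (1 / (1 - \<eta>)) *\<^sub>R z) + (1 / (1 - \<eta>)) *\<^sub>R x) ` K"
        by (intro image_cong) (auto simp: dilate_def algebra_simps)
      then show ?thesis using bK by (simp add: convex_affinity)
    qed
    have "?A \<subseteq> ?K"
    proof
      fix x assume "x \<in> ?A"
      then have "dilate z (1 - \<eta>) x \<in> K" by (rule dilin[OF \<eta>])
      then show "x \<in> ?K" using inv by (metis imageI)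
    qed
    then obtain Q where Q: "polytope Q" "?A \<subseteq> Q" "Q \<subseteq> ?K" using polytope_between[OF A(1) oK cK] by blast
    have "K \<subseteq> interior Q" using Q(2) closure_subset[of K] bK by (intro interior_maximal) auto
    then have int: "interior Q \<noteq> {}" using bK by blast
    then obtain I n b where I: "facet_data Q I n b" using facet_data_exists[OF Q(1)] by blast
    note cQ = polytope_imp_compact[OF Q(1)] polytope_imp_convex[OF Q(1)]
    have "dilate z (1 - \<eta>) ` Q \<subseteq> K" using Q(3) inv by auto
    then have "hausdorff_measure ?d (frontier Q) \<le> ennreal ((1 / (1 - \<eta>)) ^ ?d) * hausdorff_measure ?d (frontier K)"
      using \<eta> bK by (intro hausdorff_frontier_mono[OF cQ]) auto
    then have fa: "facet_area I n \<le> ennreal ((1 / (1 - \<eta>)) ^ ?d) * hausdorff_measure ?d (frontier K)"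
      using facet_area_eq_hausdorff[OF I cQ(2)] by simp
    have "codim1_volume (frontier K) \<le> ennreal (1 / (1 - \<eta>)) * facet_area I n"
      by (rule codim1_le_facet_area[OF K I cQ int Q(2) \<eta>])
    also have "\<dots> \<le> ennreal (1 / (1 - \<eta>)) * (ennreal ((1 / (1 - \<eta>)) ^ ?d) * hausdorff_measure ?d (frontier K))"
      using fa by (rule mult_left_mono) simp
    also have "\<dots> = ennreal ((1 / (1 - \<eta>)) ^ Suc ?d) * hausdorff_measure ?d (frontier K)"
      using \<eta> by (subst power_Suc, subst ennreal_mult') (auto simp: mult.assoc)
    finally show "codim1_volume (frontier K) \<le> ennreal ((1 / (1 - \<eta>)) ^ Suc ?d) * hausdorff_measure ?d (frontier K)" .
  qed
  show ?thesis using lower upper by (rule antisym[rotated])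
qed

section \<open>The inradius inequality\<close>

lemma vol_dilate:
  fixes S :: "'a::euclidean_space set"
  assumes s: "s > 0" and S: "S \<in> sets borel" and dS: "dilate z s ` S \<in> sets borel"
  shows "vol (dilate z s ` S) = ennreal (s ^ DIM('a)) * vol S"
proof -
  have eq: "dilate z s ` S = (\<lambda>x. s *\<^sub>R x + (z - s *\<^sub>R z)) ` S"
    by (intro image_cong) (auto simp: dilate_def algebra_simps)
  have "vol (dilate z s ` S) = emeasure lebesgue (dilate z s ` S)" using dS by simp
  also have "\<dots> = ennreal (\<bar>s\<bar> ^ DIM('a)) * emeasure lebesgue S"
    unfolding eq using emeasure_lebesgue_affine[of s "z - s *\<^sub>R z" S] by (simp add: ennreal_power)
  finally show ?thesis using s S by simp
qed

lemma rvol_dilate_open: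
  fixes K :: "'a::euclidean_space set"
  assumes "s > 0" "open K"
  shows "rvol (dilate z s ` K) = s ^ DIM('a) * rvol K"
  using vol_dilate[OF assms(1), of K z] open_dilate[OF assms] assms by (simp add: measure_def enn2real_mult)

lemma rvol_dilate_compact:
  fixes K :: "'a::euclidean_space set"
  assumes "s > 0" "compact K"
  shows "rvol (dilate z s ` K) = s ^ DIM('a) * rvol K"
proof -
  have "compact (dilate z s ` K)" using assms by (intro compact_continuous_image continuous_dilate) auto
  then show ?thesis using vol_dilate[OF assms(1), of K z] assms by (simp add: measure_def enn2real_mult borel_compact)
qed

text \<open>
  Otherwise some boundary point \<open>q\<close> lies within \<open>\<epsilon>\<close> of the
  shrunk point. But shrinking towards \<open>c\<close> moves \<open>x\<close> at least the
  fraction \<open>\<epsilon> / s\<close> of the distance from \<open>c\<close> to the support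
  plane at \<open>q\<close> below this plane, that is, at least \<open>\<epsilon>\<close>. Only
  support planes near the shrunk point matter, which allows the lemma to be applied locally.
\<close>

lemma shrunk_point_deep:
  fixes K :: "'a::euclidean_space set"
  assumes K: "bounded K" "open K" "convex K" and c: "c \<in> K" and x: "x \<in> closure K"
    and s: "s > 0" and \<epsilon>: "0 < \<epsilon>" "\<epsilon> < s"
    and far: "\<And>q u. q \<in> frontier K \<Longrightarrow> dist (dilate c (1 - \<epsilon> / s) x) q < \<epsilon> \<Longrightarrow> norm u = 1 \<Longrightarrow>
       (\<And>y. y \<in> closure K \<Longrightarrow> u \<bullet> y \<le> u \<bullet> q) \<Longrightarrow> u \<bullet> (q - c) \<ge> s"
  shows "ball (dilate c (1 - \<epsilon> / s) x) \<epsilon> \<subseteq> K"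
proof (rule ccontr)
  let ?p = "dilate c (1 - \<epsilon> / s) x"
  assume not: "\<not> ball ?p \<epsilon> \<subseteq> K"
  have "?p \<in> K" using K c x s \<epsilon> by (intro dilate_into_open_convex) auto
  then have "?p \<in> ball ?p \<epsilon> \<inter> K" using \<epsilon> by simp
  then have "ball ?p \<epsilon> \<inter> K \<noteq> {}" by blast
  then obtain q where q: "q \<in> ball ?p \<epsilon>" "q \<in> frontier K"
    using connected_Int_frontier[of "ball ?p \<epsilon>" K] not by auto
  obtain u where u: "norm u = 1" "\<And>y. y \<in> closure K \<Longrightarrow> u \<bullet> y \<le> u \<bullet> q"
    using support_at_frontier[OF K(3) q(2)] by blast
  have uq: "u \<bullet> (q - c) \<ge> s" using q by (intro far u) auto
  have "u \<bullet> (q - c) = u \<bullet> (q - ?p) + u \<bullet> (?p - c)" by (simp add: inner_diff_right)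
  also have "u \<bullet> (q - ?p) \<le> norm u * norm (q - ?p)" by (rule norm_cauchy_schwarz)
  also have "norm u * norm (q - ?p) < \<epsilon>" using u(1) q(1) by (simp add: dist_norm norm_minus_commute)
  also have "u \<bullet> (?p - c) = (1 - \<epsilon> / s) * (u \<bullet> (x - c))" by (simp add: dilate_def)
  also have "\<dots> \<le> (1 - \<epsilon> / s) * (u \<bullet> (q - c))"
    using u(2)[OF x] s \<epsilon> by (intro mult_left_mono) (auto simp: inner_diff_right)
  finally have "(\<epsilon> / s) * (u \<bullet> (q - c)) < \<epsilon>" by (simp add: algebra_simps)
  moreover have "(\<epsilon> / s) * s \<le> (\<epsilon> / s) * (u \<bullet> (q - c))" using uq s \<epsilon> by (intro mult_left_mono) auto
  ultimately show False using s by simp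
qed

lemma support_ge_inradius:
  fixes K :: "'a::euclidean_space set"
  assumes r: "r > 0" "ball c r \<subseteq> K" and u: "norm u = 1" "\<And>y. y \<in> closure K \<Longrightarrow> u \<bullet> y \<le> u \<bullet> q"
  shows "u \<bullet> (q - c) \<ge> r"
proof -
  have "closure (ball c r) \<subseteq> closure K" using r by (intro closure_mono)
  moreover have "c + r *\<^sub>R u \<in> closure (ball c r)" using r u by (simp add: dist_norm)
  ultimately have "u \<bullet> (c + r *\<^sub>R u) \<le> u \<bullet> q" using u(2) by blast
  moreover have "u \<bullet> u = 1" using u(1) by (simp add: norm_eq_1)
  ultimately show ?thesis by (simp add: inner_diff_right inner_add_right)
qed

text \<open>
  The difference quotient at zero of the volume of the dilated body minus that of the union of the
  shrunk body with a slightly less shrunk cone.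
\<close>

lemma layer_tendsto:
  fixes r s V W :: real
  assumes r: "r > 0" and s: "s > 0"
  shows "((\<lambda>\<epsilon>. ((1 + \<epsilon> / r) ^ N * V - ((1 - \<epsilon> / r) ^ N * V + ((1 - \<epsilon> / s) ^ N - (1 - \<epsilon> / r) ^ N) * W)) / (2 * \<epsilon>))
     \<longlongrightarrow> real N / r * V - real N / 2 * (1 / r - 1 / s) * W) (at_right 0)"
proof -
  let ?f = "\<lambda>\<epsilon>. (1 + \<epsilon> / r) ^ N * V - ((1 - \<epsilon> / r) ^ N * V + ((1 - \<epsilon> / s) ^ N - (1 - \<epsilon> / r) ^ N) * W)"
  let ?D = "real N / r * V - real N / 2 * (1 / r - 1 / s) * W"
  have lin: "((\<lambda>\<epsilon>. (1 + \<epsilon> * a) ^ N) has_real_derivative real N * a) (at 0)" for a :: real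
    by (auto intro!: derivative_eq_intros)
  have P: "((\<lambda>\<epsilon>. (1 + \<epsilon> / r) ^ N) has_real_derivative real N / r) (at 0)"
    using lin[of "1 / r"] by simp
  have M: "((\<lambda>\<epsilon>. (1 - \<epsilon> / t) ^ N) has_real_derivative - (real N / t)) (at 0)" for t :: real
    using lin[of "- 1 / t"] by simp
  have "(?f has_real_derivative (2 * ?D)) (at 0)"
    by (rule DERIV_cong[OF DERIV_diff[OF DERIV_cmult_right[OF P] DERIV_add[OF DERIV_cmult_right[OF M]
          DERIV_cmult_right[OF DERIV_diff[OF M M]]]]]) (use r s in \<open>simp add: field_simps\<close>)
  then have "((\<lambda>h. (?f (0 + h) - ?f 0) / h) \<longlongrightarrow> 2 * ?D) (at 0)" by (simp add: DERIV_def)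
  then have "((\<lambda>h. (?f h / h) / 2) \<longlongrightarrow> (2 * ?D) / 2) (at 0)" by (intro tendsto_divide tendsto_const) auto
  moreover have "(2 * ?D) / 2 = ?D" by (rule nonzero_mult_div_cancel_left) simp
  moreover have "(?f h / h) / 2 = ?f h / (2 * h)" for h by (simp only: divide_divide_eq_left mult.commute[of h 2])
  ultimately have "((\<lambda>h. ?f h / (2 * h)) \<longlongrightarrow> ?D) (at 0)" by (simp only:)
  then show ?thesis by (rule filterlim_mono[OF _ order_refl at_le]) simp
qed

definition cone_over :: "'a::euclidean_space \<Rightarrow> 'a set \<Rightarrow> 'a set" where
  "cone_over c S = (\<lambda>(t, x). dilate c t x) ` ({0..1} \<times> S)"

lemma compact_cone_over: "compact S \<Longrightarrow> compact (cone_over c S)"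
  unfolding cone_over_def dilate_def case_prod_beta
  by (intro compact_continuous_image compact_Times continuous_intros) auto

text \<open>
  The tube lies in the dilate of \<open>K\<close> with ratio \<open>1 + \<epsilon> / r\<close> and
  avoids the points at depth \<open>\<epsilon>\<close>. Among these are the dilate with ratio
  \<open>1 - \<epsilon> / r\<close> and, by assumption, the dilate with ratio \<open>1 -
  \<epsilon> / s\<close> of the cone over \<open>S\<close>. With \<open>S\<close> empty this is
  the inradius inequality; a cone of positive volume and \<open>s > r\<close> make it strict.
\<close>

lemma codim1_upper_bound:
  fixes K S :: "'a::euclidean_space set"
  assumes K: "convex_body K" and r: "r > 0" "ball c r \<subseteq> K" and rs: "r \<le> s"
    and S: "compact S" "S \<subseteq> frontier K"
    and e0: "e0 > 0" and deep: "\<And>\<epsilon> x. 0 < \<epsilon> \<Longrightarrow> \<epsilon> < e0 \<Longrightarrow> x \<in> S \<Longrightarrow> ball (dilate c (1 - \<epsilon> / s) x) \<epsilon> \<subseteq> K"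
  shows "codim1_volume (frontier K) \<le> ennreal (real DIM('a) / r * rvol K
     - real DIM('a) / 2 * (1 / r - 1 / s) * rvol (cone_over c S))"
proof -
  define C where "C = cone_over c S"
  let ?N = "DIM('a)" let ?V = "rvol K" let ?W = "rvol C"
  have bK: "bounded K" "open K" "convex K" "K \<noteq> {}" using K by (auto simp: convex_body_def)
  have s: "s > 0" using r rs by simp
  have cK: "c \<in> K" using r by auto
  have fK: "x \<notin> K" if "x \<in> frontier K" for x using frontier_disjoint_open that bK by blast
  have fin: "vol X < \<infinity>" if "X \<subseteq> dilate c t ` K" for X t
  proof -
    have "bounded (dilate c t ` K)"
    proof -
      have "dilate c t ` K \<subseteq> dilate c t ` closure K" using closure_subset by blast
      moreover have "compact (dilate c t ` closure K)"
        using bK by (intro compact_continuous_image continuous_dilate) (auto simp: compact_closure)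
      ultimately show ?thesis using bounded_subset compact_imp_bounded by blast
    qed
    then show ?thesis using that emeasure_bounded_finite bounded_subset by blast
  qed
  have finK: "vol K < \<infinity>" using bK emeasure_bounded_finite by blast
  have cC: "compact C" unfolding C_def by (rule compact_cone_over[OF S(1)])
  have main: "vol (tube (frontier K) \<epsilon>) / ennreal (2 * \<epsilon>)
     \<le> ennreal (((1 + \<epsilon> / r) ^ ?N * ?V - ((1 - \<epsilon> / r) ^ ?N * ?V + ((1 - \<epsilon> / s) ^ ?N - (1 - \<epsilon> / r) ^ ?N) * ?W)) / (2 * \<epsilon>))"
    if \<epsilon>: "0 < \<epsilon>" "\<epsilon> < min e0 r" for \<epsilon>
  proof -
    let ?L = "tube (frontier K) \<epsilon>"
    define l where "l = 1 - \<epsilon> / r" define m where "m = 1 - \<epsilon> / s" define k where "k = 1 + \<epsilon> / r"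
    have l: "0 < l" "l \<le> m" "m < 1" "0 < m" "k > 1"
    proof -
      show "0 < l" using \<epsilon> r by (simp add: l_def)
      show "l \<le> m" using \<epsilon> r rs by (simp add: l_def m_def frac_le)
      then show "0 < m" using \<open>0 < l\<close> by linarith
      show "m < 1" using \<epsilon> s by (simp add: m_def)
      show "k > 1" using \<epsilon> r by (simp add: k_def)
    qed
    define A where "A = dilate c l ` K" define B where "B = dilate c m ` C" define O1 where "O1 = dilate c k ` K"
    have oA: "open A" "open O1" unfolding A_def O1_def using l bK by (auto intro: open_dilate)
    have cB: "compact B" unfolding B_def using cC by (intro compact_continuous_image continuous_dilate) auto
    have mm: "A \<in> sets borel" "B \<in> sets borel" "O1 \<in> sets borel" "K \<in> sets borel"
      using oA cB bK by (auto simp: borel_compact)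
    have deepA: "ball x \<epsilon> \<subseteq> K" if xA: "x \<in> A" for x
    proof -
      obtain y where y: "y \<in> K" "x = dilate c (1 - \<epsilon> / r) y" using xA by (auto simp: A_def l_def)
      have "ball (dilate c (1 - \<epsilon> / r) y) \<epsilon> \<subseteq> K"
        using bK cK y(1) closure_subset r(1) \<epsilon>
        by (intro shrunk_point_deep) (auto intro: support_ge_inradius[OF r])
      then show ?thesis by (simp add: y)
    qed
    have deepc: "ball c \<epsilon> \<subseteq> K" using r \<epsilon> by (auto simp: subset_iff)
    \<comment> \<open>A point of the cone is a combination of c and a shrunk point of S; balls of radius
      \<epsilon> about both lie in K.\<close>
    have deepB: "ball x \<epsilon> \<subseteq> K" if xB: "x \<in> B" for x
    proof -
      obtain t y where y: "0 \<le> t" "t \<le> 1" "y \<in> S" "x = dilate c m (dilate c t y)" using xB by (auto simp: B_def C_def cone_over_def)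
      define p where "p = dilate c m y"
      have bp: "ball p \<epsilon> \<subseteq> K" unfolding p_def m_def using deep \<epsilon> y(3) by auto
      have xp: "x = (1 - t) *\<^sub>R c + t *\<^sub>R p" by (simp add: y(4) p_def dilate_def algebra_simps)
      show ?thesis
      proof
        fix w assume w: "w \<in> ball x \<epsilon>"
        have "c + (w - x) \<in> K" "p + (w - x) \<in> K" using w deepc bp by (auto simp: dist_norm norm_minus_commute subset_iff)
        then have "(1 - t) *\<^sub>R (c + (w - x)) + t *\<^sub>R (p + (w - x)) \<in> K" using y bK by (intro convexD) auto
        moreover have "(1 - t) *\<^sub>R (c + (w - x)) + t *\<^sub>R (p + (w - x)) = w" by (simp add: xp algebra_simps)
        ultimately show "w \<in> K" by simp
      qed
    qed
    have deepL: "x \<notin> ?L" if "ball x \<epsilon> \<subseteq> K" for x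
    proof
      assume "x \<in> ?L"
      then obtain y where "y \<in> frontier K" "dist x y < \<epsilon>"
        by (rule tubeE[OF _ frontier_closed])
      then show False using that fK by auto
    qed
    have LO: "?L \<subseteq> O1 - (A \<union> B)"
    proof
      fix x assume x: "x \<in> ?L"
      then obtain y where y: "y \<in> frontier K" "dist x y < \<epsilon>"
        by (rule tubeE[OF _ frontier_closed])
      \<comment> \<open>The shrunk point is the combination of y and a point w of the inscribed ball, hence
        interior.\<close>
      define h where "h = \<epsilon> / (r + \<epsilon>)"
      have h: "0 < h" "h < 1" "1 - h = 1 / k" "h * (r / \<epsilon>) = 1 - h" using r \<epsilon> by (auto simp: h_def k_def field_simps)
      define w where "w = c + (r / \<epsilon>) *\<^sub>R (x - y)"
      have "norm (x - y) * (r / \<epsilon>) < \<epsilon> * (r / \<epsilon>)" using y(2) r \<epsilon> by (intro mult_strict_right_mono) (auto simp: dist_norm)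
      then have "w \<in> ball c r" using r \<epsilon> by (simp add: w_def dist_norm mult.commute)
      then have "w \<in> interior K" using r bK by (auto simp: interior_open)
      moreover have "y \<in> closure K" using y(1) by (simp add: frontier_def)
      ultimately have "y - h *\<^sub>R (y - w) \<in> interior K" using bK h by (intro mem_interior_closure_convex_shrink) auto
      moreover have "y - h *\<^sub>R (y - w) = dilate c (1 / k) x"
      proof -
        have "y - h *\<^sub>R (y - w) = (1 - h) *\<^sub>R y + h *\<^sub>R c + (h * (r / \<epsilon>)) *\<^sub>R (x - y)"
          by (simp add: w_def algebra_simps)
        also have "\<dots> = (1 - h) *\<^sub>R x + h *\<^sub>R c" unfolding h(4) by (simp add: algebra_simps)
        also have "\<dots> = dilate c (1 - h) x" by (simp add: dilate_def algebra_simps)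
        finally show ?thesis by (simp add: h(3))
      qed
      ultimately have "dilate c (1 / k) x \<in> K" using bK by (simp add: interior_open)
      then have "x \<in> O1" unfolding O1_def using dilate_inverse(1)[of k c x] l by (metis imageI less_trans zero_less_one)
      moreover have "x \<notin> A \<union> B" using deepA deepB deepL x by blast
      ultimately show "x \<in> O1 - (A \<union> B)" by blast
    qed
    have AK: "A \<union> B \<subseteq> O1"
    proof
      fix x assume "x \<in> A \<union> B"
      then have "ball x \<epsilon> \<subseteq> K" using deepA deepB by blast
      then have xK: "x \<in> K" using \<epsilon> by auto
      have "dilate c (1/k) x \<in> K" using bK cK xK l closure_subset by (intro dilate_into_open_convex) auto
      then show "x \<in> O1" unfolding O1_def using dilate_inverse(1)[of k c x] l by (metis imageI less_trans zero_less_one)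
    qed
    \<comment> \<open>The two inner sets overlap only inside the cone shrunk by l, because points of S lie
      outside K.\<close>
    have ABsub: "A \<inter> B \<subseteq> dilate c l ` C"
    proof
      fix p assume p: "p \<in> A \<inter> B"
      obtain y where y: "y \<in> K" "p = dilate c l y" using p by (auto simp: A_def)
      obtain t x where x: "0 \<le> t" "t \<le> 1" "x \<in> S" "p = dilate c m (dilate c t x)" using p by (auto simp: B_def C_def cone_over_def)
      define \<tau> where "\<tau> = m * t / l"
      have yt: "y = dilate c \<tau> x"
      proof -
        have "y = dilate c (1/l) p" using y(2) by (simp add: dilate_inverse(2)[OF l(1)])
        then show ?thesis by (simp add: x(4) dilate_dilate \<tau>_def)
      qed
      have "\<tau> < 1"
      proof (rule ccontr)
        assume "\<not> \<tau> < 1"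
        then have \<tau>: "\<tau> \<ge> 1" by simp
        have "(1 - 1/\<tau>) *\<^sub>R c + (1/\<tau>) *\<^sub>R y \<in> K" using bK cK y(1) \<tau> by (intro convexD) auto
        then have "dilate c (1/\<tau>) y \<in> K" by (simp add: dilate_def algebra_simps)
        moreover have "dilate c (1/\<tau>) y = x" unfolding yt using \<tau> by (intro dilate_inverse(2)) simp
        ultimately show False using fK x(3) S(2) by auto
      qed
      moreover have "\<tau> \<ge> 0" using x l by (simp add: \<tau>_def)
      ultimately have "y \<in> C" unfolding C_def cone_over_def yt using x(3) by (intro image_eqI[of _ _ "(\<tau>, x)"]) auto
      then show "p \<in> dilate c l ` C" using y(2) by blast
    qed
    have cl: "compact (dilate c l ` C)" using cC by (intro compact_continuous_image continuous_dilate) auto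
    have fA: "vol A \<noteq> \<infinity>" "vol B \<noteq> \<infinity>" "vol O1 \<noteq> \<infinity>"
      using fin[of A l] fin[of O1 k] emeasure_compact_finite[OF cB] by (auto simp: A_def O1_def)
    have mAB: "rvol (A \<union> B) = rvol A + rvol B - rvol (A \<inter> B)"
      using mm fA by (intro measure_Un3) (auto simp: fmeasurable_def top.not_eq_extremum)
    have "rvol (A \<inter> B) \<le> rvol (dilate c l ` C)"
      using ABsub cl mm by (intro measure_mono_fmeasurable) (auto simp: fmeasurable_compact borel_compact)
    also have "\<dots> = l ^ ?N * ?W" by (rule rvol_dilate_compact[OF l(1) cC])
    finally have "rvol (A \<inter> B) \<le> l ^ ?N * ?W" .
    moreover have "rvol A = l ^ ?N * ?V" unfolding A_def by (rule rvol_dilate_open[OF l(1) bK(2)])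
    moreover have "rvol B = m ^ ?N * ?W" unfolding B_def by (rule rvol_dilate_compact[OF l(4) cC])
    ultimately have lowAB: "l ^ ?N * ?V + (m ^ ?N - l ^ ?N) * ?W \<le> rvol (A \<union> B)"
      unfolding mAB by (simp add: algebra_simps)
    have Lm: "?L \<in> sets borel" by (rule tube_borel)
    have fO: "vol (O1 - (A \<union> B)) \<noteq> \<infinity>" 
    proof -
      have "vol (O1 - (A \<union> B)) < \<infinity>" by (rule fin[of _ k]) (auto simp: O1_def)
      then show ?thesis by simp
    qed
    have "vol ?L \<le> vol (O1 - (A \<union> B))" using LO mm by (intro emeasure_mono) auto
    also have "\<dots> = ennreal (rvol (O1 - (A \<union> B)))" using fO by (simp add: emeasure_eq_ennreal_measure)
    also have "rvol (O1 - (A \<union> B)) = rvol O1 - rvol (A \<union> B)"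
      using mm fA AK by (intro measure_Diff) auto
    also have "rvol O1 = k ^ ?N * ?V" unfolding O1_def using l bK by (intro rvol_dilate_open) auto
    also have "ennreal (k ^ ?N * ?V - rvol (A \<union> B)) \<le> ennreal (k ^ ?N * ?V - (l ^ ?N * ?V + (m ^ ?N - l ^ ?N) * ?W))"
      using lowAB by (intro ennreal_leI) simp
    finally have "vol ?L / ennreal (2 * \<epsilon>) \<le> ennreal (k ^ ?N * ?V - (l ^ ?N * ?V + (m ^ ?N - l ^ ?N) * ?W)) / ennreal (2 * \<epsilon>)"
      by (rule divide_right_mono_ennreal)
    also have "\<dots> \<le> ennreal ((k ^ ?N * ?V - (l ^ ?N * ?V + (m ^ ?N - l ^ ?N) * ?W)) / (2 * \<epsilon>))"
    proof -
      let ?X = "k ^ ?N * ?V - (l ^ ?N * ?V + (m ^ ?N - l ^ ?N) * ?W)"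
      show ?thesis
      proof (cases "?X \<ge> 0")
        case True
        then show ?thesis using \<epsilon> by (subst divide_ennreal) auto
      next
        case False
        then show ?thesis by (simp add: ennreal_neg)
      qed
    qed
    finally show ?thesis unfolding k_def l_def m_def .
  qed
  let ?g = "\<lambda>\<epsilon>. ennreal (((1 + \<epsilon> / r) ^ ?N * ?V - ((1 - \<epsilon> / r) ^ ?N * ?V + ((1 - \<epsilon> / s) ^ ?N - (1 - \<epsilon> / r) ^ ?N) * ?W)) / (2 * \<epsilon>))"
  have "eventually (\<lambda>\<epsilon>. \<epsilon> \<in> {0<..<min e0 r}) (at_right 0)" using e0 r by (intro eventually_at_right_real) simp
  then have "codim1_volume (frontier K) \<le> Liminf (at_right 0) ?g"
    unfolding codim1_volume_eq by (intro Liminf_mono) (auto elim!: eventually_mono intro: main)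
  also have "\<dots> = ennreal (real ?N / r * ?V - real ?N / 2 * (1 / r - 1 / s) * ?W)"
    by (intro lim_imp_Liminf tendsto_ennrealI layer_tendsto r s) simp
  finally show ?thesis unfolding C_def .
qed

section \<open>Consequences of equality\<close>

text \<open>
  Limits of support normals at points converging to \<open>x0\<close> are support normals at
  \<open>x0\<close>. The unit sphere is compact, so a strict lower bound for the distances at
  \<open>x0\<close> persists near \<open>x0\<close>. The excess \<open>s - r\<close> serves also
  as radius of the neighbourhood.
\<close>

lemma support_far_nearby:
  fixes K :: "'a::euclidean_space set"
  assumes K: "convex K" and x0: "x0 \<in> frontier K"
    and far: "\<And>u. norm u = 1 \<Longrightarrow> (\<And>y. y \<in> closure K \<Longrightarrow> u \<bullet> y \<le> u \<bullet> x0) \<Longrightarrow> u \<bullet> (x0 - c) > r"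
  obtains s where "s > r" "\<And>q u. q \<in> frontier K \<Longrightarrow> dist x0 q < s - r \<Longrightarrow> norm u = 1 \<Longrightarrow>
       (\<And>y. y \<in> closure K \<Longrightarrow> u \<bullet> y \<le> u \<bullet> q) \<Longrightarrow> u \<bullet> (q - c) \<ge> s"
proof -
  have "\<exists>s>r. \<forall>q u. q \<in> frontier K \<longrightarrow> dist x0 q < s - r \<longrightarrow> norm u = 1 \<longrightarrow> (\<forall>y\<in>closure K. u \<bullet> y \<le> u \<bullet> q) \<longrightarrow> u \<bullet> (q - c) \<ge> s"
  proof (rule ccontr)
    assume not: "\<not> ?thesis"
    have "\<exists>q u. q \<in> frontier K \<and> dist x0 q < inverse (real (Suc m)) \<and> norm u = 1 \<and> (\<forall>y\<in>closure K. u \<bullet> y \<le> u \<bullet> q) \<and> u \<bullet> (q - c) < r + inverse (real (Suc m))" for m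
    proof -
      have "r + inverse (real (Suc m)) > r" by simp
      then show ?thesis using not by (metis add_diff_cancel_left' not_le)
    qed
    then obtain q u where qu: "\<And>m::nat. q m \<in> frontier K" "\<And>m. dist x0 (q m) < inverse (real (Suc m))" "\<And>m. norm (u m) = 1"
       "\<And>m y. y \<in> closure K \<Longrightarrow> u m \<bullet> y \<le> u m \<bullet> q m" "\<And>m. u m \<bullet> (q m - c) < r + inverse (real (Suc m))"
      by metis
    have "compact (sphere (0::'a) 1)" by simp
    moreover have "\<forall>m. u m \<in> sphere 0 1" using qu(3) by simp
    ultimately obtain v k where k: "v \<in> sphere 0 1" "strict_mono k" "(u \<circ> k) \<longlonglongrightarrow> v"
      unfolding compact_def by metis
    have inv0: "(\<lambda>m. inverse (real (Suc (k m)))) \<longlonglongrightarrow> 0"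
      using LIMSEQ_subseq_LIMSEQ[OF LIMSEQ_inverse_real_of_nat k(2)] by (simp add: o_def)
    have "(\<lambda>m. dist (q (k m)) x0) \<longlonglongrightarrow> 0"
      by (rule tendsto_sandwich[OF _ _ tendsto_const inv0]) (use qu(2) in \<open>auto simp: dist_commute less_imp_le\<close>)
    then have ql: "(\<lambda>m. q (k m)) \<longlonglongrightarrow> x0" by (rule tendsto_dist_iff[THEN iffD2])
    have ul: "(\<lambda>m. u (k m)) \<longlonglongrightarrow> v" using k(3) by (simp add: o_def)
    have "v \<bullet> y \<le> v \<bullet> x0" if y: "y \<in> closure K" for y
    proof (rule LIMSEQ_le)
      show "(\<lambda>m. u (k m) \<bullet> y) \<longlonglongrightarrow> v \<bullet> y" by (intro tendsto_intros ul)
      show "(\<lambda>m. u (k m) \<bullet> q (k m)) \<longlonglongrightarrow> v \<bullet> x0" by (intro tendsto_intros ul ql)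
    qed (use qu(4)[OF y] in auto)
    moreover have "v \<bullet> (x0 - c) \<le> r"
    proof (rule LIMSEQ_le)
      show "(\<lambda>m. u (k m) \<bullet> (q (k m) - c)) \<longlonglongrightarrow> v \<bullet> (x0 - c)" by (intro tendsto_intros ul ql)
      have "(\<lambda>m. r + inverse (real (Suc (k m)))) \<longlonglongrightarrow> r + 0" by (intro tendsto_add tendsto_const inv0)
      then show "(\<lambda>m. r + inverse (real (Suc (k m)))) \<longlonglongrightarrow> r" by simp
    qed (use qu(5) in \<open>auto intro: less_imp_le\<close>)
    ultimately show False using far[of v] k(1) by auto
  qed
  then obtain s where "s > r" "\<forall>q u. q \<in> frontier K \<longrightarrow> dist x0 q < s - r \<longrightarrow> norm u = 1 \<longrightarrow> (\<forall>y\<in>closure K. u \<bullet> y \<le> u \<bullet> q) \<longrightarrow> u \<bullet> (q - c) \<ge> s"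
    by blast
  then show ?thesis using that[of s] by blast
qed

text \<open>
  Rays from \<open>c\<close> through points near \<open>x0\<close> leave \<open>K\<close> near
  \<open>x0\<close>, so the cone contains all points of \<open>K\<close> near \<open>x0\<close>.
\<close>

lemma cone_over_rvol_pos:
  fixes K :: "'a::euclidean_space set"
  assumes K: "bounded K" "open K" "convex K" and r: "r > 0" "ball c r \<subseteq> K" and x0: "x0 \<in> frontier K" and \<rho>: "\<rho> > 0"
  shows "rvol (cone_over c (frontier K \<inter> cball x0 \<rho>)) > 0"
proof -
  let ?S = "frontier K \<inter> cball x0 \<rho>"
  let ?C = "cone_over c ?S"
  have cK: "c \<in> K" using r by auto
  have fK: "x \<notin> K" if "x \<in> frontier K" for x using frontier_disjoint_open that K by blast
  obtain D where D': "D > 0" and D: "\<And>x. x \<in> closure K \<Longrightarrow> norm (x - c) \<le> D"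
    using bounded_closure_distance[OF K(1)] by metis
  have "D \<ge> 0" using D' by simp
  define \<rho>' where "\<rho>' = min r (\<rho> / (1 + D / r))"
  have \<rho>': "\<rho>' > 0" using r \<rho> \<open>D \<ge> 0\<close> by (simp add: \<rho>'_def add_pos_nonneg)
  have sub: "K \<inter> ball x0 \<rho>' \<subseteq> ?C"
  proof
    fix y assume "y \<in> K \<inter> ball x0 \<rho>'"
    then have y: "y \<in> K" "dist x0 y < \<rho>'" by auto
    have "y \<noteq> c"
    proof
      assume "y = c"
      then have "x0 \<in> ball c r" using y(2) by (simp add: \<rho>'_def dist_commute)
      then show False using fK[OF x0] r by blast
    qed
    then have yc: "y - c \<noteq> 0" by simp
    obtain \<tau> where \<tau>: "0 < \<tau>" "c + \<tau> *\<^sub>R (y - c) \<in> frontier K"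
      using ray_to_frontier[OF K(1) _ yc, of c] cK K by (metis interior_open)
    define x where "x = c + \<tau> *\<^sub>R (y - c)"
    have xf: "x \<in> frontier K" using \<tau>(2) by (simp add: x_def)
    have \<tau>1: "\<tau> > 1"
    proof (rule ccontr)
      assume "\<not> \<tau> > 1"
      then have "(1 - \<tau>) *\<^sub>R c + \<tau> *\<^sub>R y \<in> K" using K cK y(1) \<tau>(1) by (intro convexD) auto
      then have "x \<in> K" by (simp add: x_def algebra_simps)
      then show False using fK xf by blast
    qed
    define h where "h = 1 - 1 / \<tau>"
    have h: "0 < h" "h < 1" using \<tau>1 by (auto simp: h_def)
    have yx: "y = x - h *\<^sub>R (x - c)"
    proof -
      have "x - h *\<^sub>R (x - c) = c + (1 - h) *\<^sub>R (x - c)" by (simp add: algebra_simps)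
      also have "\<dots> = c + ((1 - h) * \<tau>) *\<^sub>R (y - c)" by (simp add: x_def)
      also have "(1 - h) * \<tau> = 1" using \<tau>1 by (simp add: h_def)
      finally show ?thesis by simp
    qed
    \<comment> \<open>The ball of radius h r about y is the image of the inscribed ball under shrinking
      towards x by the factor h, so it lies in K and misses x0.\<close>
    have "dist x0 y \<ge> h * r"
    proof (rule ccontr)
      assume "\<not> dist x0 y \<ge> h * r"
      then have d: "norm (x0 - y) < h * r" by (simp add: dist_norm)
      define w where "w = c + (1 / h) *\<^sub>R (x0 - y)"
      have "norm ((1 / h) *\<^sub>R (x0 - y)) = norm (x0 - y) / h" using h by (subst norm_scaleR) simp
      also have "\<dots> < r" using d h(1) by (simp add: pos_divide_less_eq mult.commute)
      finally have "norm ((1 / h) *\<^sub>R (x0 - y)) < r" .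
      then have "w \<in> ball c r" by (simp add: w_def dist_norm)
      then have "w \<in> interior K" using r K by (auto simp: interior_open)
      moreover have "x \<in> closure K" using xf by (simp add: frontier_def)
      ultimately have "x - h *\<^sub>R (x - w) \<in> interior K" using K h by (intro mem_interior_closure_convex_shrink) auto
      moreover have "x - h *\<^sub>R (x - w) = x0" using h yx by (simp add: w_def algebra_simps)
      ultimately show False using fK[OF x0] K by (simp add: interior_open)
    qed
    then have hle: "h \<le> dist x0 y / r" using r by (simp add: field_simps)
    have "norm (x - y) = h * norm (x - c)" using yx h by simp
    also have "\<dots> \<le> (dist x0 y / r) * D"
      using hle D[of x] xf h by (intro mult_mono) (auto simp: frontier_def r less_imp_le)
    finally have "dist x0 x \<le> dist x0 y * (1 + D / r)"
      using dist_triangle[of x0 x y] by (simp add: dist_norm norm_minus_commute algebra_simps)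
    also have "\<dots> \<le> \<rho>' * (1 + D / r)" using y(2) r \<open>D \<ge> 0\<close> by (intro mult_right_mono) auto
    also have "\<dots> \<le> \<rho> / (1 + D / r) * (1 + D / r)" using r \<open>D \<ge> 0\<close> by (intro mult_right_mono) (auto simp: \<rho>'_def)
    also have "\<dots> = \<rho>"
    proof -
      have "1 + D / r > 0" using r \<open>D \<ge> 0\<close> by (simp add: add_pos_nonneg)
      then show ?thesis by simp
    qed
    finally have "x \<in> ?S" using xf by simp
    moreover have "y = dilate c (1 - h) x" using yx by (simp add: dilate_def algebra_simps)
    ultimately show "y \<in> ?C" unfolding cone_over_def using h by (intro image_eqI[of _ _ "(1 - h, x)"]) auto
  qed
  have "x0 \<in> closure K" using x0 by (simp add: frontier_def)
  then obtain p where p: "p \<in> K" "dist p x0 < \<rho>'" using \<rho>' closure_approachable by blast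
  then have "p \<in> K \<inter> ball x0 \<rho>'" by (simp add: dist_commute)
  then obtain e where e: "e > 0" "ball p e \<subseteq> K \<inter> ball x0 \<rho>'"
    using open_Int[OF K(2) open_ball[of x0 \<rho>']] openE by metis
  have "compact (frontier K)" using K by (simp add: compact_frontier_bounded)
  then have cS: "compact ?S" by (simp add: compact_Int_closed)
  have cC: "compact ?C" by (rule compact_cone_over[OF cS])
  have "0 < rvol (ball p e)" using e(1) by (simp add: content_ball_gt_0_iff)
  also have "\<dots> \<le> rvol ?C"
    using e(2) sub cC by (intro measure_mono_fmeasurable) (auto simp: fmeasurable_compact)
  finally show ?thesis .
qed

text \<open>
  Were all support planes at \<open>x0\<close> farther than \<open>r\<close> from
  \<open>c\<close>, then the same would hold, with some \<open>s > r\<close>, for those at nearby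
  boundary points, and the improved bound would exclude equality.
\<close>

lemma equality_touching:
  fixes K :: "'a::euclidean_space set"
  assumes K: "convex_body K" and r: "r > 0" "ball c r \<subseteq> K"
    and eq: "codim1_volume (frontier K) \<ge> ennreal (real DIM('a) / r * rvol K)"
    and x0: "x0 \<in> frontier K"
  obtains u where "norm u = 1" "\<And>y. y \<in> closure K \<Longrightarrow> u \<bullet> y \<le> u \<bullet> x0" "u \<bullet> (x0 - c) = r"
proof (rule ccontr)
  assume "\<not> thesis"
  have bK: "bounded K" "open K" "convex K" "K \<noteq> {}" using K by (auto simp: convex_body_def)
  have cK: "c \<in> K" using r by auto
  have far: "u \<bullet> (x0 - c) > r" if "norm u = 1" "\<And>y. y \<in> closure K \<Longrightarrow> u \<bullet> y \<le> u \<bullet> x0" for u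
    using support_ge_inradius[OF r that] that \<open>\<not> thesis\<close> \<open>\<And>u. \<lbrakk>norm u = 1; \<And>y. y \<in> closure K \<Longrightarrow> u \<bullet> y \<le> u \<bullet> x0; u \<bullet> (x0 - c) = r\<rbrakk> \<Longrightarrow> thesis\<close>
    by fastforce
  obtain s where s: "s > r" "\<And>q u. q \<in> frontier K \<Longrightarrow> dist x0 q < s - r \<Longrightarrow> norm u = 1 \<Longrightarrow>
       (\<And>y. y \<in> closure K \<Longrightarrow> u \<bullet> y \<le> u \<bullet> q) \<Longrightarrow> u \<bullet> (q - c) \<ge> s"
    using support_far_nearby[OF bK(3) x0 far] by metis
  define \<rho> where "\<rho> = (s - r) / 2"
  have \<rho>: "\<rho> > 0" using s by (simp add: \<rho>_def)
  let ?S = "frontier K \<inter> cball x0 \<rho>"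
  have "compact (frontier K)" using bK by (simp add: compact_frontier_bounded)
  then have cS: "compact ?S" by (simp add: compact_Int_closed)
  obtain D where D: "D > 0" "\<And>x. x \<in> closure K \<Longrightarrow> norm (x - c) \<le> D"
    using bounded_closure_distance[OF bK(1)] by metis
  have s0: "s > 0" using s r by simp
  have Ds: "1 + D / s > 0" using D s0 by (simp add: add_pos_nonneg)
  \<comment> \<open>For these \<epsilon>, boundary points within \<epsilon> of a shrunk point of the patch
    stay within 2 \<rho> = s - r of x0.\<close>
  define e0 where "e0 = min s (\<rho> / (1 + D / s))"
  have e0: "e0 > 0" using s0 \<rho> Ds by (simp add: e0_def)
  have "codim1_volume (frontier K) \<le> ennreal (real DIM('a) / r * rvol K
     - real DIM('a) / 2 * (1 / r - 1 / s) * rvol (cone_over c ?S))"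
  proof (rule codim1_upper_bound[OF K r _ cS _ e0])
    fix \<epsilon> x assume \<epsilon>: "0 < \<epsilon>" "\<epsilon> < e0" and x: "x \<in> ?S"
    then have xc: "x \<in> closure K" by (simp add: frontier_def)
    show "ball (dilate c (1 - \<epsilon> / s) x) \<epsilon> \<subseteq> K"
    proof (rule shrunk_point_deep[OF bK(1-3) cK xc s0 \<epsilon>(1)])
      show "\<epsilon> < s" using \<epsilon> by (simp add: e0_def)
      fix q u assume q: "q \<in> frontier K" "dist (dilate c (1 - \<epsilon> / s) x) q < \<epsilon>" and u: "norm u = 1" "\<And>y. y \<in> closure K \<Longrightarrow> u \<bullet> y \<le> u \<bullet> q"
      have "x - dilate c (1 - \<epsilon> / s) x = (\<epsilon> / s) *\<^sub>R (x - c)" by (simp add: dilate_def algebra_simps)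
      then have "dist x (dilate c (1 - \<epsilon> / s) x) = (\<epsilon> / s) * norm (x - c)" using \<epsilon> s0 by (simp add: dist_norm)
      also have "\<dots> \<le> (\<epsilon> / s) * D" using D(2)[OF xc] \<epsilon> s0 by (intro mult_left_mono) auto
      finally have "dist x q < \<epsilon> * (1 + D / s)"
        using q(2) dist_triangle[of x q "dilate c (1 - \<epsilon> / s) x"] by (simp add: algebra_simps)
      also have "\<dots> \<le> \<rho> / (1 + D / s) * (1 + D / s)" using \<epsilon> Ds by (intro mult_right_mono) (auto simp: e0_def)
      also have "\<dots> = \<rho>" using Ds by simp
      finally have "dist x q < \<rho>" .
      moreover have "dist x0 x \<le> \<rho>" using x by simp
      ultimately have "dist x0 q < \<rho> + \<rho>" using dist_triangle[of x0 q x] by linarith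
      then show "u \<bullet> (q - c) \<ge> s" using q(1) u by (intro s(2)) (auto simp: \<rho>_def)
    qed
  qed (use s in auto)
  also have "\<dots> < ennreal (real DIM('a) / r * rvol K)"
  proof (rule ennreal_lessI)
    have "0 < rvol (ball c r)" using r by (simp add: content_ball_gt_0_iff)
    also have "\<dots> \<le> rvol K"
      using r bK emeasure_bounded_finite[OF bK(1)] by (intro measure_mono_fmeasurable fmeasurableI) auto
    finally show "0 < real DIM('a) / r * rvol K" using r by simp
    have "1 / r - 1 / s > 0" using s r by (simp add: frac_less2)
    then show "real DIM('a) / r * rvol K - real DIM('a) / 2 * (1 / r - 1 / s) * rvol (cone_over c ?S)
       < real DIM('a) / r * rvol K"
      using cone_over_rvol_pos[OF bK(1-3) r x0 \<rho>] by simp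
  qed
  finally show False using eq by simp
qed

section \<open>Bodies whose support planes touch the inscribed ball\<close>

lemma outer_point_if_not_ball:
  fixes K :: "'a::euclidean_space set"
  assumes K: "bounded K" "open K" and c: "ball c r \<subseteq> K" "r > 0" and y: "y \<in> K" "dist c y \<ge> r"
  obtains x where "x \<in> frontier K" "dist c x > r"
proof -
  have yc: "y - c \<noteq> 0" using y(2) c(2) by auto
  obtain d where d: "0 < d" "y + d *\<^sub>R (y - c) \<in> frontier K"
    using ray_to_frontier[OF K(1) _ yc, of y] y(1) K by (metis interior_open)
  have "y + d *\<^sub>R (y - c) - c = (1 + d) *\<^sub>R (y - c)" by (simp add: algebra_simps)
  then have "dist c (y + d *\<^sub>R (y - c)) = (1 + d) * dist c y"
    using d by (simp add: dist_norm norm_minus_commute[of c])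
  moreover have "(1 + d) * dist c y > 1 * dist c y" using d y c by (intro mult_strict_right_mono) auto
  ultimately show ?thesis using that d(2) y(2) by simp
qed

text \<open>
  If \<open>K\<close> exceeds the ball, some boundary point \<open>x\<close> is farther than
  \<open>r\<close> from \<open>c\<close>. Its touching support plane also contains the point of
  contact with the ball, which differs from \<open>x\<close>. The segment between them stays in
  the plane, contrary to strict convexity.
\<close>

lemma strictly_convex_touching_ball:
  fixes K :: "'a::euclidean_space set"
  assumes K: "convex_body K" and r: "r > 0" "ball c r \<subseteq> K" and sc: "strictly_convex K"
    and touch: "\<And>x. x \<in> frontier K \<Longrightarrow> \<exists>u. norm u = 1 \<and> (\<forall>y\<in>closure K. u \<bullet> y \<le> u \<bullet> x) \<and> u \<bullet> (x - c) = r"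
  shows "K = ball c r"
proof (rule ccontr)
  assume "K \<noteq> ball c r"
  then have "\<not> K \<subseteq> ball c r" using r(2) by blast
  then obtain y where "y \<in> K" "y \<notin> ball c r" by blast
  then have y: "y \<in> K" "dist c y \<ge> r" by auto
  have bK: "bounded K" "open K" using K by (auto simp: convex_body_def)
  obtain x where x: "x \<in> frontier K" "dist c x > r" using outer_point_if_not_ball[OF bK r(2,1) y] by blast
  obtain u where u: "norm u = 1" "\<And>y. y \<in> closure K \<Longrightarrow> u \<bullet> y \<le> u \<bullet> x" "u \<bullet> (x - c) = r" using touch[OF x(1)] by blast
  have uu: "u \<bullet> u = 1" using u(1) by (simp add: norm_eq_1)
  define p where "p = c + r *\<^sub>R u"
  have up: "u \<bullet> p = u \<bullet> x" using u(3) uu by (simp add: p_def inner_add_right inner_diff_right)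
  have noK: "u \<bullet> w < u \<bullet> x" if "w \<in> K" for w
    using support_strict[OF bK(2) u(1,2) that] .
  have "p \<in> closure (ball c r)" using r u by (simp add: p_def dist_norm)
  then have "p \<in> closure K" using closure_mono[OF r(2)] by blast
  moreover have "p \<notin> K" using noK[of p] up by auto
  ultimately have pf: "p \<in> frontier K" using bK by (simp add: frontier_def interior_open)
  have "p \<noteq> x" using x(2) u(1) r by (auto simp: p_def dist_norm)
  then have seg: "open_segment p x \<subseteq> K" using sc pf x(1) by (auto simp: strictly_convex_def)
  have "midpoint p x \<in> open_segment p x" using \<open>p \<noteq> x\<close> by simp
  then have "u \<bullet> midpoint p x < u \<bullet> x" using seg noK by blast
  then show False using up by (simp add: midpoint_def inner_add_right)
qed

text \<open>
  A support normal must be parallel to the gradient. Otherwise some tangent direction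
  \<open>a\<close> ascends for the support functional, and by the intermediate value theorem
  \<open>g\<close> vanishes near the ray in that direction, which gives boundary points beyond the
  support plane. Of the two unit vectors parallel to the gradient only one can be an outer normal,
  since \<open>K\<close> has interior points.
\<close>

lemma C1_hypersurface_support_unique:
  fixes K :: "'a::euclidean_space set"
  assumes K: "open K" "K \<noteq> {}" and C1: "C1_hypersurface (frontier K)" and x: "x \<in> frontier K"
    and u: "norm u = 1" "\<And>y. y \<in> closure K \<Longrightarrow> u \<bullet> y \<le> u \<bullet> x"
    and v: "norm v = 1" "\<And>y. y \<in> closure K \<Longrightarrow> v \<bullet> y \<le> v \<bullet> x"
  shows "u = v"
proof -
  have "\<exists>U g G. open U \<and> x \<in> U \<and> (\<forall>y\<in>U. GDERIV g y :> G y \<and> G y \<noteq> 0) \<and>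
      continuous_on U G \<and> frontier K \<inter> U = {y\<in>U. g y = 0}"
    using C1 x unfolding C1_hypersurface_def by (rule bspec)
  then obtain U g G where U0: "open U \<and> x \<in> U \<and> (\<forall>y\<in>U. GDERIV g y :> G y \<and> G y \<noteq> 0) \<and>
      continuous_on U G \<and> frontier K \<inter> U = {y\<in>U. g y = 0}"
    by (elim exE) (rule that)
  note U = conjunct1[OF U0] conjunct1[OF conjunct2[OF U0]] conjunct1[OF conjunct2[OF conjunct2[OF U0]]]
    conjunct2[OF conjunct2[OF conjunct2[OF conjunct2[OF U0]]]]
  let ?G = "G x"
  have Gx: "?G \<noteq> 0" using bspec[OF U(3) U(2)] by simp
  have "x \<in> frontier K \<inter> U" using x U(2) by simp
  then have gx: "g x = 0" unfolding U(4) by simp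
  have gd: "(g has_derivative (\<lambda>h. h \<bullet> ?G)) (at x)" using bspec[OF U(3) U(2)] by (simp add: gderiv_def)
  have cont: "isCont g y" if "y \<in> U" for y
  proof -
    have "(g has_derivative (\<lambda>h. h \<bullet> G y)) (at y)" using bspec[OF U(3) that] by (simp add: gderiv_def)
    then show ?thesis by (rule has_derivative_continuous)
  qed
  have dir: "((\<lambda>t. g (x + t *\<^sub>R w)) has_real_derivative (w \<bullet> ?G)) (at 0)" for w
  proof -
    have "((\<lambda>t::real. x + t *\<^sub>R w) has_derivative (\<lambda>t. t *\<^sub>R w)) (at 0)" by (auto intro!: derivative_eq_intros)
    moreover have "(g has_derivative (\<lambda>h. h \<bullet> ?G)) (at (x + 0 *\<^sub>R w))" using gd by simp
    ultimately have "((\<lambda>t. g (x + t *\<^sub>R w)) has_derivative (\<lambda>t. (t *\<^sub>R w) \<bullet> ?G)) (at 0)"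
      by (rule has_derivative_compose)
    moreover have "(\<lambda>t. (t *\<^sub>R w) \<bullet> ?G) = (*) (w \<bullet> ?G)" by (simp add: fun_eq_iff)
    ultimately show ?thesis by (simp add: has_field_derivative_def)
  qed
  have par: "\<exists>k. w = k *\<^sub>R ?G" if w: "norm w = 1" "\<And>y. y \<in> closure K \<Longrightarrow> w \<bullet> y \<le> w \<bullet> x" for w
  proof (rule ccontr)
    assume npar: "\<not> ?thesis"
    \<comment> \<open>The component of w tangent to the level set of g.\<close>
    define a where "a = w - ((w \<bullet> ?G) / (?G \<bullet> ?G)) *\<^sub>R ?G"
    have GG: "?G \<bullet> ?G > 0" using Gx by simp
    have a0: "a \<noteq> 0" using npar by (auto simp: a_def)
    have aG: "a \<bullet> ?G = 0" using GG by (simp add: a_def inner_diff_left)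
    have wa: "w \<bullet> a > 0"
    proof -
      have "w \<bullet> a = a \<bullet> a + ((w \<bullet> ?G) / (?G \<bullet> ?G)) * (?G \<bullet> a)"
        by (simp add: a_def inner_diff_left inner_diff_right inner_commute algebra_simps)
      also have "\<dots> = a \<bullet> a" using aG by (simp add: inner_commute)
      finally show ?thesis using a0 by simp
    qed
    \<comment> \<open>The tilt towards the gradient is small enough for the directions a \<plusminus> \<delta>
      G to ascend still for w.\<close>
    define \<delta> where "\<delta> = (w \<bullet> a) / (2 * (\<bar>w \<bullet> ?G\<bar> + 1))"
    have \<delta>: "\<delta> > 0" using wa by (simp add: \<delta>_def)
    have \<delta>w: "\<delta> * \<bar>w \<bullet> ?G\<bar> < w \<bullet> a"
    proof -
      have "\<delta> * \<bar>w \<bullet> ?G\<bar> \<le> \<delta> * (\<bar>w \<bullet> ?G\<bar> + 1)" using \<delta> by simp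
      also have "\<dots> = (w \<bullet> a) / 2" by (simp add: \<delta>_def field_simps add_nonneg_eq_0_iff)
      finally show ?thesis using wa by simp
    qed
    have "(a + \<delta> *\<^sub>R ?G) \<bullet> ?G > 0" using aG \<delta> GG by (simp add: inner_add_left)
    then obtain d1 where d1: "d1 > 0" "\<And>h. 0 < h \<Longrightarrow> h < d1 \<Longrightarrow> g (x + h *\<^sub>R (a + \<delta> *\<^sub>R ?G)) > 0"
      using DERIV_pos_inc_right[OF dir[of "a + \<delta> *\<^sub>R ?G"]] gx by auto
    have "(a - \<delta> *\<^sub>R ?G) \<bullet> ?G < 0" using aG \<delta> GG by (simp add: inner_diff_left)
    then obtain d2 where d2: "d2 > 0" "\<And>h. 0 < h \<Longrightarrow> h < d2 \<Longrightarrow> g (x + h *\<^sub>R (a - \<delta> *\<^sub>R ?G)) < 0"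
      using DERIV_neg_dec_right[OF dir[of "a - \<delta> *\<^sub>R ?G"]] gx by auto
    obtain e where e: "e > 0" "ball x e \<subseteq> U" using U(1,2) by (meson openE)
    define R where "R = norm a + \<delta> * norm ?G + 1"
    have R: "R > 0" using \<delta> by (simp add: R_def add_nonneg_pos)
    define h where "h = min (min (d1 / 2) (d2 / 2)) (e / (2 * R))"
    have h: "0 < h" "h < d1" "h < d2" "h * R < e"
    proof -
      have "0 < d1 / 2" "0 < d2 / 2" "0 < e / (2 * R)" using d1(1) d2(1) e(1) R by simp_all
      then show "0 < h" by (simp add: h_def)
      have le: "h \<le> d1 / 2" "h \<le> d2 / 2" "h \<le> e / (2 * R)" by (simp_all add: h_def min_le_iff_disj)
      show "h < d1" "h < d2" using le(1,2) d1(1) d2(1) by linarith+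
      have "h * R \<le> e / (2 * R) * R" using R le(3) by (intro mult_right_mono) simp_all
      also have "\<dots> < e" using R e by simp
      finally show "h * R < e" .
    qed
    define z where "z \<theta> = x + h *\<^sub>R (a + \<theta> *\<^sub>R ?G)" for \<theta>
    have zU: "z \<theta> \<in> U" if "\<bar>\<theta>\<bar> \<le> \<delta>" for \<theta>
    proof -
      have "norm (a + \<theta> *\<^sub>R ?G) \<le> norm a + \<bar>\<theta>\<bar> * norm ?G" using norm_triangle_ineq[of a "\<theta> *\<^sub>R ?G"] by simp
      also have "\<dots> \<le> norm a + \<delta> * norm ?G" using that by (simp add: mult_right_mono)
      also have "\<dots> \<le> R" by (simp add: R_def)
      finally have "h * norm (a + \<theta> *\<^sub>R ?G) \<le> h * R" using h(1) by (intro mult_left_mono) auto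
      then have "h * norm (a + \<theta> *\<^sub>R ?G) < e" using h(4) by linarith
      moreover have "dist x (z \<theta>) = h * norm (a + \<theta> *\<^sub>R ?G)" using h(1) by (simp add: z_def dist_norm)
      ultimately have "dist x (z \<theta>) < e" by simp
      then show ?thesis using e(2) by auto
    qed
    have "\<exists>\<theta>. - \<delta> \<le> \<theta> \<and> \<theta> \<le> \<delta> \<and> g (z \<theta>) = 0"
    proof (rule IVT')
      show "g (z (- \<delta>)) \<le> 0" using d2(2)[OF h(1,3)] by (simp add: z_def)
      show "0 \<le> g (z \<delta>)" using d1(2)[OF h(1,2)] by (simp add: z_def)
      show "continuous_on {- \<delta>..\<delta>} (\<lambda>\<theta>. g (z \<theta>))"
      proof (rule continuous_on_compose2[of U g])
        show "continuous_on U g" using cont by (simp add: continuous_at_imp_continuous_on)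
        show "continuous_on {- \<delta>..\<delta>} z" unfolding z_def by (intro continuous_intros)
        show "z ` {- \<delta>..\<delta>} \<subseteq> U" using zU by auto
      qed
    qed (use \<delta> in auto)
    then obtain \<theta> where \<theta>': "- \<delta> \<le> \<theta>" "\<theta> \<le> \<delta>" and g0: "g (z \<theta>) = 0" by blast
    then have \<theta>: "\<bar>\<theta>\<bar> \<le> \<delta>" by linarith
    with g0 have "z \<theta> \<in> frontier K \<inter> U" unfolding U(4) using zU by simp
    then have "w \<bullet> z \<theta> \<le> w \<bullet> x" by (intro w(2)) (simp add: frontier_def)
    then have "h * (w \<bullet> a + \<theta> * (w \<bullet> ?G)) \<le> 0" by (simp add: z_def inner_add_right algebra_simps)
    then have "w \<bullet> a + \<theta> * (w \<bullet> ?G) \<le> 0" using h(1) by (simp add: mult_le_0_iff)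
    moreover have "\<bar>\<theta> * (w \<bullet> ?G)\<bar> \<le> \<delta> * \<bar>w \<bullet> ?G\<bar>" using \<theta>(1) by (simp add: abs_mult mult_right_mono)
    ultimately show False using \<delta>w by linarith
  qed
  obtain k l where k: "u = k *\<^sub>R ?G" and l: "v = l *\<^sub>R ?G" using par[OF u] par[OF v] by blast
  have nG: "norm ?G > 0" using Gx by simp
  have "\<bar>k\<bar> * norm ?G = 1" "\<bar>l\<bar> * norm ?G = 1" using u(1) v(1) k l by simp_all
  then have "\<bar>k\<bar> = \<bar>l\<bar>" using nG by (metis mult_cancel_right less_irrefl)
  then consider "k = l" | "k = - l" by linarith
  then show ?thesis
  proof cases
    case 1
    then show ?thesis using k l by simp
  next
    case 2
    then have vu: "v = - u" using k l by simp
    obtain y where y: "y \<in> K" using K by blast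
    have "u \<bullet> y < u \<bullet> x" by (rule support_strict[OF K(1) u y])
    moreover have "v \<bullet> y < v \<bullet> x" by (rule support_strict[OF K(1) v y])
    ultimately show ?thesis unfolding vu by simp
  qed
qed

text \<open>
  For a point \<open>y\<close> of \<open>K\<close> outside the ball, the support plane with normal
  \<open>y - c\<close> touches \<open>K\<close> at some boundary point. By uniqueness it is the
  plane at distance \<open>r\<close>, but \<open>y\<close> lies below it.
\<close>

lemma C1_touching_ball:
  fixes K :: "'a::euclidean_space set"
  assumes K: "convex_body K" and r: "r > 0" "ball c r \<subseteq> K" and C1: "C1_hypersurface (frontier K)"
    and touch: "\<And>x. x \<in> frontier K \<Longrightarrow> \<exists>u. norm u = 1 \<and> (\<forall>y\<in>closure K. u \<bullet> y \<le> u \<bullet> x) \<and> u \<bullet> (x - c) = r"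
  shows "K = ball c r"
proof (rule ccontr)
  assume "K \<noteq> ball c r"
  then have "\<not> K \<subseteq> ball c r" using r(2) by blast
  then obtain y where "y \<in> K" "y \<notin> ball c r" by blast
  then have y: "y \<in> K" "dist c y \<ge> r" by auto
  have bK: "bounded K" "open K" "K \<noteq> {}" using K by (auto simp: convex_body_def)
  define v where "v = (y - c) /\<^sub>R norm (y - c)"
  have yc: "norm (y - c) \<ge> r" using y(2) by (simp add: dist_norm norm_minus_commute)
  have "y \<noteq> c" using y(2) r by auto
  then have v: "norm v = 1" by (simp add: v_def)
  have cl: "compact (closure K)" "closure K \<noteq> {}" using bK by (auto simp: compact_closure)
  obtain x where x: "x \<in> closure K" "\<And>w. w \<in> closure K \<Longrightarrow> v \<bullet> w \<le> v \<bullet> x"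
  proof -
    have "continuous_on (closure K) (\<lambda>w. v \<bullet> w)" by (intro continuous_intros)
    then show ?thesis using continuous_attains_sup[OF cl] that by blast
  qed
  have lt: "v \<bullet> w < v \<bullet> x" if "w \<in> K" for w
    using support_strict[OF bK(2) v x(2) that] .
  then have "x \<notin> K" by blast
  then have xf: "x \<in> frontier K" using x(1) bK by (simp add: frontier_def interior_open)
  obtain u where u: "norm u = 1" "\<And>y. y \<in> closure K \<Longrightarrow> u \<bullet> y \<le> u \<bullet> x" "u \<bullet> (x - c) = r" using touch[OF xf] by blast
  have "u = v" by (rule C1_hypersurface_support_unique[OF bK(2,3) C1 xf u(1,2) v x(2)])
  then have "v \<bullet> (y - c) < r" using lt[OF y(1)] u(3) by (simp add: inner_diff_right)
  moreover have "v \<bullet> (y - c) = norm (y - c)" using \<open>y \<noteq> c\<close> by (simp add: v_def dot_square_norm power2_eq_square)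
  ultimately show False using yc by simp
qed

section \<open>Incentre and spheres\<close>

text \<open>
  The distance to the complement is continuous and attains its maximum on the closure of
  \<open>K\<close>.
\<close>

lemma inradius_attained:
  fixes K :: "'a::euclidean_space set"
  assumes K: "convex_body K"
  obtains c where "inradius K > 0" "ball c (inradius K) \<subseteq> K" "\<And>x \<rho>. ball x \<rho> \<subseteq> K \<Longrightarrow> \<rho> \<le> inradius K"
proof -
  have bK: "bounded K" "open K" "K \<noteq> {}" using K by (auto simp: convex_body_def)
  have cl: "compact (closure K)" "closure K \<noteq> {}" using bK by (auto simp: compact_closure)
  have ne: "- K \<noteq> {}" using bK(1) by (metis Compl_empty_eq boolean_algebra.de_Morgan_conj double_compl not_bounded_UNIV)
  have cc: "closed (- K)" using bK(2) by (simp add: closed_def)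
  obtain c where c: "c \<in> closure K" "\<And>x. x \<in> closure K \<Longrightarrow> infdist x (- K) \<le> infdist c (- K)"
  proof -
    have "continuous_on (closure K) (\<lambda>x. infdist x (- K))" by (intro continuous_intros)
    then show ?thesis using continuous_attains_sup[OF cl] that by blast
  qed
  define r where "r = infdist c (- K)"
  have in_ball: "ball x (infdist x (- K)) \<subseteq> K" for x
  proof
    fix y assume y: "y \<in> ball x (infdist x (- K))"
    show "y \<in> K"
    proof (rule ccontr)
      assume "y \<notin> K"
      then have "infdist x (- K) \<le> dist x y" by (intro infdist_le) simp
      then show False using y by simp
    qed
  qed
  have le: "\<rho> \<le> infdist x (- K)" if b: "ball x \<rho> \<subseteq> K" for x \<rho>
  proof -
    obtain y where "y \<in> - K" "infdist x (- K) = dist x y" using infdist_attains_inf[OF cc ne] by blast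
    then show ?thesis using b by (metis ComplD linorder_not_le mem_ball subsetD)
  qed
  have r0: "r > 0"
  proof -
    obtain x where x: "x \<in> K" using bK by blast
    obtain e where e: "e > 0" "ball x e \<subseteq> K" using bK(2) x by (meson openE)
    then show ?thesis using le[OF e(2)] c(2)[of x] x closure_subset[of K] by (auto simp: r_def)
  qed
  have max: "\<rho> \<le> r" if b: "ball x \<rho> \<subseteq> K" for x \<rho>
  proof (cases "\<rho> > 0")
    case True
    then have "x \<in> K" using b by auto
    then show ?thesis using le[OF b] c(2)[of x] closure_subset[of K] by (auto simp: r_def)
  qed (use r0 in simp)
  have "inradius K = r" unfolding inradius_def
    by (rule Greatest_equality) (use in_ball[of c] max in \<open>auto simp: r_def\<close>)
  then show ?thesis using that[of c] r0 in_ball[of c] max by (simp add: r_def)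
qed

text \<open>
  The open shell between the radii \<open>r - \<epsilon>\<close> and \<open>r + \<epsilon>\<close>
  lies in the tube, which gives equality for balls.
\<close>

lemma codim1_volume_sphere_ge:
  fixes c :: "'a::euclidean_space"
  assumes r: "r > 0"
  shows "ennreal (real DIM('a) / r * rvol (ball c r)) \<le> codim1_volume (frontier (ball c r))"
proof -
  let ?N = "DIM('a)" let ?w = "unit_ball_vol (real ?N)"
  have fr: "frontier (ball c r) = sphere c r" using r by simp
  have main: "ennreal (?w * ((r + \<epsilon>) ^ ?N - (r - \<epsilon>) ^ ?N) / (2 * \<epsilon>)) \<le> vol (tube (sphere c r) \<epsilon>) / ennreal (2 * \<epsilon>)"
    if \<epsilon>: "0 < \<epsilon>" "\<epsilon> < r" for \<epsilon>
  proof -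
    let ?L = "tube (sphere c r) \<epsilon>"
    have sub: "ball c (r + \<epsilon>) - cball c (r - \<epsilon>) \<subseteq> ?L"
    proof
      fix x assume x: "x \<in> ball c (r + \<epsilon>) - cball c (r - \<epsilon>)"
      define n where "n = norm (x - c)"
      have n: "r - \<epsilon> < n" "n < r + \<epsilon>" using x by (auto simp: n_def dist_norm norm_minus_commute)
      then have n0: "n > 0" using \<epsilon> by simp
      define y where "y = c + (r / n) *\<^sub>R (x - c)"
      have "norm ((r / n) *\<^sub>R (x - c)) = (r / n) * n" using r n0 by (simp add: n_def)
      then have y: "y \<in> sphere c r" using n0 by (simp add: y_def dist_norm)
      have "x - y = (1 - r / n) *\<^sub>R (x - c)" by (simp add: y_def algebra_simps)
      then have "dist x y = \<bar>1 - r / n\<bar> * n" by (simp add: dist_norm n_def)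
      also have "\<dots> = \<bar>(1 - r / n) * n\<bar>" using n0 by (simp add: abs_mult)
      also have "(1 - r / n) * n = n - r" using n0 by (simp add: algebra_simps)
      finally have "dist x y < \<epsilon>" using n by auto
      then show "x \<in> ?L" by (rule tubeI[OF y])
    qed
    have "ennreal (?w * ((r + \<epsilon>) ^ ?N - (r - \<epsilon>) ^ ?N)) = ennreal (?w * (r + \<epsilon>) ^ ?N) - ennreal (?w * (r - \<epsilon>) ^ ?N)"
      using \<epsilon> by (subst ennreal_minus) (auto simp: algebra_simps)
    also have "\<dots> = vol (ball c (r + \<epsilon>)) - vol (cball c (r - \<epsilon>))"
      using \<epsilon> r by (simp add: emeasure_ball emeasure_cball)
    also have "\<dots> = vol (ball c (r + \<epsilon>) - cball c (r - \<epsilon>))"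
      using \<epsilon> emeasure_compact_finite[of "cball c (r - \<epsilon>)"] by (intro emeasure_Diff[symmetric]) (auto simp: subset_iff)
    also have "\<dots> \<le> vol ?L" by (rule emeasure_mono[OF sub]) (simp only: sets_lborel tube_borel)
    finally have "ennreal (?w * ((r + \<epsilon>) ^ ?N - (r - \<epsilon>) ^ ?N)) / ennreal (2 * \<epsilon>) \<le> vol ?L / ennreal (2 * \<epsilon>)"
      by (rule divide_right_mono_ennreal)
    moreover have "(r - \<epsilon>) ^ ?N \<le> (r + \<epsilon>) ^ ?N" using \<epsilon> by (intro power_mono) auto
    then have "0 \<le> ?w * ((r + \<epsilon>) ^ ?N - (r - \<epsilon>) ^ ?N)" by simp
    then have "ennreal (?w * ((r + \<epsilon>) ^ ?N - (r - \<epsilon>) ^ ?N)) / ennreal (2 * \<epsilon>) = ennreal (?w * ((r + \<epsilon>) ^ ?N - (r - \<epsilon>) ^ ?N) / (2 * \<epsilon>))"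
      using \<epsilon> by (intro divide_ennreal) auto
    ultimately show ?thesis by (simp only:)
  qed
  let ?g = "\<lambda>\<epsilon>. ?w * ((r + \<epsilon>) ^ ?N - (r - \<epsilon>) ^ ?N) / (2 * \<epsilon>)"
  have "(?g \<longlongrightarrow> real ?N / r * rvol (ball c r)) (at_right 0)"
  proof -
    let ?f = "\<lambda>\<epsilon>. ?w * ((r + \<epsilon>) ^ ?N - (r - \<epsilon>) ^ ?N)"
    have "(?f has_real_derivative (?w * (2 * (real ?N * r ^ (?N - 1))))) (at 0)"
      using r by (auto intro!: derivative_eq_intros simp: field_simps)
    then have "((\<lambda>h. (?f (0 + h) - ?f 0) / h) \<longlongrightarrow> ?w * (2 * (real ?N * r ^ (?N - 1)))) (at 0)" by (simp add: DERIV_def)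
    then have "((\<lambda>h. (?f h / h) / 2) \<longlongrightarrow> (?w * (2 * (real ?N * r ^ (?N - 1)))) / 2) (at 0)" by (intro tendsto_divide tendsto_const) auto
    moreover have "(?w * (2 * (real ?N * r ^ (?N - 1)))) / 2 = ?w * (real ?N * r ^ (?N - 1))" by simp
    moreover have "(?f h / h) / 2 = ?g h" for h by (simp only: divide_divide_eq_left mult.commute[of h 2])
    ultimately have "(?g \<longlongrightarrow> ?w * (real ?N * r ^ (?N - 1))) (at 0)" by (simp only:)
    moreover have "?w * (real ?N * r ^ (?N - 1)) = real ?N / r * rvol (ball c r)"
      using r DIM_positive[where 'a='a] by (simp add: content_ball power_eq_if)
    ultimately have "(?g \<longlongrightarrow> real ?N / r * rvol (ball c r)) (at 0)" by (simp only:)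
    then show ?thesis by (rule filterlim_mono[OF _ order_refl at_le]) simp
  qed
  then have "Liminf (at_right 0) (\<lambda>\<epsilon>. ennreal (?g \<epsilon>)) = ennreal (real ?N / r * rvol (ball c r))"
    by (intro lim_imp_Liminf tendsto_ennrealI) simp_all
  moreover have "Liminf (at_right 0) (\<lambda>\<epsilon>. ennreal (?g \<epsilon>)) \<le> codim1_volume (frontier (ball c r))"
    unfolding codim1_volume_eq fr
  proof (rule Liminf_mono, rule eventually_mono[OF eventually_at_right_real[OF r]])
    fix \<epsilon> assume "\<epsilon> \<in> {0<..<r}"
    then have "0 < \<epsilon>" "\<epsilon> < r" by simp_all
    then show "ennreal (?g \<epsilon>) \<le> vol (tube (sphere c r) \<epsilon>) / ennreal (2 * \<epsilon>)"
      by (rule main)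
  qed
  ultimately show ?thesis by (simp only:)
qed

section \<open>Boundary measure and inradius of convex bodies\<close>

theorem theorem3p2:
  fixes K :: "'a::euclidean_space set"
  assumes "convex_body K"
  shows "codim1_volume (frontier K) = hausdorff_measure (DIM('a) - 1) (frontier K) \<and>
    codim1_volume (frontier K) \<le> ennreal (real DIM('a) / inradius K) * emeasure lebesgue K \<and>
    (strictly_convex K \<or> C1_hypersurface (frontier K) \<longrightarrow>
      (codim1_volume (frontier K) = ennreal (real DIM('a) / inradius K) * emeasure lebesgue K
        \<longleftrightarrow> (\<exists>c r. 0 < r \<and> K = ball c r)))"
proof -
  note K = \<open>convex_body K\<close>
  obtain c where r: "inradius K > 0" "ball c (inradius K) \<subseteq> K" and max: "\<And>x \<rho>. ball x \<rho> \<subseteq> K \<Longrightarrow> \<rho> \<le> inradius K"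
    using inradius_attained[OF K] by blast
  have bK: "bounded K" "open K" using K by (auto simp: convex_body_def)
  have vol_eq: "ennreal (real DIM('a) / inradius K) * emeasure lebesgue K = ennreal (real DIM('a) / inradius K * rvol K)"
  proof -
    have "emeasure lebesgue K = vol K" using bK by simp
    also have "\<dots> = ennreal (rvol K)"
      using emeasure_bounded_finite[OF bK(1)] by (intro emeasure_eq_ennreal_measure) simp
    finally have e: "emeasure lebesgue K = ennreal (rvol K)" .
    show ?thesis unfolding e using r(1) by (intro ennreal_mult[symmetric]) auto
  qed
  have upper: "codim1_volume (frontier K) \<le> ennreal (real DIM('a) / inradius K * rvol K)"
    using codim1_upper_bound[OF K r order_refl compact_empty, of 1] by simp
  have rigid: "K = ball c (inradius K)"
    if cond: "strictly_convex K \<or> C1_hypersurface (frontier K)"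
      and eq: "codim1_volume (frontier K) = ennreal (real DIM('a) / inradius K * rvol K)"
  proof -
    have touch: "\<exists>u. norm u = 1 \<and> (\<forall>y\<in>closure K. u \<bullet> y \<le> u \<bullet> x) \<and> u \<bullet> (x - c) = inradius K" if "x \<in> frontier K" for x
      by (rule equality_touching[OF K r _ that]) (use eq in auto)
    from cond show ?thesis
      using strictly_convex_touching_ball[OF K r _ touch] C1_touching_ball[OF K r _ touch] by blast
  qed
  have ball: "codim1_volume (frontier K) = ennreal (real DIM('a) / inradius K * rvol K)"
    if K': "K = ball a s" and s: "0 < s" for a s
  proof -
    have "s \<le> inradius K" using max[of a s] K' by simp
    moreover have "inradius K \<le> s"
      using r unfolding K' ball_subset_ball_iff using zero_le_dist[of c a] by linarith
    ultimately have "inradius K = s" by simp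
    then have "ennreal (real DIM('a) / inradius K * rvol K) \<le> codim1_volume (frontier K)"
      using codim1_volume_sphere_ge[OF s, of a] K' by simp
    with upper show ?thesis by (rule antisym)
  qed
  show ?thesis
    unfolding vol_eq using codim1_volume_eq_hausdorff[OF K] upper rigid ball r(1) by blast
qed

end
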